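(* Let $n\ge 2$, let $\Omega,\Omega^*\subset\mathbb{R}^n$ be bounded domains, let $f\in C^{1,1}(\Omega)$ and $g\in C^{1,1}(\Omega^* )$ have positive upper and lower bounds, and suppose $\int_\Omega f(x)\,dx=\int_{\Omega^*}g(y)\,dy$. For $\varepsilon\in(0,1]$ let $c_\varepsilon(x,y)=\sqrt{\varepsilon^2+|x-y|^2}$. Let $u\in C^{3,1}(\Omega)$ be a $c_\varepsilon$-concave solution of $$\det (w_{ij})=\frac{\varepsilon^2}{L^{n+2}}\,\frac{f}{g\circ T}\quad\text{in }\Omega ,$$ where $L$, $T:\Omega\to\Omega^*$, $A_{ij}$, $w_{ij}$ are built from $u$ and $\varepsilon$ as in the context, and let $W=\sum_{\alpha,\beta=1}^n A^{\alpha\beta}w_{\alpha\beta}$. Then for every $x\in\Omega$ $$W(x)\le C,$$ where $C$ depends on $n$, $\mathrm{dist}(x,\partial\Omega)$, $f$ and $g$ (and on their domains $\Omega,\Omega^*$), but is independent of $\varepsilon\in(0,1]$ and of $u$. That is: given $n,\Omega,\Omega^*,f,g$ and $\delta>0$ there is a constant $C$ such that $W(x)\le C$ for all $\varepsilon\in(0,1]$, all such $u$, and all $x\in\Omega$ with $\mathrm{dist}(x,\partial\Omega)\ge\delta$.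
   Context: A function $u:\Omega\to\mathbb{R}$ is $c_\varepsilon$-concave if $u(x)=\inf_{y\in\Omega^*}\{c_\varepsilon(x,y)-\psi(y)\}$ for some function $\psi$ on $\Omega^*$. For differentiable $c_\varepsilon$-concave $u$ one has $|Du|<1$, and one sets $$L(x)=\frac{\varepsilon}{\sqrt{1-|Du(x)|^2}},\qquad T(x)=x-L(x)Du(x),$$ so that $D_xc_\varepsilon(x,T(x))=Du(x)$ and $L(x)=\sqrt{\varepsilon^2+|x-T(x)|^2}$. $T$ is the optimal mapping, with values in $\Omega^*$. Further, $$A_{ij}=\frac1L(\delta_{ij}-D_iu\,D_ju),\qquad w_{ij}=A_{ij}-D^2_{ij}u .$$ The matrix $(A_{ij})$ is positive definite, with inverse $A^{ij}=L\big(\delta_{ij}+\frac{L^2}{\varepsilon^2}D_iu\,D_ju\big)$; $(w_{ij})$ is symmetric and nonnegative. $C^{1,1}$ means continuously differentiable with bounded, Lipschitz first derivatives; $C^{3,1}(\Omega)$ means $C^3$ with locally Lipschitz third derivatives. *)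

theory Defs
  imports "HOL-Analysis.Analysis"
begin

(* All functions are total on real^'n; only their values on the relevant open set matter. *)

definition domain_set :: "(real^'n) set \<Rightarrow> bool" where
  "domain_set S \<longleftrightarrow> open S \<and> connected S \<and> S \<noteq> {}"

definition partial :: "'n \<Rightarrow> (real^'n \<Rightarrow> real) \<Rightarrow> real^'n \<Rightarrow> real" where
  "partial i u x = frechet_derivative u (at x) (axis i 1)"

definition grad :: "(real^'n \<Rightarrow> real) \<Rightarrow> real^'n \<Rightarrow> real^'n" where
  "grad u x = (\<chi> i. partial i u x)"

definition hessian :: "(real^'n \<Rightarrow> real) \<Rightarrow> real^'n \<Rightarrow> real^'n^'n" where
  "hessian u x = (\<chi> i j. partial j (partial i u) x)"

(* u is of class C^k on the (open) set S *)
primrec Ck_on :: "nat \<Rightarrow> (real^'n) set \<Rightarrow> (real^'n \<Rightarrow> real) \<Rightarrow> bool" where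
  "Ck_on 0 S u \<longleftrightarrow> continuous_on S u"
| "Ck_on (Suc k) S u \<longleftrightarrow> (\<forall>x\<in>S. u differentiable (at x)) \<and> (\<forall>i. Ck_on k S (partial i u))"

definition C11_on :: "(real^'n) set \<Rightarrow> (real^'n \<Rightarrow> real) \<Rightarrow> bool" where
  "C11_on S u \<longleftrightarrow> Ck_on 1 S u \<and>
     (\<forall>i. bounded (partial i u ` S) \<and> (\<exists>K. K-lipschitz_on S (partial i u)))"

definition locally_lipschitz_on :: "(real^'n) set \<Rightarrow> (real^'n \<Rightarrow> real) \<Rightarrow> bool" where
  "locally_lipschitz_on S v \<longleftrightarrow> (\<forall>x\<in>S. \<exists>r>0. \<exists>K. K-lipschitz_on (ball x r \<inter> S) v)"

definition C31_on :: "(real^'n) set \<Rightarrow> (real^'n \<Rightarrow> real) \<Rightarrow> bool" where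
  "C31_on S u \<longleftrightarrow> Ck_on 3 S u \<and>
     (\<forall>i j k. locally_lipschitz_on S (partial k (partial j (partial i u))))"

definition cost :: "real \<Rightarrow> real^'n \<Rightarrow> real^'n \<Rightarrow> real" where
  "cost \<epsilon> x y = sqrt (\<epsilon>\<^sup>2 + (norm (x - y))\<^sup>2)"

(* The bdd_below clause says that the infimum is finite; INF alone would be an
   unspecified real number if the set were unbounded below. *)
definition cost_concave ::
    "real \<Rightarrow> (real^'n) set \<Rightarrow> (real^'n) set \<Rightarrow> (real^'n \<Rightarrow> real) \<Rightarrow> bool" where
  "cost_concave \<epsilon> \<Omega> \<Omega>' u \<longleftrightarrow>
     (\<exists>\<psi>. \<forall>x\<in>\<Omega>. bdd_below ((\<lambda>y. cost \<epsilon> x y - \<psi> y) ` \<Omega>') \<and>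
                u x = (INF y\<in>\<Omega>'. cost \<epsilon> x y - \<psi> y))"

definition Lfun :: "real \<Rightarrow> (real^'n \<Rightarrow> real) \<Rightarrow> real^'n \<Rightarrow> real" where
  "Lfun \<epsilon> u x = \<epsilon> / sqrt (1 - (norm (grad u x))\<^sup>2)"

definition Tmap :: "real \<Rightarrow> (real^'n \<Rightarrow> real) \<Rightarrow> real^'n \<Rightarrow> real^'n" where
  "Tmap \<epsilon> u x = x - Lfun \<epsilon> u x *\<^sub>R grad u x"

definition Amat :: "real \<Rightarrow> (real^'n \<Rightarrow> real) \<Rightarrow> real^'n \<Rightarrow> real^'n^'n" where
  "Amat \<epsilon> u x = (\<chi> i j. 1 / Lfun \<epsilon> u x *
     ((if i = j then 1 else 0) - partial i u x * partial j u x))"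

definition wmat :: "real \<Rightarrow> (real^'n \<Rightarrow> real) \<Rightarrow> real^'n \<Rightarrow> real^'n^'n" where
  "wmat \<epsilon> u x = Amat \<epsilon> u x - hessian u x"

(* Upper indices on A denote entries of the inverse matrix. *)
definition Wfun :: "real \<Rightarrow> (real^'n \<Rightarrow> real) \<Rightarrow> real^'n \<Rightarrow> real" where
  "Wfun \<epsilon> u x = (\<Sum>\<alpha>\<in>UNIV. \<Sum>\<beta>\<in>UNIV.
     matrix_inv (Amat \<epsilon> u x) $ \<alpha> $ \<beta> * wmat \<epsilon> u x $ \<alpha> $ \<beta>)"

end

theory Submission
  imports Defs
begin

text \<open>The graph of \<open>u\<close> is a spacelike hypersurface of Minkowski space with induced metric
  \<open>g = I - Du Du\<^sup>T\<close>, and \<open>L w = g - \<epsilon> h\<close> is a Codazzi tensor, where \<open>h\<close> is the second fundamental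
  form; the equation prescribes \<open>det (L w) / det g = f / (g \<circ> T)\<close>. At an interior maximum of
  \<open>\<rho>\<^sup>2 w(\<xi>,\<xi>) / A(\<xi>,\<xi>)\<close> with the cutoff \<open>\<rho> = R\<^sup>2 - |x - c|\<^sup>2\<close>, let \<open>\<lambda>\<close> be the largest eigenvalue of
  \<open>A\<^sup>-\<^sup>1 w\<close>, \<open>\<sigma>\<close> the sum of the eigenvalues and \<open>r\<close> the sum of their inverses. Interchanging covariant
  derivatives contributes \<open>- (L / \<epsilon>\<^sup>2) (\<lambda> - 1) (\<lambda> r - n \<lambda> - n + \<sigma>)\<close>, and all other terms are of size
  \<open>(L / \<epsilon>\<^sup>2) (\<lambda>\<^sup>2 + \<lambda> r / \<rho>\<^sup>2)\<close>. So \<open>\<lambda> \<rho>\<^sup>2\<close> is bounded if \<open>r\<close> is large, while for bounded \<open>r\<close> the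
  eigenvalues are bounded because their product is \<open>f / (g \<circ> T)\<close>.

  Since \<open>w(\<xi>,\<xi>)\<close> need not be twice differentiable, \<open>D\<^sup>2u(\<xi>,\<xi>)\<close> is replaced by a second difference
  quotient with step \<open>h\<close>, and the concavity of \<open>ln det\<close> is used for the three points \<open>x\<close>, \<open>x \<plusminus> h\<xi>\<close>
  instead of differentiating the equation twice. The limit \<open>h \<rightarrow> 0\<close> is an inequality between
  derivatives of \<open>u\<close> of order at most three at the maximum.\<close>

section \<open>Linear algebra\<close>

text \<open>Uniformity in \<epsilon> rests on one scaling: once the third derivatives are
  eliminated, every term of the inequality at the maximum is bounded by
  \<open>1 / (\<epsilon> * s)\<close>, that is \<open>L / \<epsilon>\<^sup>2\<close>, times a
  quantity that depends on \<epsilon> only through \<open>L\<close>. The common factor divides out,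
  and \<open>L\<^sup>2 = \<epsilon>\<^sup>2 + |x - T x|\<^sup>2\<close> is controlled by the size of
  the domains. The third derivatives are removed by identities, not estimated:
  \<open>D\<^sup>3u(\<xi>,\<xi>)\<close> is fixed by the first-order condition in \<open>x\<close>,
  the sum of \<open>D\<^sup>3u(f i, f i) / l i\<close> by the differentiated equation, and the
  remaining sums over the components of \<open>q\<close> cancel. In the difference quotient the
  place of fourth derivatives is taken by values of \<open>D\<^sup>2u\<close> at \<open>x\<close>
  and \<open>x \<plusminus> h \<xi>\<close>. These are values of \<open>A - w\<close>, where
  \<open>A\<close> can be differentiated explicitly and \<open>w\<close> is compared through its
  determinant. Only a lower bound for the second difference of \<open>ln det w\<close> is called
  for, and Lipschitz gradients of \<open>ln f\<close> and \<open>ln g\<close> provide one.\<close>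

lemma linear_coeff_zero:
  fixes b c :: real
  assumes "\<And>t. 0 \<le> 2 * t * b + t\<^sup>2 * c"
  shows "b = 0"
proof (rule ccontr)
  assume b: "b \<noteq> 0"
  \<comment> \<open>\<open>d\<close> only has to be positive and larger than \<open>c\<close>: then
    the test value \<open>t = - b / d\<close> gives
    \<open>b\<^sup>2 / d * (c / d - 2) < 0\<close>.\<close>
  define d where "d = \<bar>c\<bar> + 1"
  have d: "d > 0" "c < d" by (auto simp: d_def)
  have "0 \<le> 2 * (- b / d) * b + (- b / d)\<^sup>2 * c" by (rule assms)
  also have "\<dots> = (b\<^sup>2 / d) * (c / d - 2)" using d by (simp add: field_simps power2_eq_square)
  finally have "0 \<le> (b\<^sup>2 / d) * (c / d - 2)" .
  moreover have "b\<^sup>2 / d > 0" using b d by simp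
  moreover have "c / d - 2 < 0" using d by (simp add: field_simps)
  ultimately show False using mult_pos_neg[of "b\<^sup>2 / d" "c / d - 2"] by linarith
qed

lemma symmetric_matrix_inner:
  fixes A :: "real^'n^'n"
  assumes "transpose A = A"
  shows "x \<bullet> (A *v y) = y \<bullet> (A *v x)"
  by (metis assms dot_lmul_matrix inner_commute transpose_matrix_vector)

lemma quadratic_form_add:
  fixes A :: "real^'n^'n"
  assumes "transpose A = A"
  shows "(x + t *\<^sub>R y) \<bullet> (A *v (x + t *\<^sub>R y)) = x \<bullet> (A *v x) + 2 * t * (y \<bullet> (A *v x)) + t\<^sup>2 * (y \<bullet> (A *v y))"
  using symmetric_matrix_inner[OF assms, of x y]
  by (simp add: matrix_vector_right_distrib matrix_vector_mult_scaleR inner_add_left inner_add_right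
      power2_eq_square algebra_simps)

text \<open>A zero of a nonnegative form is a minimum of it: along \<open>x + t *\<^sub>R y\<close>
  the form is a quadratic polynomial in \<open>t\<close> without constant term, so its linear
  coefficient vanishes for every \<open>y\<close>.\<close>

lemma psd_zero_vector:
  fixes A :: "real^'n^'n"
  assumes sym: "transpose A = A" and psd: "\<And>v. 0 \<le> v \<bullet> (A *v v)" and z: "x \<bullet> (A *v x) = 0"
  shows "A *v x = 0"
proof -
  have "y \<bullet> (A *v x) = 0" for y
    by (rule linear_coeff_zero[where c = "y \<bullet> (A *v y)"])
       (use psd[of "x + t *\<^sub>R y" for t] z in \<open>simp add: quadratic_form_add[OF sym]\<close>)
  then show ?thesis by (metis inner_eq_zero_iff)
qed

section \<open>Simultaneous diagonalisation of two quadratic forms\<close>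

definition pos_def :: "real^'n^'n \<Rightarrow> bool" where
  "pos_def A \<longleftrightarrow> transpose A = A \<and> (\<forall>v. v \<noteq> 0 \<longrightarrow> 0 < v \<bullet> (A *v v))"

lemma pos_defD:
  assumes "pos_def A"
  shows "transpose A = A" "v \<noteq> 0 \<Longrightarrow> 0 < v \<bullet> (A *v v)" "0 \<le> v \<bullet> (A *v v)"
  using assms by (cases "v = 0"; auto simp: pos_def_def less_imp_le)+

text \<open>Induction on the dimension: maximise the Rayleigh quotient of \<open>w\<close> relative
  to \<open>A\<close> on the unit sphere of \<open>V\<close>, split off the maximiser, and continue
  in its \<open>A\<close>-orthogonal complement inside \<open>V\<close>. Recursing on subspaces
  keeps \<open>A\<close> and \<open>w\<close> fixed.\<close>

lemma simultaneous_diag_subspace: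
  fixes A w :: "real^'n^'n"
  assumes A: "pos_def A" and w: "transpose w = w"
  shows "subspace V \<Longrightarrow> dim V = k \<Longrightarrow> \<exists>B. B \<subseteq> V \<and> finite B \<and> card B = k \<and>
     (\<forall>b\<in>B. b \<bullet> (A *v b) = 1) \<and> (\<forall>b\<in>B. \<forall>c\<in>B. b \<noteq> c \<longrightarrow> b \<bullet> (A *v c) = 0 \<and> b \<bullet> (w *v c) = 0)"
proof (induction k arbitrary: V)
  case 0
  then show ?case by (intro exI[of _ "{}"]) auto
next
  case (Suc k)
  note Asym = pos_defD(1)[OF A] and Apos = pos_defD(2)[OF A]
  let ?K = "V \<inter> sphere 0 1"
  have "V \<noteq> {0}" using Suc.prems by auto
  then obtain x where x: "x \<in> V" "x \<noteq> 0" using subspace_0[OF Suc.prems(1)] by auto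
  then have "(1 / norm x) *\<^sub>R x \<in> ?K" using subspace_scale[OF Suc.prems(1)] by auto
  then have ne: "?K \<noteq> {}" by blast
  have cpt: "compact ?K" by (intro closed_Int_compact closed_subspace Suc.prems compact_sphere)
  let ?q = "\<lambda>v. (v \<bullet> (w *v v)) / (v \<bullet> (A *v v))"
  have cont: "continuous_on ?K ?q"
  proof (intro continuous_intros matrix_vector_mult_linear_continuous_on ballI)
    fix v assume "v \<in> ?K"
    then have "v \<noteq> 0" by auto
    then show "v \<bullet> (A *v v) \<noteq> 0" using Apos[of v] by simp
  qed
  obtain y where y: "y \<in> ?K" "\<And>v. v \<in> ?K \<Longrightarrow> ?q v \<le> ?q y"
    using continuous_attains_sup[OF cpt ne cont] by blast
  define m where "m = ?q y"
  have y0: "y \<noteq> 0" "y \<in> V" using y by auto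
  \<comment> \<open>On \<open>V\<close> the form of \<open>m A - w\<close> is nonnegative and
    vanishes at \<open>y\<close>, so \<open>M *v y\<close> is orthogonal to \<open>V\<close>. For
    vectors of \<open>V\<close> that are \<open>A\<close>-orthogonal to \<open>y\<close>,
    orthogonality with respect to \<open>w\<close> follows.\<close>
  define M where "M = m *\<^sub>R A - w"
  have Msym: "transpose M = M" using Asym w
    by (simp add: M_def transpose_def vec_eq_iff)
  have Mq: "a \<bullet> (M *v v) = m * (a \<bullet> (A *v v)) - a \<bullet> (w *v v)" for a v
    by (simp add: M_def matrix_vector_mult_diff_rdistrib inner_diff_right scaleR_matrix_vector_assoc [symmetric])
  have Mpos: "0 \<le> v \<bullet> (M *v v)" if "v \<in> V" for v
  proof (cases "v = 0")
    case False
    define z where "z = (1 / norm v) *\<^sub>R v"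
    have z: "z \<in> ?K" using that False subspace_scale[OF Suc.prems(1)] by (auto simp: z_def)
    have vz: "v = norm v *\<^sub>R z" using False by (simp add: z_def)
    have "?q z \<le> m" using y(2)[OF z] by (simp add: m_def)
    moreover have "0 < z \<bullet> (A *v z)" using z by (intro Apos) auto
    ultimately have "0 \<le> z \<bullet> (M *v z)" by (simp add: Mq field_simps)
    then have "0 \<le> (norm v * norm v) * (z \<bullet> (M *v z))" by simp
    also have "\<dots> = v \<bullet> (M *v v)" by (subst (3 4) vz) (simp add: matrix_vector_mult_scaleR)
    finally show ?thesis .
  qed simp
  have My: "y \<bullet> (M *v y) = 0" using Apos[OF y0(1)] by (simp add: Mq m_def)
  have Mv: "v \<bullet> (M *v y) = 0" if "v \<in> V" for v
  proof (rule linear_coeff_zero[where c = "v \<bullet> (M *v v)"])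
    fix t
    have "y + t *\<^sub>R v \<in> V" using y0 that Suc.prems(1) by (simp add: subspace_add subspace_scale)
    from Mpos[OF this] show "0 \<le> 2 * t * (v \<bullet> (M *v y)) + t\<^sup>2 * (v \<bullet> (M *v v))"
      using My by (simp add: quadratic_form_add[OF Msym])
  qed
  define c where "c = y \<bullet> (A *v y)"
  have c: "c > 0" unfolding c_def by (rule Apos[OF y0(1)])
  define e where "e = (1 / sqrt c) *\<^sub>R y"
  have e1: "e \<bullet> (A *v e) = 1"
    using c by (simp add: e_def matrix_vector_mult_scaleR c_def[symmetric])
  have eV: "e \<in> V" using y0 Suc.prems(1) by (simp add: e_def subspace_scale)
  have eM: "v \<bullet> (M *v e) = 0" if "v \<in> V" for v
    using Mv[OF that] by (simp add: e_def matrix_vector_mult_scaleR)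
  define V' where "V' = {v \<in> V. v \<bullet> (A *v e) = 0}"
  have sV': "subspace V'" using Suc.prems(1)
    by (auto simp: V'_def subspace_def inner_add_left)
  have e_nin: "e \<notin> V'" using e1 by (simp add: V'_def)
  have "span (insert e V') = V"
  proof
    show "span (insert e V') \<subseteq> V" using eV Suc.prems(1) by (intro span_minimal) (auto simp: V'_def)
    show "V \<subseteq> span (insert e V')"
    proof
      fix v assume v: "v \<in> V"
      have "v - (v \<bullet> (A *v e)) *\<^sub>R e \<in> V'"
        using v eV e1 Suc.prems(1) by (simp add: V'_def subspace_diff subspace_scale inner_diff_left)
      then show "v \<in> span (insert e V')"
        by (metis insertCI span_base span_breakdown_eq)
    qed
  qed
  then have "dim V = dim (insert e V')" by (metis dim_span)
  also have "\<dots> = dim V' + 1" using dim_insert[of e V'] e_nin sV' by (metis span_eq_iff)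
  finally have "dim V' = k" using Suc.prems by simp
  from Suc.IH[OF sV' this] obtain B where B: "B \<subseteq> V'" "finite B" "card B = k"
     "\<forall>b\<in>B. b \<bullet> (A *v b) = 1" "\<forall>b\<in>B. \<forall>c\<in>B. b \<noteq> c \<longrightarrow> b \<bullet> (A *v c) = 0 \<and> b \<bullet> (w *v c) = 0" by blast
  have Be: "b \<bullet> (A *v e) = 0 \<and> b \<bullet> (w *v e) = 0" if "b \<in> B" for b
    using eM[of b] that B(1) Mq[of b e] by (auto simp: V'_def)
  have Be': "e \<bullet> (A *v b) = 0 \<and> e \<bullet> (w *v b) = 0" if "b \<in> B" for b
    using Be[OF that] symmetric_matrix_inner[OF Asym, of e b] symmetric_matrix_inner[OF w, of e b] by simp
  have "e \<notin> B" using e_nin B(1) by blast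
  then show ?case
    using B eV e1 Be Be' by (intro exI[of _ "insert e B"]) (auto simp: V'_def)
qed

lemma simultaneous_diag:
  fixes A w :: "real^'n^'n"
  assumes "pos_def A" "transpose w = w"
  obtains f :: "'n \<Rightarrow> real^'n" and l where
    "\<And>i j. f i \<bullet> (A *v f j) = (if i = j then 1 else 0)"
    "\<And>i j. f i \<bullet> (w *v f j) = (if i = j then l i else 0)"
proof -
  obtain B :: "(real^'n) set" where B: "finite B" "card B = CARD('n)" "\<forall>b\<in>B. b \<bullet> (A *v b) = 1"
    "\<forall>b\<in>B. \<forall>c\<in>B. b \<noteq> c \<longrightarrow> b \<bullet> (A *v c) = 0 \<and> b \<bullet> (w *v c) = 0"
    using simultaneous_diag_subspace[OF assms subspace_UNIV refl] by auto
  then obtain f where f: "bij_betw f (UNIV::'n set) B"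
    using finite_same_card_bij[of "UNIV :: 'n set" B] by auto
  then have fB: "f i \<in> B" and inj: "f i = f j \<longleftrightarrow> i = j" for i j
    by (auto simp: bij_betw_def inj_on_def)
  show thesis
    by (rule that[of f "\<lambda>i. f i \<bullet> (w *v f i)"]) (use B fB inj in auto)
qed

section \<open>Frames that are orthonormal for a positive definite form\<close>

definition of_columns :: "('n \<Rightarrow> real^'n) \<Rightarrow> real^'n^'n" where
  "of_columns f = (\<chi> i j. f j $ i)"

lemma congruence_entry:
  fixes M :: "real^'n^'n"
  shows "(transpose (of_columns f) ** M ** of_columns f) $ i $ j = f i \<bullet> (M *v f j)"
proof -
  have "(transpose (of_columns f) ** M ** of_columns f) $ i $ j
      = (\<Sum>b\<in>UNIV. \<Sum>a\<in>UNIV. f i $ a * M $ a $ b * f j $ b)"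
    by (simp add: matrix_matrix_mult_def transpose_def of_columns_def sum_distrib_right)
  also have "\<dots> = (\<Sum>a\<in>UNIV. \<Sum>b\<in>UNIV. f i $ a * M $ a $ b * f j $ b)" by (rule sum.swap)
  also have "\<dots> = f i \<bullet> (M *v f j)"
    by (simp add: matrix_vector_mult_def inner_vec_def sum_distrib_left mult.assoc)
  finally show ?thesis .
qed

text \<open>One-sided inverses of square matrices are two-sided, so the frame supplies the inverse
  of \<open>A\<close>; traces against that inverse are computed through it.\<close>

lemma orthonormal_columns:
  fixes f :: "'n \<Rightarrow> real^'n" and A :: "real^'n^'n"
  assumes "\<And>i j. f i \<bullet> (A *v f j) = (if i = j then 1 else 0)"
  shows "transpose (of_columns f) ** A ** of_columns f = mat 1"
    and "of_columns f ** transpose (of_columns f) ** A = mat 1"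
    and "A ** (of_columns f ** transpose (of_columns f)) = mat 1"
proof -
  show 1: "transpose (of_columns f) ** A ** of_columns f = mat 1"
    by (simp add: vec_eq_iff congruence_entry assms mat_def)
  then have "of_columns f ** (transpose (of_columns f) ** A) = mat 1"
    by (simp add: matrix_left_right_inverse)
  then show 2: "of_columns f ** transpose (of_columns f) ** A = mat 1"
    by (simp add: matrix_mul_assoc)
  then show "A ** (of_columns f ** transpose (of_columns f)) = mat 1"
    by (simp add: matrix_left_right_inverse)
qed

text \<open>The vectors \<open>A *v f i\<close> form the basis dual to the frame. The expansion
  serves for covectors such as gradients, which are known through their values on the frame.\<close>

lemma orthonormal_dual_expansion:
  fixes f :: "'n \<Rightarrow> real^'n" and A :: "real^'n^'n"
  assumes "\<And>i j. f i \<bullet> (A *v f j) = (if i = j then 1 else 0)"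
  shows "v = (\<Sum>i\<in>UNIV. (v \<bullet> f i) *\<^sub>R (A *v f i))"
proof -
  let ?F = "of_columns f"
  have "v = A *v (?F *v (transpose ?F *v v))"
    using orthonormal_columns(3)[OF assms] by (metis matrix_vector_mul_assoc matrix_vector_mul_lid)
  also have "transpose ?F *v v = (\<chi> i. v \<bullet> f i)"
    by (simp add: vec_eq_iff matrix_vector_mult_def transpose_def of_columns_def inner_vec_def mult.commute)
  also have "?F *v (\<chi> i. v \<bullet> f i) = (\<Sum>i\<in>UNIV. (v \<bullet> f i) *\<^sub>R f i)"
    by (simp add: vec_eq_iff matrix_vector_mult_def of_columns_def mult.commute)
  also have "A *v \<dots> = (\<Sum>i\<in>UNIV. (v \<bullet> f i) *\<^sub>R (A *v f i))"
    by (simp add: linear_sum[OF matrix_vector_mul_linear] matrix_vector_mult_scaleR)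
  finally show ?thesis .
qed

text \<open>Both sums are the trace of \<open>Y\<close> against the inverse of \<open>A\<close>,
  which every \<open>A\<close>-orthonormal frame represents as frame matrix times its
  transpose.\<close>

lemma trace_frame_independent:
  fixes f g :: "'n \<Rightarrow> real^'n" and A Y :: "real^'n^'n"
  assumes f: "\<And>i j. f i \<bullet> (A *v f j) = (if i = j then 1 else 0)"
    and g: "\<And>i j. g i \<bullet> (A *v g j) = (if i = j then 1 else 0)"
  shows "(\<Sum>i\<in>UNIV. f i \<bullet> (Y *v f i)) = (\<Sum>i\<in>UNIV. g i \<bullet> (Y *v g i))"
proof -
  let ?F = "of_columns f" and ?G = "of_columns g"
  have eq: "?F ** transpose ?F = ?G ** transpose ?G"
    by (metis orthonormal_columns(2)[OF f] orthonormal_columns(3)[OF g] matrix_mul_assoc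
        matrix_mul_lid matrix_mul_rid)
  have tr: "(\<Sum>i\<in>UNIV. h i \<bullet> (Y *v h i)) = trace (Y ** (of_columns h ** transpose (of_columns h)))"
    for h :: "'n \<Rightarrow> real^'n"
  proof -
    have "(\<Sum>i\<in>UNIV. h i \<bullet> (Y *v h i)) = trace (transpose (of_columns h) ** Y ** of_columns h)"
      by (simp add: trace_def congruence_entry)
    also have "\<dots> = trace (of_columns h ** (transpose (of_columns h) ** Y))" by (rule trace_mul_sym)
    also have "\<dots> = trace (Y ** (of_columns h ** transpose (of_columns h)))"
      by (metis matrix_mul_assoc trace_mul_sym)
    finally show ?thesis .
  qed
  show ?thesis unfolding tr eq ..
qed

text \<open>The squared determinant of the frame matrix is the same factor in the congruences for
  \<open>w\<close> and for \<open>A\<close>, hence cancels.\<close>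

lemma det_diag_frame:
  fixes f :: "'n \<Rightarrow> real^'n" and A :: "real^'n^'n"
  assumes f: "\<And>i j. f i \<bullet> (A *v f j) = (if i = j then 1 else 0)"
    and w: "\<And>i j. f i \<bullet> (w *v f j) = (if i = j then l i else 0)"
  shows "det w = det A * (\<Prod>i\<in>UNIV. l i)" "det A \<noteq> 0"
proof -
  let ?F = "of_columns f"
  have "det (transpose ?F ** w ** ?F) = (\<Prod>i\<in>UNIV. (transpose ?F ** w ** ?F) $ i $ i)"
    by (rule det_diagonal) (simp add: congruence_entry w)
  then have 1: "det ?F * det ?F * det w = (\<Prod>i\<in>UNIV. l i)"
    by (simp add: congruence_entry w det_mul mult_ac)
  have "det (transpose ?F ** A ** ?F) = 1" by (simp add: orthonormal_columns(1)[OF f])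
  then have 2: "det ?F * det ?F * det A = 1" by (simp add: det_mul mult_ac)
  then show "det A \<noteq> 0" by auto
  have "det w = (det ?F * det ?F * det A) * det w" by (simp only: 2 mult_1)
  also have "\<dots> = det A * (det ?F * det ?F * det w)" by (simp only: mult_ac)
  finally show "det w = det A * (\<Prod>i\<in>UNIV. l i)" unfolding 1 .
qed

lemma pos_def_det_pos:
  fixes A :: "real^'n^'n"
  assumes "pos_def A"
  shows "det A > 0"
proof -
  have one: "pos_def (mat 1 :: real^'n^'n)" by (auto simp: pos_def_def)
  obtain f :: "'n \<Rightarrow> real^'n" and l where f: "\<And>i j. f i \<bullet> (mat 1 *v f j) = (if i = j then 1 else 0)"
    "\<And>i j. f i \<bullet> (A *v f j) = (if i = j then l i else 0)"
    using simultaneous_diag[OF one pos_defD(1)[OF assms]] by blast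
  have "f i \<noteq> 0" for i using f(1)[of i i] by auto
  then have "l i > 0" for i using pos_defD(2)[OF assms, of "f i"] f(2)[of i i] by simp
  then show ?thesis using det_diag_frame(1)[OF f] by (simp add: prod_pos)
qed

text \<open>Concavity of \<open>ln det\<close> in tangent form: the eigenvalues \<open>m\<close> of
  \<open>Y\<close> relative to \<open>w\<close> satisfy \<open>ln m \<le> m - 1\<close>. The
  right-hand side is their sum, read off in a frame that diagonalises \<open>w\<close> without being
  normalised for it.\<close>

lemma ln_det_concave:
  fixes f :: "'n \<Rightarrow> real^'n" and w Y :: "real^'n^'n"
  assumes w: "pos_def w" and Y: "pos_def Y"
    and f: "\<And>i j. f i \<bullet> (w *v f j) = (if i = j then l i else 0)" and l: "\<And>i. l i > 0"
  shows "CARD('n) + ln (det Y) - ln (det w) \<le> (\<Sum>i\<in>UNIV. f i \<bullet> (Y *v f i) / l i)"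
proof -
  define h where "h i = (1 / sqrt (l i)) *\<^sub>R f i" for i
  have h: "h i \<bullet> (w *v h j) = (if i = j then 1 else 0)" for i j
    using l[of i] l[of j] by (auto simp: h_def matrix_vector_mult_scaleR f)
  obtain g :: "'n \<Rightarrow> real^'n" and m where g: "\<And>i j. g i \<bullet> (w *v g j) = (if i = j then 1 else 0)"
    "\<And>i j. g i \<bullet> (Y *v g j) = (if i = j then m i else 0)"
    using simultaneous_diag[OF w pos_defD(1)[OF Y]] by blast
  have "g i \<noteq> 0" for i using g(1)[of i i] by auto
  then have m: "m i > 0" for i using pos_defD(2)[OF Y, of "g i"] g(2)[of i i] by simp
  have "ln (det Y) = ln (det w) + (\<Sum>i\<in>UNIV. ln (m i))"
    using m pos_def_det_pos[OF w] unfolding det_diag_frame(1)[OF g]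
    by (simp add: ln_mult prod_pos ln_prod order_less_imp_not_eq2)
  also have "(\<Sum>i\<in>UNIV. ln (m i)) \<le> (\<Sum>i\<in>UNIV. m i - 1)"
    using m by (intro sum_mono ln_le_minus_one) auto
  finally have "CARD('n) + ln (det Y) - ln (det w) \<le> (\<Sum>i\<in>UNIV. m i)" by (simp add: sum_subtractf)
  also have "\<dots> = (\<Sum>i\<in>UNIV. g i \<bullet> (Y *v g i))" by (simp add: g)
  also have "\<dots> = (\<Sum>i\<in>UNIV. h i \<bullet> (Y *v h i))" by (rule trace_frame_independent[OF g(1) h])
  also have "\<dots> = (\<Sum>i\<in>UNIV. f i \<bullet> (Y *v f i) / l i)"
    using l by (intro sum.cong) (auto simp: h_def matrix_vector_mult_scaleR real_sqrt_mult_self less_imp_le)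
  finally show ?thesis .
qed

section \<open>Determinant of a rank-one perturbation of the identity\<close>

definition outer :: "real^'n \<Rightarrow> real^'n \<Rightarrow> real^'n^'n" where
  "outer x y = (\<chi> i j. x $ i * y $ j)"

lemma outer_mult_vec: "outer x y *v v = (y \<bullet> v) *\<^sub>R x"
  by (simp add: outer_def matrix_vector_mult_def vec_eq_iff inner_vec_def sum_distrib_left sum_distrib_right
      mult_ac)

lemma det_replace_row:
  fixes y :: "real^'n"
  shows "det ((\<chi> i. if i = k then y else axis i 1) :: real^'n^'n) = y $ k"
proof -
  have row: "row i (mat 1 :: real^'n^'n) = axis i 1" for i
    by (auto simp: vec_eq_iff row_def mat_def axis_def)
  have "(\<Sum>i\<in>UNIV. y $ i *s axis i 1) = y" by (rule basis_expansion)
  then show ?thesis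
    using cramer_lemma_transpose[of k y "mat 1 :: real^'n^'n"] unfolding row by (simp cong: if_cong)
qed

text \<open>Since row \<open>k\<close> is \<open>y\<close> itself, the multiples of \<open>y\<close>
  added to the other rows can be removed one by one by row operations.\<close>

lemma det_rank_one_aux:
  fixes x y :: "real^'n"
  assumes "finite S" "k \<notin> S"
  shows "det ((\<chi> i. if i = k then y else if i \<in> S then axis i 1 + x $ i *\<^sub>R y else axis i 1) :: real^'n^'n) = y $ k"
  using assms
proof (induction S rule: finite_induct)
  case empty
  show ?case using det_replace_row[of k y] by (simp cong: if_cong)
next
  case (insert a S)
  let ?M = "\<lambda>S. (\<chi> i. if i = k then y else if i \<in> S then axis i 1 + x $ i *\<^sub>R y else axis i 1) :: real^'n^'n"
  have ak: "a \<noteq> k" using insert by auto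
  have "det (\<chi> i. if i = a then row a (?M S) + (x $ a) *s row k (?M S) else row i (?M S)) = det (?M S)"
    using det_row_operation[OF ak, of "?M S" "x $ a"] by simp
  moreover have "(\<chi> i. if i = a then row a (?M S) + (x $ a) *s row k (?M S) else row i (?M S)) = ?M (insert a S)"
    using ak insert by (auto simp: vec_eq_iff row_def)
  ultimately show ?case using insert by simp
qed

text \<open>The perturbation is switched on row by row; linearity of the determinant in the new row
  \<open>a\<close> splits off the summand \<open>x $ a * y $ a\<close>.\<close>

lemma det_rank_one_sum:
  fixes x y :: "real^'n"
  assumes "finite S"
  shows "det ((\<chi> i. if i \<in> S then axis i 1 + x $ i *\<^sub>R y else axis i 1) :: real^'n^'n) = 1 + (\<Sum>i\<in>S. x $ i * y $ i)"
  using assms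
proof (induction S rule: finite_induct)
  case empty
  have "(\<chi> i. axis i 1) = (mat 1 :: real^'n^'n)" by (auto simp: vec_eq_iff mat_def axis_def)
  then show ?case by simp
next
  case (insert a S)
  let ?r = "\<lambda>i. if i \<in> S then axis i 1 + x $ i *\<^sub>R y else axis i (1::real)"
  have "det ((\<chi> i. if i \<in> insert a S then axis i 1 + x $ i *\<^sub>R y else axis i 1) :: real^'n^'n)
     = det ((\<chi> i. if i = a then axis a 1 + x $ a *s y else ?r i) :: real^'n^'n)"
    by (rule arg_cong[of _ _ det]) (auto simp: vec_eq_iff)
  also have "\<dots> = det ((\<chi> i. if i = a then axis a 1 else ?r i) :: real^'n^'n)
       + det ((\<chi> i. if i = a then x $ a *s y else ?r i) :: real^'n^'n)"
    by (rule det_row_add)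
  also have "det ((\<chi> i. if i = a then x $ a *s y else ?r i) :: real^'n^'n)
      = x $ a * det ((\<chi> i. if i = a then y else ?r i) :: real^'n^'n)"
    by (rule det_row_mul)
  also have "det ((\<chi> i. if i = a then y else ?r i) :: real^'n^'n) = y $ a"
    by (rule det_rank_one_aux) (use insert in auto)
  also have "((\<chi> i. if i = a then axis a 1 else ?r i) :: real^'n^'n) = (\<chi> i. ?r i)"
    using insert by (auto simp: vec_eq_iff)
  finally show ?case using insert by simp
qed

lemma det_rank_one:
  fixes x y :: "real^'n"
  shows "det (mat 1 + outer x y) = 1 + x \<bullet> y"
proof -
  have "mat 1 + outer x y = (\<chi> i. if i \<in> UNIV then axis i 1 + x $ i *\<^sub>R y else axis i 1)"
    by (auto simp: vec_eq_iff mat_def axis_def outer_def)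
  then show ?thesis using det_rank_one_sum[of UNIV x y] by (simp add: inner_vec_def)
qed

section \<open>Difference quotients and third-order jets\<close>

text \<open>Taylor's formula is applied to the even function \<open>F t + F (- t)\<close>, whose
  first derivative vanishes at 0; the second-order remainder is then the difference quotient
  itself.\<close>

lemma second_difference_mvt:
  fixes F :: "real \<Rightarrow> real"
  assumes h: "0 < h"
    and d1: "\<And>t. \<bar>t\<bar> \<le> h \<Longrightarrow> (F has_real_derivative F1 t) (at t)"
    and d2: "\<And>t. \<bar>t\<bar> \<le> h \<Longrightarrow> (F1 has_real_derivative F2 t) (at t)"
  shows "\<exists>\<theta>. \<bar>\<theta>\<bar> \<le> h \<and> (F h + F (- h) - 2 * F 0) / h\<^sup>2 = (F2 \<theta> + F2 (- \<theta>)) / 2"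
proof -
  define diff where "diff m = (if m = 0 then (\<lambda>t. F t + F (- t)) else if m = (1::nat) then (\<lambda>t. F1 t - F1 (- t))
      else (\<lambda>t. F2 t + F2 (- t)))" for m
  have "\<forall>m t. m < 2 \<and> 0 \<le> t \<and> t \<le> h \<longrightarrow> (diff m has_real_derivative diff (Suc m) t) (at t)"
  proof (intro allI impI)
    fix m :: nat and t :: real
    assume m: "m < 2 \<and> 0 \<le> t \<and> t \<le> h"
    have "((\<lambda>t. F (- t)) has_real_derivative F1 (- t) * (- 1)) (at t)"
      by (rule DERIV_chain2[of F _ "uminus"]) (use m in \<open>auto intro!: d1 derivative_eq_intros\<close>)
    moreover have "((\<lambda>t. F1 (- t)) has_real_derivative F2 (- t) * (- 1)) (at t)"
      by (rule DERIV_chain2[of F1 _ "uminus"]) (use m in \<open>auto intro!: d2 derivative_eq_intros\<close>)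
    moreover have "m = 0 \<or> m = 1" using m by auto
    ultimately show "(diff m has_real_derivative diff (Suc m) t) (at t)"
      using d1[of t] d2[of t] m by (auto simp: diff_def intro!: derivative_eq_intros)
  qed
  from Maclaurin2[OF h refl this] obtain t where t: "0 < t" "t \<le> h"
    "diff 0 h = (\<Sum>m<2. diff m 0 / fact m * h ^ m) + diff 2 t / fact 2 * h\<^sup>2" by blast
  have "F h + F (- h) = 2 * F 0 + (F2 t + F2 (- t)) / 2 * h\<^sup>2"
    using t(3) by (simp add: diff_def numeral_2_eq_2)
  then have "(F h + F (- h) - 2 * F 0) / h\<^sup>2 = (F2 t + F2 (- t)) / 2" using h by simp
  then show ?thesis using t by (intro exI[of _ t]) auto
qed

text \<open>The functions vary with \<open>k\<close> because base points and directions will. The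
  intermediate points of the mean value theorem are unknown, so convergence of \<open>F2\<close> is
  demanded along every choice of points within the step.\<close>

lemma second_difference_tendsto:
  fixes F F1 F2 :: "nat \<Rightarrow> real \<Rightarrow> real"
  assumes h: "\<And>k. 0 < h k"
    and d: "\<forall>\<^sub>F k in sequentially. \<forall>t. \<bar>t\<bar> \<le> h k \<longrightarrow>
       (F k has_real_derivative F1 k t) (at t) \<and> (F1 k has_real_derivative F2 k t) (at t)"
    and c: "\<And>\<theta>. (\<And>k. \<bar>\<theta> k\<bar> \<le> h k) \<Longrightarrow> (\<lambda>k. F2 k (\<theta> k)) \<longlonglongrightarrow> c"
  shows "(\<lambda>k. (F k (h k) + F k (- h k) - 2 * F k 0) / (h k)\<^sup>2) \<longlonglongrightarrow> c"
proof -
  have "\<forall>\<^sub>F k in sequentially. \<exists>\<theta>. \<bar>\<theta>\<bar> \<le> h k \<and>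
      (F k (h k) + F k (- h k) - 2 * F k 0) / (h k)\<^sup>2 = (F2 k \<theta> + F2 k (- \<theta>)) / 2"
    using d by eventually_elim (use h second_difference_mvt in blast)
  then have "\<forall>\<^sub>F k in sequentially. \<exists>\<theta>. \<bar>\<theta>\<bar> \<le> h k \<and> (\<bar>\<theta>\<bar> \<le> h k \<longrightarrow>
      (F k (h k) + F k (- h k) - 2 * F k 0) / (h k)\<^sup>2 = (F2 k \<theta> + F2 k (- \<theta>)) / 2)"
    by eventually_elim blast
  then obtain N where N: "\<And>k. k \<ge> N \<Longrightarrow> \<exists>\<theta>. \<bar>\<theta>\<bar> \<le> h k \<and>
      (F k (h k) + F k (- h k) - 2 * F k 0) / (h k)\<^sup>2 = (F2 k \<theta> + F2 k (- \<theta>)) / 2"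
    unfolding eventually_sequentially by blast
  \<comment> \<open>Below \<open>N\<close> there is no intermediate point to take; 0 serves as
    default, so that \<open>\<theta>\<close> is defined for all \<open>k\<close>.\<close>
  have "\<exists>\<theta>. \<bar>\<theta>\<bar> \<le> h k \<and> (k \<ge> N \<longrightarrow>
      (F k (h k) + F k (- h k) - 2 * F k 0) / (h k)\<^sup>2 = (F2 k \<theta> + F2 k (- \<theta>)) / 2)" for k
    using N[of k] h[of k] by (cases "k \<ge> N") (auto intro: exI[of _ 0])
  then obtain \<theta> where \<theta>: "\<And>k. \<bar>\<theta> k\<bar> \<le> h k" "\<And>k. k \<ge> N \<Longrightarrow>
      (F k (h k) + F k (- h k) - 2 * F k 0) / (h k)\<^sup>2 = (F2 k (\<theta> k) + F2 k (- \<theta> k)) / 2"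
    by metis
  have "(\<lambda>k. (F2 k (\<theta> k) + F2 k (- \<theta> k)) / 2) \<longlonglongrightarrow> (c + c) / 2"
    using \<theta>(1) by (intro tendsto_intros c) auto
  then have "(\<lambda>k. (F2 k (\<theta> k) + F2 k (- \<theta> k)) / 2) \<longlonglongrightarrow> c" by simp
  then show ?thesis
    by (rule Lim_transform_eventually) (rule eventually_sequentiallyI[of N], rule \<theta>(2)[symmetric])
qed

text \<open>\<open>F1\<close> is differentiable at 0 only. If \<open>c\<close> were negative,
  \<open>F1\<close> would be negative just to the right of its zero, and by the mean value theorem
  \<open>F\<close> would drop below its minimum.\<close>

lemma second_derivative_test:
  fixes F :: "real \<Rightarrow> real"
  assumes r: "0 < r"
    and d1: "\<And>t. \<bar>t\<bar> < r \<Longrightarrow> (F has_real_derivative F1 t) (at t)"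
    and d2: "(F1 has_real_derivative c) (at 0)"
    and min: "\<And>t. \<bar>t\<bar> < r \<Longrightarrow> F 0 \<le> F t"
  shows "F1 0 = 0" "0 \<le> c"
proof -
  show z: "F1 0 = 0"
    by (rule DERIV_local_min[OF d1[of 0] r]) (use min r in auto)
  show "0 \<le> c"
  proof (rule ccontr)
    assume "\<not> 0 \<le> c"
    then obtain d where d: "d > 0" "\<And>t. 0 < t \<Longrightarrow> t < d \<Longrightarrow> F1 0 > F1 (0 + t)"
      using DERIV_neg_dec_right[OF d2] by auto
    define t where "t = min d r / 2"
    have t: "0 < t" "t < d" "t < r" using d r by (auto simp: t_def)
    obtain z where z': "0 < z" "z < t" "F t - F 0 = (t - 0) * F1 z"
      using MVT2[of 0 t F F1] d1 t by force
    have "F1 z < 0" using d(2)[of z] z' t z by auto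
    then have "F t < F 0" using z' t by (smt (verit) mult_pos_neg diff_zero)
    then show False using min[of t] t by auto
  qed
qed

section \<open>Restriction to lines and symmetry of mixed derivatives\<close>

lemma DERIV_along_line:
  fixes u :: "real^'n \<Rightarrow> real"
  assumes "(u has_derivative (\<lambda>v. P \<bullet> v)) (at (x + t *\<^sub>R v))"
  shows "((\<lambda>t. u (x + t *\<^sub>R v)) has_real_derivative P \<bullet> v) (at t)"
proof -
  have "((\<lambda>t. x + t *\<^sub>R v) has_derivative (\<lambda>s. s *\<^sub>R v)) (at t)"
    by (auto intro!: derivative_eq_intros)
  from diff_chain_at[OF this assms] show ?thesis
    by (simp add: has_field_derivative_def o_def mult.commute[of _ "P \<bullet> v"])
qed

lemma vector_derivative_along_line:
  fixes G :: "real^'n \<Rightarrow> 'b::real_normed_vector"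
  assumes "(G has_derivative G') (at (x + t *\<^sub>R v))"
  shows "((\<lambda>t. G (x + t *\<^sub>R v)) has_vector_derivative G' v) (at t)"
proof -
  have "((\<lambda>t. x + t *\<^sub>R v) has_derivative (\<lambda>s. s *\<^sub>R v)) (at t)"
    by (auto intro!: derivative_eq_intros)
  from diff_chain_at[OF this assms] show ?thesis
    using linear_cmul[OF has_derivative_linear[OF assms]]
    by (simp add: has_vector_derivative_def o_def)
qed

text \<open>The mean value theorem is used twice: in direction \<open>v\<close> for the difference
  of \<open>u\<close> over \<open>t *\<^sub>R w\<close>, then in direction \<open>w\<close> for the
  gradient.\<close>

lemma mixed_difference_mvt:
  fixes u :: "real^'n \<Rightarrow> real"
  assumes S: "ball x r \<subseteq> S"
    and du: "\<And>y. y \<in> S \<Longrightarrow> (u has_derivative (\<lambda>v. P y \<bullet> v)) (at y)"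
    and dP: "\<And>y. y \<in> S \<Longrightarrow> (P has_derivative P' y) (at y)"
    and t: "0 < t" "t * (norm v + norm w) < r"
  shows "\<exists>z. dist x z \<le> t * (norm v + norm w) \<and>
     u (x + t *\<^sub>R v + t *\<^sub>R w) - u (x + t *\<^sub>R v) - u (x + t *\<^sub>R w) + u x = t\<^sup>2 * (P' z w \<bullet> v)"
proof -
  have inS: "x + a *\<^sub>R v + b *\<^sub>R w \<in> S \<and> dist x (x + a *\<^sub>R v + b *\<^sub>R w) \<le> t * (norm v + norm w)"
    if "0 \<le> a" "a \<le> t" "0 \<le> b" "b \<le> t" for a b
  proof -
    have "norm (a *\<^sub>R v + b *\<^sub>R w) \<le> a * norm v + b * norm w"
      using that by (metis abs_of_nonneg norm_scaleR norm_triangle_ineq)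
    also have "\<dots> \<le> t * norm v + t * norm w" using that by (intro add_mono mult_right_mono) auto
    finally have "dist x (x + a *\<^sub>R v + b *\<^sub>R w) \<le> t * (norm v + norm w)"
      by (simp add: dist_norm norm_minus_commute distrib_left add.assoc
          norm_minus_cancel[of "a *\<^sub>R v + b *\<^sub>R w", symmetric] del: norm_minus_cancel)
    then show ?thesis using S t by (auto simp: subset_iff)
  qed
  let ?\<phi> = "\<lambda>s. u (x + t *\<^sub>R w + s *\<^sub>R v) - u (x + s *\<^sub>R v)"
  have "(?\<phi> has_real_derivative P (x + t *\<^sub>R w + s *\<^sub>R v) \<bullet> v - P (x + s *\<^sub>R v) \<bullet> v) (at s)"
    if "0 \<le> s" "s \<le> t" for s
    using inS[of s t] inS[of s 0] that t
    by (intro DERIV_diff DERIV_along_line du) (auto simp: ac_simps)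
  from MVT2[OF t(1) this] obtain s where s: "0 < s" "s < t"
    "?\<phi> t - ?\<phi> 0 = (t - 0) * (P (x + t *\<^sub>R w + s *\<^sub>R v) \<bullet> v - P (x + s *\<^sub>R v) \<bullet> v)" by blast
  let ?g = "\<lambda>b. P (x + s *\<^sub>R v + b *\<^sub>R w) \<bullet> v"
  have "(?g has_real_derivative P' (x + s *\<^sub>R v + b *\<^sub>R w) w \<bullet> v) (at b)" if "0 \<le> b" "b \<le> t" for b
    using vector_derivative_along_line[OF dP, of "x + s *\<^sub>R v" b w] inS[of s b] s that
    by (intro bounded_linear.has_vector_derivative[OF bounded_linear_inner_left,
          folded has_real_derivative_iff_has_vector_derivative]) auto
  from MVT2[OF t(1) this] obtain b where b: "0 < b" "b < t"
    "?g t - ?g 0 = (t - 0) * (P' (x + s *\<^sub>R v + b *\<^sub>R w) w \<bullet> v)" by blast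
  show ?thesis
  proof (intro exI conjI)
    show "dist x (x + s *\<^sub>R v + b *\<^sub>R w) \<le> t * (norm v + norm w)" using inS[of s b] s b by auto
    show "u (x + t *\<^sub>R v + t *\<^sub>R w) - u (x + t *\<^sub>R v) - u (x + t *\<^sub>R w) + u x
      = t\<^sup>2 * (P' (x + s *\<^sub>R v + b *\<^sub>R w) w \<bullet> v)"
      using s(3) b(3) by (simp add: ac_simps power2_eq_square)
  qed
qed

text \<open>The mixed difference does not change when \<open>v\<close> and \<open>w\<close> are
  exchanged, while \<open>mixed_difference_mvt\<close> together with continuity of the second
  derivative at \<open>x\<close> identifies the limit of its quotient with either side.\<close>

lemma second_derivative_symmetric:
  fixes u :: "real^'n \<Rightarrow> real"
  assumes S: "open S" "x \<in> S"
    and du: "\<And>y. y \<in> S \<Longrightarrow> (u has_derivative (\<lambda>v. P y \<bullet> v)) (at y)"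
    and dP: "\<And>y. y \<in> S \<Longrightarrow> (P has_derivative P' y) (at y)"
    and cont: "\<And>v. isCont (\<lambda>y. P' y v) x"
  shows "P' x v \<bullet> w = P' x w \<bullet> v"
proof -
  obtain r where r: "r > 0" "ball x r \<subseteq> S" using S by (meson openE)
  define c where "c = norm v + norm w"
  have c0: "c \<ge> 0" by (simp add: c_def)
  \<comment> \<open>This makes \<open>t k * c < r\<close> for every \<open>k\<close>;
    \<open>c + 1\<close> in place of \<open>c\<close> covers the case of two zero
    directions.\<close>
  define t where "t k = r / (c + 1) * inverse (real (Suc k))" for k :: nat
  have t0: "t k > 0" for k using r c0 by (simp add: t_def)
  have tr: "t k * c < r" for k
  proof -
    have "t k * c \<le> r / (c + 1) * 1 * c"
      unfolding t_def using r c0 by (intro mult_right_mono mult_left_mono) (auto simp: field_simps)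
    also have "\<dots> < r" using r c0 by (simp add: field_simps)
    finally show ?thesis .
  qed
  have tlim: "t \<longlonglongrightarrow> 0" unfolding t_def
    by (intro tendsto_mult_right_zero LIMSEQ_inverse_real_of_nat)
  define D where "D k = (u (x + t k *\<^sub>R v + t k *\<^sub>R w) - u (x + t k *\<^sub>R v) - u (x + t k *\<^sub>R w) + u x) / (t k)\<^sup>2" for k
  have key: "D \<longlonglongrightarrow> P' x b \<bullet> a" if ab: "(a = v \<and> b = w) \<or> (a = w \<and> b = v)" for a b
  proof -
    have "\<exists>z. dist x z \<le> t k * c \<and> D k = P' z b \<bullet> a" for k
    proof -
      have "norm a + norm b = c" using ab by (auto simp: c_def)
      then show ?thesis
        using mixed_difference_mvt[OF r(2) du dP t0[of k], of a b] tr[of k] t0[of k] ab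
        by (auto simp: D_def ac_simps field_simps)
    qed
    then obtain z where z: "\<And>k. dist x (z k) \<le> t k * c" "\<And>k. D k = P' (z k) b \<bullet> a" by metis
    have "(\<lambda>k. t k * c) \<longlonglongrightarrow> 0" using tendsto_mult_left_zero[OF tlim] by simp
    then have "(\<lambda>k. dist (z k) x) \<longlonglongrightarrow> 0"
      by (rule tendsto_0_le[where K = 1]) (use z(1) in \<open>auto simp: dist_commute intro!: always_eventually order_trans[OF _ abs_ge_self]\<close>)
    then have "z \<longlonglongrightarrow> x" by (simp add: tendsto_dist_iff[symmetric])
    then have "(\<lambda>k. P' (z k) b) \<longlonglongrightarrow> P' x b" using cont isCont_tendsto_compose by blast
    then show ?thesis unfolding z(2)[abs_def] by (intro tendsto_intros)
  qed
  from LIMSEQ_unique[OF key[of v w] key[of w v]] show ?thesis by simp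
qed


section \<open>Third-order jets\<close>

lemma tendsto_matrix_vector_mult:
  fixes M :: "'a \<Rightarrow> real^'n^'m" and v :: "'a \<Rightarrow> real^'n"
  assumes "(M \<longlongrightarrow> m) F" "(v \<longlongrightarrow> w) F"
  shows "((\<lambda>k. M k *v v k) \<longlongrightarrow> m *v w) F"
  unfolding matrix_vector_mult_def
  by (intro tendsto_vec_lambda tendsto_intros assms)

lemma matrix_vector_mult_has_derivative:
  fixes M :: "'a::real_normed_vector \<Rightarrow> real^'n^'m"
  assumes "(M has_derivative M') F"
  shows "((\<lambda>y. M y *v e) has_derivative (\<lambda>v. M' v *v e)) F"
proof -
  have "linear (\<lambda>A :: real^'n^'m. A *v e)"
    by (intro linearI) (simp_all add: matrix_vector_mult_add_rdistrib scaleR_matrix_vector_assoc)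
  then have "bounded_linear (\<lambda>A :: real^'n^'m. A *v e)"
    by (simp add: linear_conv_bounded_linear)
  from bounded_linear.has_derivative[OF this assms] show ?thesis .
qed

text \<open>Gradient, Hessian and third derivatives are carried as vector and matrix fields,
  \<open>D i\<close> being the derivative of the Hessian along the \<open>i\<close>-th axis;
  iterated partial derivatives enter through an instance for \<open>Ck_on\<close>.\<close>

locale C3_jet =
  fixes S :: "(real^'n) set" and u :: "real^'n \<Rightarrow> real" and p :: "real^'n \<Rightarrow> real^'n"
    and H :: "real^'n \<Rightarrow> real^'n^'n" and D :: "'n \<Rightarrow> real^'n \<Rightarrow> real^'n^'n"
  assumes open_S: "open S"
    and du: "x \<in> S \<Longrightarrow> (u has_derivative (\<lambda>v. p x \<bullet> v)) (at x)"
    and dp: "x \<in> S \<Longrightarrow> (p has_derivative (\<lambda>v. H x *v v)) (at x)"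
    and dH: "x \<in> S \<Longrightarrow> (H has_derivative (\<lambda>v. \<Sum>i\<in>UNIV. v $ i *\<^sub>R D i x)) (at x)"
    and isCont_D: "x \<in> S \<Longrightarrow> isCont (D i) x"
begin

definition D3 :: "real^'n \<Rightarrow> real^'n \<Rightarrow> real^'n^'n" where
  "D3 x v = (\<Sum>i\<in>UNIV. v $ i *\<^sub>R D i x)"

lemma dH': "x \<in> S \<Longrightarrow> (H has_derivative D3 x) (at x)"
  using dH by (simp add: D3_def[abs_def])

lemma isCont_u: "x \<in> S \<Longrightarrow> isCont u x" and isCont_p: "x \<in> S \<Longrightarrow> isCont p x"
  and isCont_H: "x \<in> S \<Longrightarrow> isCont H x"
  using du dp dH has_derivative_continuous by blast+

lemma tendsto_D3:
  assumes "x \<in> S" "y \<longlonglongrightarrow> x" "v \<longlonglongrightarrow> w"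
  shows "(\<lambda>k. D3 (y k) (v k)) \<longlonglongrightarrow> D3 x w"
  unfolding D3_def
  by (intro tendsto_intros assms isCont_tendsto_compose[OF isCont_D])

lemma H_sym:
  assumes "x \<in> S"
  shows "transpose (H x) = H x"
proof -
  have "isCont (\<lambda>y. H y *v v) x" for v
    using isCont_H[OF assms] unfolding isCont_def by (intro tendsto_matrix_vector_mult) auto
  from second_derivative_symmetric[OF open_S assms du dp this]
  have "(H x *v axis i 1) \<bullet> axis j 1 = (H x *v axis j 1) \<bullet> axis i 1" for i j by blast
  then show ?thesis
    by (simp add: vec_eq_iff transpose_def inner_axis matrix_vector_mult_basis column_def)
qed

text \<open>The directional derivative \<open>p y \<bullet> e\<close> has gradient
  \<open>H y *v e\<close>, because \<open>H\<close> is symmetric; the claim is the symmetry of the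
  Hessian of this function.\<close>

lemma D3_sym_swap:
  assumes "x \<in> S"
  shows "(D3 x v *v e) \<bullet> w = (D3 x w *v e) \<bullet> v"
proof (rule second_derivative_symmetric[OF open_S assms, of "\<lambda>y. p y \<bullet> e" "\<lambda>y. H y *v e"])
  fix y assume y: "y \<in> S"
  have "((\<lambda>y. p y \<bullet> e) has_derivative (\<lambda>v. (H y *v v) \<bullet> e)) (at y)"
    by (intro has_derivative_inner_left dp y)
  then show "((\<lambda>y. p y \<bullet> e) has_derivative (\<lambda>v. (H y *v e) \<bullet> v)) (at y)"
    using symmetric_matrix_inner[OF H_sym[OF y], of e] by (simp add: inner_commute)
  show "((\<lambda>y. H y *v e) has_derivative (\<lambda>v. D3 y v *v e)) (at y)"
    by (intro matrix_vector_mult_has_derivative dH' y)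
next
  fix v
  show "isCont (\<lambda>y. D3 y v *v e) x"
    unfolding D3_def isCont_def
    using isCont_D[OF assms] by (intro tendsto_matrix_vector_mult tendsto_intros) (auto simp: isCont_def)
qed

end

lemma differentiable_partial:
  assumes "u differentiable (at x)"
  shows "(u has_derivative (\<lambda>v. \<Sum>i\<in>UNIV. v $ i * partial i u x)) (at x)"
proof -
  let ?f = "frechet_derivative u (at x)"
  have d: "(u has_derivative ?f) (at x)" using assms by (simp add: frechet_derivative_works)
  have lin: "linear ?f" using d by (rule has_derivative_linear)
  have "?f v = (\<Sum>i\<in>UNIV. v $ i * partial i u x)" for v
  proof -
    have "?f v = ?f (\<Sum>i\<in>UNIV. v $ i *\<^sub>R axis i 1)"
      using basis_expansion[of v] by (simp add: scalar_mult_eq_scaleR)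
    also have "\<dots> = (\<Sum>i\<in>UNIV. v $ i * partial i u x)"
      by (simp add: linear_sum[OF lin] linear_cmul[OF lin] partial_def)
    finally show ?thesis .
  qed
  then have "?f = (\<lambda>v. \<Sum>i\<in>UNIV. v $ i * partial i u x)" by blast
  with d show ?thesis by simp
qed

lemma has_derivative_vec_lambda:
  fixes f :: "'a::euclidean_space \<Rightarrow> 'i::finite \<Rightarrow> 'b::euclidean_space"
  assumes "\<And>i. ((\<lambda>x. f x i) has_derivative (\<lambda>v. g v i)) (at x)"
  shows "((\<lambda>x. \<chi> i. f x i) has_derivative (\<lambda>v. \<chi> i. g v i)) (at x)"
proof -
  have "((\<lambda>x. (\<chi> i. f x i) \<bullet> b) has_derivative (\<lambda>v. (\<chi> i. g v i) \<bullet> b)) (at x)" for b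
    unfolding inner_vec_def by (simp, intro has_derivative_sum has_derivative_inner_left assms)
  then show ?thesis by (subst has_derivative_componentwise_within) auto
qed

lemma Ck_on_3_jet:
  assumes S: "open S" and u: "Ck_on 3 S u"
  shows "C3_jet S u (grad u) (hessian u) (\<lambda>k x. \<chi> i j. partial k (partial j (partial i u)) x)"
proof
  note u' = u[unfolded numeral_3_eq_3 Ck_on.simps]
  show "open S" by fact
  fix x assume x: "x \<in> S"
  show "(u has_derivative (\<lambda>v. grad u x \<bullet> v)) (at x)"
    using differentiable_partial[of u x] u' x by (simp add: grad_def inner_vec_def mult.commute)
  show "(grad u has_derivative (\<lambda>v. hessian u x *v v)) (at x)"
    unfolding grad_def[abs_def] matrix_vector_mult_def hessian_def
    using u' x by (intro has_derivative_vec_lambda) (auto simp: mult.commute[of "partial _ _ _"] intro!: differentiable_partial)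
  have "(hessian u has_derivative (\<lambda>v. \<chi> i j. \<Sum>k\<in>UNIV. v $ k * partial k (partial j (partial i u)) x)) (at x)"
    unfolding hessian_def[abs_def]
    using u' x by (intro has_derivative_vec_lambda) (auto intro!: differentiable_partial)
  moreover have "(\<chi> i j. \<Sum>k\<in>UNIV. v $ k * partial k (partial j (partial i u)) x)
     = (\<Sum>k\<in>UNIV. v $ k *\<^sub>R (\<chi> i j. partial k (partial j (partial i u)) x))" for v :: "real^'a"
    by (simp add: vec_eq_iff)
  ultimately show "(hessian u has_derivative
      (\<lambda>v. \<Sum>k\<in>UNIV. v $ k *\<^sub>R (\<chi> i j. partial k (partial j (partial i u)) x))) (at x)"
    by simp
  fix k
  have "continuous (at x) (partial k (partial j (partial i u)))" for i j
    using u' x S by (simp add: continuous_on_eq_continuous_at)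
  then show "isCont (\<lambda>x. \<chi> i j. partial k (partial j (partial i u)) x) x"
    unfolding isCont_def by (intro tendsto_vec_lambda)
qed

section \<open>Differentiable cost-concave functions\<close>

text \<open>The matrix \<open>A\<close> as a function of the gradient alone: the Hessian in
  \<open>x\<close> of \<open>cost \<epsilon> x y\<close> at a point where the gradient in
  \<open>x\<close> equals \<open>p\<close>.\<close>

definition cost_hess :: "real \<Rightarrow> real^'n \<Rightarrow> real^'n^'n" where
  "cost_hess \<epsilon> p = (sqrt (1 - p \<bullet> p) / \<epsilon>) *\<^sub>R (mat 1 - outer p p)"

lemma Amat_eq_cost_hess: "Amat \<epsilon> u x = cost_hess \<epsilon> (grad u x)"
  by (simp add: Amat_def cost_hess_def vec_eq_iff Lfun_def mat_def outer_def grad_def power2_norm_eq_inner)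

lemma cost_hess_form:
  "e \<bullet> (cost_hess \<epsilon> p *v f) = sqrt (1 - p \<bullet> p) / \<epsilon> * (e \<bullet> f - (p \<bullet> e) * (p \<bullet> f))"
  by (simp add: cost_hess_def scaleR_matrix_vector_assoc[symmetric] matrix_vector_mult_diff_rdistrib
      outer_mult_vec inner_diff_right inner_commute mult_ac)

lemma cost_hess_sym: "transpose (cost_hess \<epsilon> p) = cost_hess \<epsilon> p"
  by (auto simp: cost_hess_def transpose_def vec_eq_iff mat_def outer_def)

lemma metric_lower:
  fixes p e :: "'a::real_inner"
  shows "(1 - p \<bullet> p) * (e \<bullet> e) \<le> e \<bullet> e - (p \<bullet> e)\<^sup>2"
  using Cauchy_Schwarz_ineq[of p e] by (simp add: algebra_simps)

lemma cost_hess_pos_def: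
  assumes "0 < \<epsilon>" "p \<bullet> p < 1"
  shows "pos_def (cost_hess \<epsilon> p)"
proof -
  have "0 < v \<bullet> (cost_hess \<epsilon> p *v v)" if "v \<noteq> 0" for v
  proof -
    have "0 < (1 - p \<bullet> p) * (v \<bullet> v)" using that assms by simp
    also have "\<dots> \<le> v \<bullet> v - (p \<bullet> v)\<^sup>2" by (rule metric_lower)
    finally show ?thesis using assms by (simp add: cost_hess_form power2_eq_square)
  qed
  then show ?thesis by (simp add: pos_def_def cost_hess_sym)
qed

lemma det_scaleR: "det (c *\<^sub>R (M :: real^'n^'n)) = c ^ CARD('n) * det M"
  using det_rows_mul[of "\<lambda>_. c" "\<lambda>i. M $ i"] by (simp add: scaleR_vec_def scalar_mult_eq_scaleR)

text \<open>With \<open>L = \<epsilon> / s\<close> this equals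
  \<open>\<epsilon>\<^sup>2 / L ^ (n + 2)\<close>, the first factor of the prescribed determinant.
  Hence the equation prescribes the product of the eigenvalues of \<open>w\<close> relative to
  \<open>A\<close>.\<close>

lemma det_cost_hess:
  fixes p :: "real^'n"
  shows "det (cost_hess \<epsilon> p) = (sqrt (1 - p \<bullet> p) / \<epsilon>) ^ CARD('n) * (1 - p \<bullet> p)"
proof -
  have eq: "mat 1 - outer p p = mat 1 + outer (- p) p" by (simp add: outer_def vec_eq_iff)
  show ?thesis unfolding cost_hess_def det_scaleR eq det_rank_one by simp
qed

text \<open>The infimum need not be attained in \<Omega>'. A minimising sequence has a limit point
  in the closure, and as \<psi> drops out of the difference \<open>u z - u x\<close>, continuity of
  the cost is enough to pass to the limit.\<close>

lemma cost_touching_point: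
  assumes u: "cost_concave \<epsilon> \<Omega> \<Omega>' u" and b: "bounded \<Omega>'" "\<Omega>' \<noteq> {}" and x: "x \<in> \<Omega>"
  shows "\<exists>y. \<forall>z\<in>\<Omega>. u z - u x \<le> cost \<epsilon> z y - cost \<epsilon> x y"
proof -
  obtain \<psi> where \<psi>: "\<And>x. x \<in> \<Omega> \<Longrightarrow> bdd_below ((\<lambda>y. cost \<epsilon> x y - \<psi> y) ` \<Omega>')"
    "\<And>x. x \<in> \<Omega> \<Longrightarrow> u x = (INF y\<in>\<Omega>'. cost \<epsilon> x y - \<psi> y)"
    using u unfolding cost_concave_def by metis
  have "\<exists>y\<in>\<Omega>'. cost \<epsilon> x y - \<psi> y < u x + inverse (real (Suc k))" for k
    using \<psi>[OF x] b by (subst cINF_less_iff[symmetric]) auto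
  then obtain y where y: "\<And>k. y k \<in> \<Omega>'" "\<And>k. cost \<epsilon> x (y k) - \<psi> (y k) < u x + inverse (real (Suc k))"
    by metis
  have "compact (closure \<Omega>')" using b by (simp add: compact_closure)
  moreover have "\<forall>k. y k \<in> closure \<Omega>'" using y(1) closure_subset by blast
  ultimately obtain l r where r: "strict_mono r" "(y \<circ> r) \<longlonglongrightarrow> l"
    unfolding compact_def by metis
  have "u z - u x \<le> cost \<epsilon> z l - cost \<epsilon> x l" if z: "z \<in> \<Omega>" for z
  proof (rule LIMSEQ_le_const)
    have "(\<lambda>k. inverse (real (Suc (r k)))) \<longlonglongrightarrow> 0"
      using LIMSEQ_subseq_LIMSEQ[OF LIMSEQ_inverse_real_of_nat r(1)] by (simp add: o_def)
    then have "(\<lambda>k. cost \<epsilon> z ((y \<circ> r) k) - cost \<epsilon> x ((y \<circ> r) k) + inverse (real (Suc (r k))))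
        \<longlonglongrightarrow> cost \<epsilon> z l - cost \<epsilon> x l + 0"
      unfolding cost_def by (intro tendsto_intros r)
    then show "(\<lambda>k. cost \<epsilon> z ((y \<circ> r) k) - cost \<epsilon> x ((y \<circ> r) k) + inverse (real (Suc (r k))))
        \<longlonglongrightarrow> cost \<epsilon> z l - cost \<epsilon> x l" by simp
    have "u z - u x \<le> cost \<epsilon> z (y (r k)) - cost \<epsilon> x (y (r k)) + inverse (real (Suc (r k)))" for k
    proof -
      have "u z \<le> cost \<epsilon> z (y (r k)) - \<psi> (y (r k))"
        unfolding \<psi>(2)[OF z] by (intro cINF_lower \<psi>(1) z y(1))
      with y(2)[of "r k"] show ?thesis by linarith
    qed
    then show "\<exists>N. \<forall>n\<ge>N. u z - u x \<le> cost \<epsilon> z ((y \<circ> r) n) - cost \<epsilon> x ((y \<circ> r) n) + inverse (real (Suc (r n)))"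
      by auto
  qed
  then show ?thesis by blast
qed

context C3_jet
begin

lemma line_in_S:
  assumes "x \<in> S"
  obtains r where "r > 0" "\<And>t. \<bar>t\<bar> < r \<Longrightarrow> x + t *\<^sub>R e \<in> S"
proof -
  obtain d where d: "d > 0" "ball x d \<subseteq> S" using open_S assms by (meson openE)
  have "x + t *\<^sub>R e \<in> S" if t: "\<bar>t\<bar> < d / (norm e + 1)" for t
  proof -
    have "\<bar>t\<bar> * norm e \<le> \<bar>t\<bar> * (norm e + 1)" by (intro mult_left_mono) auto
    also have "\<dots> < d" using t by (simp add: pos_less_divide_eq add_nonneg_pos)
    finally show ?thesis using d(2) by (auto simp: subset_iff dist_norm)
  qed
  moreover have "d / (norm e + 1) > 0" using d by (simp add: add_nonneg_pos)
  ultimately show thesis using that by blast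
qed

text \<open>As a function of \<open>z\<close>, \<open>cost \<epsilon> z y - u z\<close> has a
  minimum at \<open>x\<close>, so the gradients agree there and the Hessian of \<open>u\<close> lies
  below that of the cost. The gradient of the cost is shorter than 1 because \<epsilon> is
  positive.\<close>

lemma cost_concave_jet:
  assumes eps: "0 < \<epsilon>" and u: "cost_concave \<epsilon> S \<Omega>' u" and b: "bounded \<Omega>'" "\<Omega>' \<noteq> {}" and x: "x \<in> S"
  shows "p x \<bullet> p x < 1" "e \<bullet> (H x *v e) \<le> e \<bullet> (cost_hess \<epsilon> (p x) *v e)"
proof -
  obtain y where y: "\<And>z. z \<in> S \<Longrightarrow> u z - u x \<le> cost \<epsilon> z y - cost \<epsilon> x y"
    using cost_touching_point[OF u b x] by blast
  define R where "R = cost \<epsilon> x y"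
  have cost_eq: "cost \<epsilon> z y = sqrt (\<epsilon>\<^sup>2 + (z - y) \<bullet> (z - y))" for z
    by (simp add: cost_def power2_norm_eq_inner)
  have pos: "0 < \<epsilon>\<^sup>2 + z \<bullet> z" for z :: "real^'n" using eps by (simp add: add_pos_nonneg)
  have cpos: "cost \<epsilon> z y > 0" for z using pos by (simp add: cost_eq)
  have R: "R > 0" "R\<^sup>2 = \<epsilon>\<^sup>2 + (x - y) \<bullet> (x - y)" using cpos pos less_imp_le[OF pos] by (auto simp: R_def cost_eq)
  have main: "((x - y) \<bullet> e) / R - p x \<bullet> e = 0 \<and> 0 \<le> (e \<bullet> e) / R - ((x - y) \<bullet> e)\<^sup>2 / R ^ 3 - e \<bullet> (H x *v e)" for e
  proof -
    obtain r where r: "r > 0" "\<And>t. \<bar>t\<bar> < r \<Longrightarrow> x + t *\<^sub>R e \<in> S" using line_in_S[OF x] by blast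
    define F where "F t = cost \<epsilon> (x + t *\<^sub>R e) y - u (x + t *\<^sub>R e)" for t
    define F1 where "F1 t = ((x + t *\<^sub>R e - y) \<bullet> e) / cost \<epsilon> (x + t *\<^sub>R e) y - p (x + t *\<^sub>R e) \<bullet> e" for t
    have dcost: "((\<lambda>t. cost \<epsilon> (x + t *\<^sub>R e) y) has_real_derivative ((x + t *\<^sub>R e - y) \<bullet> e) / cost \<epsilon> (x + t *\<^sub>R e) y) (at t)" for t
    proof -
      have *: "(x + t *\<^sub>R e - y) \<bullet> (x + t *\<^sub>R e - y)
         = (x - y) \<bullet> (x - y) + 2 * t * ((x - y) \<bullet> e) + t\<^sup>2 * (e \<bullet> e)" for t
        by (simp add: inner_diff_left inner_diff_right inner_add_left inner_add_right
            inner_commute power2_eq_square algebra_simps)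
      have **: "(x + t *\<^sub>R e - y) \<bullet> e = (x - y) \<bullet> e + t * (e \<bullet> e)"
        by (simp add: inner_diff_left inner_add_left algebra_simps)
      show ?thesis unfolding cost_eq * **
        using pos[of "x + t *\<^sub>R e - y"]
        by (auto intro!: derivative_eq_intros simp: * field_simps)
    qed
    have dF: "(F has_real_derivative F1 t) (at t)" if "\<bar>t\<bar> < r" for t
      unfolding F_def F1_def by (intro DERIV_diff dcost DERIV_along_line du r(2) that)
    have dp0: "((\<lambda>t. p (x + t *\<^sub>R e) \<bullet> e) has_real_derivative (H x *v e) \<bullet> e) (at 0)"
      using vector_derivative_along_line[OF dp, of x 0 e] x
      by (intro bounded_linear.has_vector_derivative[OF bounded_linear_inner_left,
          folded has_real_derivative_iff_has_vector_derivative]) auto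
    have dc0: "((\<lambda>t. ((x + t *\<^sub>R e - y) \<bullet> e) / cost \<epsilon> (x + t *\<^sub>R e) y) has_real_derivative
        (e \<bullet> e) / R - ((x - y) \<bullet> e)\<^sup>2 / R ^ 3) (at 0)"
    proof -
      have "((\<lambda>t. ((x - y) \<bullet> e + t * (e \<bullet> e)) / cost \<epsilon> (x + t *\<^sub>R e) y) has_real_derivative
        ((e \<bullet> e) * R - ((x - y) \<bullet> e) * (((x - y) \<bullet> e) / R)) / (R * R)) (at 0)"
        using R(1) dcost[of 0] by (auto intro!: derivative_eq_intros simp: R_def)
      moreover have "((e \<bullet> e) * R - ((x - y) \<bullet> e) * (((x - y) \<bullet> e) / R)) / (R * R)
        = (e \<bullet> e) / R - ((x - y) \<bullet> e)\<^sup>2 / R ^ 3"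
        using R(1) by (simp add: field_simps power2_eq_square power3_eq_cube)
      moreover have "(x + t *\<^sub>R e - y) \<bullet> e = (x - y) \<bullet> e + t * (e \<bullet> e)" for t
        by (simp add: inner_diff_left inner_add_left algebra_simps)
      ultimately show ?thesis by (simp only:)
    qed
    have dF1: "(F1 has_real_derivative (e \<bullet> e) / R - ((x - y) \<bullet> e)\<^sup>2 / R ^ 3 - e \<bullet> (H x *v e)) (at 0)"
      unfolding F1_def inner_commute[of e "H x *v e"] by (rule DERIV_diff[OF dc0 dp0])
    have min: "F 0 \<le> F t" if "\<bar>t\<bar> < r" for t
      using y[OF r(2)[OF that]] by (simp add: F_def)
    from second_derivative_test[OF r(1) dF dF1 min] show ?thesis by (simp add: F1_def R_def)
  qed
  have "(p x - (1 / R) *\<^sub>R (x - y)) \<bullet> e = 0" for e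
    using main[of e] by (simp add: inner_diff_left)
  then have px: "p x = (1 / R) *\<^sub>R (x - y)" by (metis inner_eq_zero_iff right_minus_eq)
  \<comment> \<open>The value \<open>R\<close> of the cost is thereby recognised as
    \<open>L = \<epsilon> / s\<close>, which turns the Hessian of the cost into
    \<open>cost_hess\<close>.\<close>
  have one: "1 - p x \<bullet> p x = \<epsilon>\<^sup>2 / R\<^sup>2"
  proof -
    have "p x \<bullet> p x = ((x - y) \<bullet> (x - y)) / R\<^sup>2"
      unfolding px inner_scaleR_left inner_scaleR_right by (simp add: power2_eq_square)
    also have "(x - y) \<bullet> (x - y) = R\<^sup>2 - \<epsilon>\<^sup>2" using R by simp
    finally show ?thesis using R(1) by (simp add: diff_divide_distrib)
  qed
  then show "p x \<bullet> p x < 1" using R eps by (smt (verit) divide_pos_pos zero_less_power)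
  have "sqrt (1 - p x \<bullet> p x) / \<epsilon> = 1 / R"
    unfolding one using R(1) eps by (simp add: real_sqrt_divide)
  moreover have "p x \<bullet> e = ((x - y) \<bullet> e) / R" by (simp add: px)
  ultimately have "e \<bullet> (cost_hess \<epsilon> (p x) *v e) = 1 / R * (e \<bullet> e - ((x - y) \<bullet> e) / R * (((x - y) \<bullet> e) / R))"
    unfolding cost_hess_form by (simp only:)
  also have "\<dots> = (e \<bullet> e) / R - ((x - y) \<bullet> e)\<^sup>2 / R ^ 3"
    using R(1) by (simp add: field_simps power2_eq_square power3_eq_cube)
  finally have "e \<bullet> (cost_hess \<epsilon> (p x) *v e) = (e \<bullet> e) / R - ((x - y) \<bullet> e)\<^sup>2 / R ^ 3" .
  then show "e \<bullet> (H x *v e) \<le> e \<bullet> (cost_hess \<epsilon> (p x) *v e)" using main[of e] by linarith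
qed

end

section \<open>The quadratic form of A along curves\<close>

text \<open>\<open>Psi1\<close> and \<open>Psi2\<close> are the first and second derivatives of \<open>Psi\<close> along a curve with
  \<open>p' = \<pi>\<close>, \<open>p'' = k\<close>, \<open>e' = z\<close>, \<open>e'' = 0\<close>.\<close>

definition Psi :: "real \<Rightarrow> real^'n \<Rightarrow> real^'n \<Rightarrow> real" where
  "Psi \<epsilon> p e = sqrt (1 - p \<bullet> p) / \<epsilon> * (e \<bullet> e - (p \<bullet> e)\<^sup>2)"

definition Psi1 :: "real \<Rightarrow> real^'n \<Rightarrow> real^'n \<Rightarrow> real^'n \<Rightarrow> real^'n \<Rightarrow> real" where
  "Psi1 \<epsilon> p \<pi> e z = (- (p \<bullet> \<pi>) / sqrt (1 - p \<bullet> p) * (e \<bullet> e - (p \<bullet> e)\<^sup>2)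
     + sqrt (1 - p \<bullet> p) * (2 * (e \<bullet> z) - 2 * (p \<bullet> e) * (\<pi> \<bullet> e + p \<bullet> z))) / \<epsilon>"

definition Psi2 :: "real \<Rightarrow> real^'n \<Rightarrow> real^'n \<Rightarrow> real^'n \<Rightarrow> real^'n \<Rightarrow> real^'n \<Rightarrow> real" where
  "Psi2 \<epsilon> p \<pi> k e z =
    ((- (\<pi> \<bullet> \<pi> + p \<bullet> k) / sqrt (1 - p \<bullet> p) - (p \<bullet> \<pi>)\<^sup>2 / sqrt (1 - p \<bullet> p) ^ 3) * (e \<bullet> e - (p \<bullet> e)\<^sup>2)
     + 2 * (- (p \<bullet> \<pi>) / sqrt (1 - p \<bullet> p)) * (2 * (e \<bullet> z) - 2 * (p \<bullet> e) * (\<pi> \<bullet> e + p \<bullet> z))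
     + sqrt (1 - p \<bullet> p) * (2 * (z \<bullet> z) - 2 * (\<pi> \<bullet> e + p \<bullet> z)\<^sup>2 - 2 * (p \<bullet> e) * (k \<bullet> e + 2 * (\<pi> \<bullet> z)))) / \<epsilon>"

lemma cost_hess_Psi: "e \<bullet> (cost_hess \<epsilon> p *v e) = Psi \<epsilon> p e"
  by (simp add: cost_hess_form Psi_def power2_eq_square)

lemma DERIV_inner_vector:
  fixes f g :: "real \<Rightarrow> 'a::real_inner"
  assumes "(f has_vector_derivative f') (at t)" "(g has_vector_derivative g') (at t)"
  shows "((\<lambda>t. f t \<bullet> g t) has_real_derivative (f t \<bullet> g' + f' \<bullet> g t)) (at t)"
proof -
  have "((\<lambda>t. f t \<bullet> g t) has_derivative (\<lambda>h. f t \<bullet> (h *\<^sub>R g') + (h *\<^sub>R f') \<bullet> g t)) (at t)"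
    using assms unfolding has_vector_derivative_def by (rule has_derivative_inner)
  moreover have "(\<lambda>h. f t \<bullet> (h *\<^sub>R g') + (h *\<^sub>R f') \<bullet> g t) = (*) (f t \<bullet> g' + f' \<bullet> g t)"
    by (auto simp: algebra_simps)
  ultimately show ?thesis by (simp add: has_field_derivative_def)
qed

context
  fixes P \<pi> :: "real \<Rightarrow> real^'n" and E :: "real \<Rightarrow> real^'n" and k z :: "real^'n" and t \<epsilon> :: real
  assumes P: "(P has_vector_derivative \<pi> t) (at t)" and E: "(E has_vector_derivative z) (at t)"
    and P1: "P t \<bullet> P t < 1"
begin

lemmas Psi_scalar_derivs =
  DERIV_inner_vector[OF P P] DERIV_inner_vector[OF P E] DERIV_inner_vector[OF E E]

lemma sqrt_deriv:
  "((\<lambda>t. sqrt (1 - P t \<bullet> P t)) has_real_derivative - (P t \<bullet> \<pi> t) / sqrt (1 - P t \<bullet> P t)) (at t)"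
  using P1 by (auto intro!: derivative_eq_intros Psi_scalar_derivs simp: inner_commute field_simps)

lemma Psi_quadratic_deriv: "((\<lambda>t. E t \<bullet> E t - (P t \<bullet> E t)\<^sup>2) has_real_derivative
      2 * (E t \<bullet> z) - 2 * (P t \<bullet> E t) * (\<pi> t \<bullet> E t + P t \<bullet> z)) (at t)"
  by (rule derivative_eq_intros Psi_scalar_derivs refl)+ (simp add: inner_commute algebra_simps)

lemma Psi_deriv: "((\<lambda>t. Psi \<epsilon> (P t) (E t)) has_real_derivative Psi1 \<epsilon> (P t) (\<pi> t) (E t) z) (at t)"
  unfolding Psi_def
  by (rule DERIV_cong[OF DERIV_mult[OF DERIV_cdivide[OF sqrt_deriv] Psi_quadratic_deriv]])
     (simp add: Psi1_def add_divide_distrib diff_divide_distrib mult_ac)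

lemma sqrt_gradient_deriv:
  assumes \<pi>: "(\<pi> has_vector_derivative k) (at t)"
  shows "((\<lambda>t. - (P t \<bullet> \<pi> t) / sqrt (1 - P t \<bullet> P t)) has_real_derivative
      - (\<pi> t \<bullet> \<pi> t + P t \<bullet> k) / sqrt (1 - P t \<bullet> P t) - (P t \<bullet> \<pi> t)\<^sup>2 / sqrt (1 - P t \<bullet> P t) ^ 3) (at t)"
proof -
  define s where "s = sqrt (1 - P t \<bullet> P t)"
  have s: "s > 0" using P1 by (simp add: s_def)
  have ds: "((\<lambda>t. sqrt (1 - P t \<bullet> P t)) has_real_derivative - (P t \<bullet> \<pi> t) / s) (at t)"
    using P1 by (auto intro!: derivative_eq_intros Psi_scalar_derivs simp: s_def inner_commute field_simps)
  have dq: "((\<lambda>t. - (P t \<bullet> \<pi> t)) has_real_derivative - (P t \<bullet> k + \<pi> t \<bullet> \<pi> t)) (at t)"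
    by (rule derivative_eq_intros DERIV_inner_vector[OF P \<pi>] refl)+
  have "((\<lambda>t. - (P t \<bullet> \<pi> t) / sqrt (1 - P t \<bullet> P t)) has_real_derivative
     (- (P t \<bullet> k + \<pi> t \<bullet> \<pi> t) * s - - (P t \<bullet> \<pi> t) * (- (P t \<bullet> \<pi> t) / s)) / (s * s)) (at t)"
    using DERIV_divide[OF dq ds] s by (simp add: s_def)
  moreover have "(- (P t \<bullet> k + \<pi> t \<bullet> \<pi> t) * s - - (P t \<bullet> \<pi> t) * (- (P t \<bullet> \<pi> t) / s)) / (s * s)
    = - (\<pi> t \<bullet> \<pi> t + P t \<bullet> k) / s - (P t \<bullet> \<pi> t)\<^sup>2 / s ^ 3"
    using s by (simp add: field_simps power2_eq_square power3_eq_cube)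
  ultimately show ?thesis by (simp add: s_def)
qed

lemma Psi1_deriv:
  assumes \<pi>: "(\<pi> has_vector_derivative k) (at t)"
  shows "((\<lambda>t. Psi1 \<epsilon> (P t) (\<pi> t) (E t) z) has_real_derivative Psi2 \<epsilon> (P t) (\<pi> t) k (E t) z) (at t)"
proof -
  have Z: "((\<lambda>_. z) has_vector_derivative 0) (at t)" by simp
  have dm1: "((\<lambda>t. 2 * (E t \<bullet> z) - 2 * (P t \<bullet> E t) * (\<pi> t \<bullet> E t + P t \<bullet> z)) has_real_derivative
      2 * (z \<bullet> z) - 2 * (\<pi> t \<bullet> E t + P t \<bullet> z)\<^sup>2 - 2 * (P t \<bullet> E t) * (k \<bullet> E t + 2 * (\<pi> t \<bullet> z))) (at t)"
    by (rule derivative_eq_intros Psi_scalar_derivs DERIV_inner_vector[OF E Z]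
          DERIV_inner_vector[OF \<pi> E] DERIV_inner_vector[OF P Z] refl)+
       (simp add: inner_commute algebra_simps power2_eq_square)
  show ?thesis
    unfolding Psi1_def Psi2_def
    by (rule DERIV_cong[OF DERIV_cdivide[OF DERIV_add[OF
          DERIV_mult[OF sqrt_gradient_deriv[OF \<pi>] Psi_quadratic_deriv] DERIV_mult[OF sqrt_deriv dm1]]]])
       (simp add: mult_ac)
qed

end

text \<open>\<open>G\<close> lives on a normed space because it is applied to functions of a point,
  of a real number, and of a pair of point and vector. Base point and direction depend on
  \<open>k\<close>, as the approximate minimisers do.\<close>

lemma second_difference_along:
  fixes G :: "'a::real_normed_vector \<Rightarrow> real"
  assumes U: "open U" "z \<in> U"
    and d1: "\<And>y \<zeta> t. y + t *\<^sub>R \<zeta> \<in> U \<Longrightarrow> ((\<lambda>t. G (y + t *\<^sub>R \<zeta>)) has_real_derivative G1 (y + t *\<^sub>R \<zeta>) \<zeta>) (at t)"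
    and d2: "\<And>y \<zeta> t. y + t *\<^sub>R \<zeta> \<in> U \<Longrightarrow> ((\<lambda>t. G1 (y + t *\<^sub>R \<zeta>) \<zeta>) has_real_derivative G2 (y + t *\<^sub>R \<zeta>) \<zeta>) (at t)"
    and c: "\<And>y \<eta>. y \<longlonglongrightarrow> z \<Longrightarrow> \<eta> \<longlonglongrightarrow> \<zeta> \<Longrightarrow> (\<lambda>k. G2 (y k) (\<eta> k)) \<longlonglongrightarrow> G2 z \<zeta>"
    and h: "\<And>k. 0 < h k" "h \<longlonglongrightarrow> 0" and y: "y \<longlonglongrightarrow> z" and \<eta>: "\<eta> \<longlonglongrightarrow> \<zeta>"
  shows "(\<lambda>k. (G (y k + h k *\<^sub>R \<eta> k) + G (y k - h k *\<^sub>R \<eta> k) - 2 * G (y k)) / (h k)\<^sup>2) \<longlonglongrightarrow> G2 z \<zeta>"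
proof -
  obtain d where d: "d > 0" "ball z d \<subseteq> U" using U by (meson openE)
  have "(\<lambda>k. h k * norm (\<eta> k)) \<longlonglongrightarrow> 0 * norm \<zeta>" by (intro tendsto_intros h \<eta>)
  then have e1: "\<forall>\<^sub>F k in sequentially. h k * norm (\<eta> k) < d / 2" using d by (intro order_tendstoD(2)) auto
  have e2: "\<forall>\<^sub>F k in sequentially. dist (y k) z < d / 2" using y d by (intro tendstoD) auto
  have inU: "\<forall>\<^sub>F k in sequentially. \<forall>t. \<bar>t\<bar> \<le> h k \<longrightarrow> y k + t *\<^sub>R \<eta> k \<in> U"
    using e1 e2
  proof eventually_elim
    case (elim k)
    show ?case
    proof (intro allI impI)
      fix t assume "\<bar>t\<bar> \<le> h k"
      then have "\<bar>t\<bar> * norm (\<eta> k) \<le> h k * norm (\<eta> k)" by (intro mult_right_mono) auto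
      then have "norm (t *\<^sub>R \<eta> k) < d / 2" using elim by simp
      then have "dist z (y k + t *\<^sub>R \<eta> k) < d"
        using elim norm_triangle_ineq[of "y k - z" "t *\<^sub>R \<eta> k"]
        by (simp add: dist_norm norm_minus_commute[of z] algebra_simps)
      then show "y k + t *\<^sub>R \<eta> k \<in> U" using d by auto
    qed
  qed
  have "(\<lambda>k. (G (y k + h k *\<^sub>R \<eta> k) + G (y k + (- h k) *\<^sub>R \<eta> k) - 2 * G (y k + 0 *\<^sub>R \<eta> k)) / (h k)\<^sup>2) \<longlonglongrightarrow> G2 z \<zeta>"
  proof (rule second_difference_tendsto[where F = "\<lambda>k t. G (y k + t *\<^sub>R \<eta> k)" and ?F1.0 = "\<lambda>k t. G1 (y k + t *\<^sub>R \<eta> k) (\<eta> k)"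
        and ?F2.0 = "\<lambda>k t. G2 (y k + t *\<^sub>R \<eta> k) (\<eta> k)"])
    show "0 < h k" for k by (rule h)
    show "\<forall>\<^sub>F k in sequentially. \<forall>t. \<bar>t\<bar> \<le> h k \<longrightarrow>
       ((\<lambda>t. G (y k + t *\<^sub>R \<eta> k)) has_real_derivative G1 (y k + t *\<^sub>R \<eta> k) (\<eta> k)) (at t) \<and>
       ((\<lambda>t. G1 (y k + t *\<^sub>R \<eta> k) (\<eta> k)) has_real_derivative G2 (y k + t *\<^sub>R \<eta> k) (\<eta> k)) (at t)"
      using inU by eventually_elim (use d1 d2 in blast)
    fix \<theta> :: "nat \<Rightarrow> real" assume \<theta>: "\<And>k. \<bar>\<theta> k\<bar> \<le> h k"
    have "\<theta> \<longlonglongrightarrow> 0" by (rule tendsto_0_le[OF h(2), where K = 1]) (use \<theta> h(1) in \<open>auto simp: less_imp_le\<close>)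
    then have "(\<lambda>k. y k + \<theta> k *\<^sub>R \<eta> k) \<longlonglongrightarrow> z + 0 *\<^sub>R \<zeta>" by (intro tendsto_intros y \<eta>)
    then show "(\<lambda>k. G2 (y k + \<theta> k *\<^sub>R \<eta> k) (\<eta> k)) \<longlonglongrightarrow> G2 z \<zeta>" by (intro c \<eta>) simp
  qed
  then show ?thesis by simp
qed

section \<open>The discrete maximum principle\<close>

lemma DERIV_penalty:
  fixes a e :: "'a::real_inner"
  shows "((\<lambda>t. ((a + t *\<^sub>R e) \<bullet> (a + t *\<^sub>R e))\<^sup>2) has_real_derivative
      4 * ((a + t *\<^sub>R e) \<bullet> (a + t *\<^sub>R e)) * ((a + t *\<^sub>R e) \<bullet> e)) (at t)"
    and "((\<lambda>t. 4 * ((a + t *\<^sub>R e) \<bullet> (a + t *\<^sub>R e)) * ((a + t *\<^sub>R e) \<bullet> e)) has_real_derivative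
      8 * (a \<bullet> e)\<^sup>2 + 4 * (a \<bullet> a) * (e \<bullet> e)) (at 0)"
proof -
  have L: "((\<lambda>t. a + t *\<^sub>R e) has_vector_derivative e) (at t)" for t
    by (auto intro!: derivative_eq_intros)
  have C: "((\<lambda>_. e) has_vector_derivative 0) (at t)" for t by simp
  show "((\<lambda>t. ((a + t *\<^sub>R e) \<bullet> (a + t *\<^sub>R e))\<^sup>2) has_real_derivative
      4 * ((a + t *\<^sub>R e) \<bullet> (a + t *\<^sub>R e)) * ((a + t *\<^sub>R e) \<bullet> e)) (at t)"
    by (rule derivative_eq_intros DERIV_inner_vector[OF L L] refl)+ (simp add: inner_commute)
  show "((\<lambda>t. 4 * ((a + t *\<^sub>R e) \<bullet> (a + t *\<^sub>R e)) * ((a + t *\<^sub>R e) \<bullet> e)) has_real_derivative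
      8 * (a \<bullet> e)\<^sup>2 + 4 * (a \<bullet> a) * (e \<bullet> e)) (at 0)"
    by (rule derivative_eq_intros DERIV_inner_vector[OF L L] DERIV_inner_vector[OF L C] refl)+
       (simp add: inner_commute power2_eq_square)
qed

text \<open>In the application \<open>\<kappa> = Z / \<rho>\<^sup>2 - 1\<close>, where \<open>Z\<close> is the maximum of \<open>\<rho>\<^sup>2 w(\<xi>,\<xi>) / A(\<xi>,\<xi>)\<close>.\<close>

locale touching = C3_jet S u p H D
  for S :: "(real^'n) set" and u p H D +
  fixes \<epsilon> :: real and \<kappa> :: "real^'n \<Rightarrow> real" and \<kappa>1 :: "real^'n \<Rightarrow> real^'n"
    and \<kappa>2 :: "real^'n \<Rightarrow> real^'n^'n" and x0 \<xi>0 :: "real^'n"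
  assumes eps: "0 < \<epsilon>"
    and p_less: "x \<in> S \<Longrightarrow> p x \<bullet> p x < 1"
    and d\<kappa>: "x \<in> S \<Longrightarrow> (\<kappa> has_derivative (\<lambda>v. \<kappa>1 x \<bullet> v)) (at x)"
    and d\<kappa>1: "x \<in> S \<Longrightarrow> (\<kappa>1 has_derivative (\<lambda>v. \<kappa>2 x *v v)) (at x)"
    and isCont_\<kappa>2: "x \<in> S \<Longrightarrow> isCont \<kappa>2 x"
    and x0: "x0 \<in> S"
    and Q_nonneg: "x \<in> S \<Longrightarrow> 0 \<le> \<xi> \<bullet> (H x *v \<xi>) + \<kappa> x * Psi \<epsilon> (p x) \<xi>"
    and Q_zero: "\<xi>0 \<bullet> (H x0 *v \<xi>0) + \<kappa> x0 * Psi \<epsilon> (p x0) \<xi>0 = 0"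
begin

text \<open>The quartic penalties force the minimisers of \<open>Qh h\<close> to converge to \<open>(x0, \<xi>0)\<close>. Their second
  derivatives vanish there, so they disappear in the limit.\<close>

definition Qh :: "real \<Rightarrow> real^'n \<Rightarrow> real^'n \<Rightarrow> real" where
  "Qh h x \<xi> = (u (x + h *\<^sub>R \<xi>) + u (x - h *\<^sub>R \<xi>) - 2 * u x) / h\<^sup>2 + \<kappa> x * Psi \<epsilon> (p x) \<xi>
     + ((x - x0) \<bullet> (x - x0))\<^sup>2 + ((\<xi> - \<xi>0) \<bullet> (\<xi> - \<xi>0))\<^sup>2"

text \<open>Second derivative at \<open>t = 0\<close> of \<open>\<kappa> (x + t e) * Psi \<epsilon>
  (p (x + t e)) (\<xi> + t z)\<close>, written out by the product rule.\<close>

definition K2 :: "real^'n \<Rightarrow> real^'n \<Rightarrow> real^'n \<Rightarrow> real^'n \<Rightarrow> real" where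
  "K2 x \<xi> e z = (e \<bullet> (\<kappa>2 x *v e)) * Psi \<epsilon> (p x) \<xi>
     + 2 * (\<kappa>1 x \<bullet> e) * Psi1 \<epsilon> (p x) (H x *v e) \<xi> z
     + \<kappa> x * Psi2 \<epsilon> (p x) (H x *v e) (D3 x e *v e) \<xi> z"

text \<open>Second derivative of the fourth power of the norm at \<open>a\<close> along
  \<open>e\<close>.\<close>

definition pen2 :: "real^'n \<Rightarrow> real^'n \<Rightarrow> real" where
  "pen2 a e = 8 * (a \<bullet> e)\<^sup>2 + 4 * (a \<bullet> a) * (e \<bullet> e)"

lemma line_p: "y + t *\<^sub>R e \<in> S \<Longrightarrow>
    ((\<lambda>t. p (y + t *\<^sub>R e)) has_vector_derivative H (y + t *\<^sub>R e) *v e) (at t)"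
  by (intro vector_derivative_along_line dp)

lemma line_H: "y + t *\<^sub>R e \<in> S \<Longrightarrow>
    ((\<lambda>t. H (y + t *\<^sub>R e) *v e) has_vector_derivative D3 (y + t *\<^sub>R e) e *v e) (at t)"
  by (intro vector_derivative_along_line[where G = "\<lambda>x. H x *v e"] matrix_vector_mult_has_derivative dH')

lemma line_u: "y + t *\<^sub>R e \<in> S \<Longrightarrow>
    ((\<lambda>t. u (y + t *\<^sub>R e)) has_real_derivative p (y + t *\<^sub>R e) \<bullet> e) (at t)"
  by (intro DERIV_along_line du)

lemma line_u1: "y + t *\<^sub>R e \<in> S \<Longrightarrow>
    ((\<lambda>t. p (y + t *\<^sub>R e) \<bullet> e) has_real_derivative e \<bullet> (H (y + t *\<^sub>R e) *v e)) (at t)"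
  using DERIV_inner_vector[OF line_p has_vector_derivative_const, of y t e e] by (simp add: inner_commute)

lemma line_\<kappa>: "y + t *\<^sub>R e \<in> S \<Longrightarrow>
    ((\<lambda>t. \<kappa> (y + t *\<^sub>R e)) has_real_derivative \<kappa>1 (y + t *\<^sub>R e) \<bullet> e) (at t)"
  by (intro DERIV_along_line d\<kappa>)

lemma line_\<kappa>1: "y + t *\<^sub>R e \<in> S \<Longrightarrow>
    ((\<lambda>t. \<kappa>1 (y + t *\<^sub>R e) \<bullet> e) has_real_derivative e \<bullet> (\<kappa>2 (y + t *\<^sub>R e) *v e)) (at t)"
  using DERIV_inner_vector[OF vector_derivative_along_line[OF d\<kappa>1] has_vector_derivative_const, of y t e e]
  by (simp add: inner_commute)

lemma line_Psi: "y + t *\<^sub>R e \<in> S \<Longrightarrow>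
    ((\<lambda>t. Psi \<epsilon> (p (y + t *\<^sub>R e)) (\<xi> + t *\<^sub>R z)) has_real_derivative
      Psi1 \<epsilon> (p (y + t *\<^sub>R e)) (H (y + t *\<^sub>R e) *v e) (\<xi> + t *\<^sub>R z) z) (at t)"
  by (rule Psi_deriv[where P = "\<lambda>t. p (y + t *\<^sub>R e)" and \<pi> = "\<lambda>t. H (y + t *\<^sub>R e) *v e" and E = "\<lambda>t. \<xi> + t *\<^sub>R z"])
     (auto intro!: line_p p_less derivative_eq_intros)

lemma line_Psi1: "y + t *\<^sub>R e \<in> S \<Longrightarrow>
    ((\<lambda>t. Psi1 \<epsilon> (p (y + t *\<^sub>R e)) (H (y + t *\<^sub>R e) *v e) (\<xi> + t *\<^sub>R z) z) has_real_derivative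
      Psi2 \<epsilon> (p (y + t *\<^sub>R e)) (H (y + t *\<^sub>R e) *v e) (D3 (y + t *\<^sub>R e) e *v e) (\<xi> + t *\<^sub>R z) z) (at t)"
  by (rule Psi1_deriv[where P = "\<lambda>t. p (y + t *\<^sub>R e)" and \<pi> = "\<lambda>t. H (y + t *\<^sub>R e) *v e" and E = "\<lambda>t. \<xi> + t *\<^sub>R z"])
     (auto intro!: line_p line_H p_less derivative_eq_intros)

lemma u_second_difference:
  assumes "x \<in> S" "\<And>k. 0 < h k" "h \<longlonglongrightarrow> 0" "y \<longlonglongrightarrow> x" "\<eta> \<longlonglongrightarrow> \<zeta>"
  shows "(\<lambda>k. (u (y k + h k *\<^sub>R \<eta> k) + u (y k - h k *\<^sub>R \<eta> k) - 2 * u (y k)) / (h k)\<^sup>2)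
     \<longlonglongrightarrow> \<zeta> \<bullet> (H x *v \<zeta>)"
proof (rule second_difference_along[OF open_S assms(1) line_u line_u1 _ assms(2-5)])
  fix y \<eta> :: "nat \<Rightarrow> real^'n" assume "y \<longlonglongrightarrow> x" "\<eta> \<longlonglongrightarrow> \<zeta>"
  then show "(\<lambda>k. \<eta> k \<bullet> (H (y k) *v \<eta> k)) \<longlonglongrightarrow> \<zeta> \<bullet> (H x *v \<zeta>)"
    by (intro tendsto_intros tendsto_matrix_vector_mult isCont_tendsto_compose[OF isCont_H[OF assms(1)]])
qed

text \<open>Moving \<open>x\<close> by \<open>t e\<close> and \<xi> by \<open>t z\<close> moves the
  outer points \<open>x \<plusminus> h \<xi>\<close> along \<open>e \<plusminus> h z\<close>; hence
  the Hessians there act on these shifted vectors.\<close>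

lemma second_order_min:
  assumes h: "0 < h" and x: "x \<in> S" "x + h *\<^sub>R \<xi> \<in> S" "x - h *\<^sub>R \<xi> \<in> S"
    and r: "0 < r" "\<And>t. \<bar>t\<bar> < r \<Longrightarrow> Qh h x \<xi> \<le> Qh h (x + t *\<^sub>R e) (\<xi> + t *\<^sub>R z)"
  shows "0 \<le> ((e + h *\<^sub>R z) \<bullet> (H (x + h *\<^sub>R \<xi>) *v (e + h *\<^sub>R z)) + (e - h *\<^sub>R z) \<bullet> (H (x - h *\<^sub>R \<xi>) *v (e - h *\<^sub>R z))
      - 2 * (e \<bullet> (H x *v e))) / h\<^sup>2 + K2 x \<xi> e z + pen2 (x - x0) e + pen2 (\<xi> - \<xi>0) z"
proof -
  obtain r1 where r1: "r1 > 0" "\<And>t. \<bar>t\<bar> < r1 \<Longrightarrow> x + t *\<^sub>R e \<in> S" using line_in_S[OF x(1)] by blast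
  obtain r2 where r2: "r2 > 0" "\<And>t. \<bar>t\<bar> < r2 \<Longrightarrow> (x + h *\<^sub>R \<xi>) + t *\<^sub>R (e + h *\<^sub>R z) \<in> S"
    using line_in_S[OF x(2)] by blast
  obtain r3 where r3: "r3 > 0" "\<And>t. \<bar>t\<bar> < r3 \<Longrightarrow> (x - h *\<^sub>R \<xi>) + t *\<^sub>R (e - h *\<^sub>R z) \<in> S"
    using line_in_S[OF x(3)] by blast
  define d where "d = Min {r, r1, r2, r3}"
  have d: "d > 0" "d \<le> r" "d \<le> r1" "d \<le> r2" "d \<le> r3" using r r1 r2 r3 by (auto simp: d_def)
  define F where "F t = (u ((x + h *\<^sub>R \<xi>) + t *\<^sub>R (e + h *\<^sub>R z)) + u ((x - h *\<^sub>R \<xi>) + t *\<^sub>R (e - h *\<^sub>R z))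
      - 2 * u (x + t *\<^sub>R e)) / h\<^sup>2 + \<kappa> (x + t *\<^sub>R e) * Psi \<epsilon> (p (x + t *\<^sub>R e)) (\<xi> + t *\<^sub>R z)
      + ((x - x0 + t *\<^sub>R e) \<bullet> (x - x0 + t *\<^sub>R e))\<^sup>2 + ((\<xi> - \<xi>0 + t *\<^sub>R z) \<bullet> (\<xi> - \<xi>0 + t *\<^sub>R z))\<^sup>2" for t
  define F1 where "F1 t = (p ((x + h *\<^sub>R \<xi>) + t *\<^sub>R (e + h *\<^sub>R z)) \<bullet> (e + h *\<^sub>R z)
      + p ((x - h *\<^sub>R \<xi>) + t *\<^sub>R (e - h *\<^sub>R z)) \<bullet> (e - h *\<^sub>R z)
      - 2 * (p (x + t *\<^sub>R e) \<bullet> e)) / h\<^sup>2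
      + ((\<kappa>1 (x + t *\<^sub>R e) \<bullet> e) * Psi \<epsilon> (p (x + t *\<^sub>R e)) (\<xi> + t *\<^sub>R z)
         + Psi1 \<epsilon> (p (x + t *\<^sub>R e)) (H (x + t *\<^sub>R e) *v e) (\<xi> + t *\<^sub>R z) z * \<kappa> (x + t *\<^sub>R e))
      + 4 * ((x - x0 + t *\<^sub>R e) \<bullet> (x - x0 + t *\<^sub>R e)) * ((x - x0 + t *\<^sub>R e) \<bullet> e)
      + 4 * ((\<xi> - \<xi>0 + t *\<^sub>R z) \<bullet> (\<xi> - \<xi>0 + t *\<^sub>R z)) * ((\<xi> - \<xi>0 + t *\<^sub>R z) \<bullet> z)" for t
  have FQ: "F t = Qh h (x + t *\<^sub>R e) (\<xi> + t *\<^sub>R z)" for t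
    by (simp add: F_def Qh_def algebra_simps)
  have dF: "(F has_real_derivative F1 t) (at t)" if "\<bar>t\<bar> < d" for t
    unfolding F_def F1_def
    by (intro DERIV_add DERIV_diff DERIV_cdivide DERIV_mult DERIV_cmult line_u line_\<kappa> line_Psi DERIV_penalty(1)
        r1(2) r2(2) r3(2)) (use that d in auto)
  have dF1: "(F1 has_real_derivative
      ((e + h *\<^sub>R z) \<bullet> (H (x + h *\<^sub>R \<xi> + 0 *\<^sub>R (e + h *\<^sub>R z)) *v (e + h *\<^sub>R z)) + (e - h *\<^sub>R z) \<bullet> (H (x - h *\<^sub>R \<xi> + 0 *\<^sub>R (e - h *\<^sub>R z)) *v (e - h *\<^sub>R z))
      - 2 * (e \<bullet> (H (x + 0 *\<^sub>R e) *v e))) / h\<^sup>2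
      + ((e \<bullet> (\<kappa>2 (x + 0 *\<^sub>R e) *v e)) * Psi \<epsilon> (p (x + 0 *\<^sub>R e)) (\<xi> + 0 *\<^sub>R z)
         + Psi1 \<epsilon> (p (x + 0 *\<^sub>R e)) (H (x + 0 *\<^sub>R e) *v e) (\<xi> + 0 *\<^sub>R z) z * (\<kappa>1 (x + 0 *\<^sub>R e) \<bullet> e)
       + (Psi2 \<epsilon> (p (x + 0 *\<^sub>R e)) (H (x + 0 *\<^sub>R e) *v e) (D3 (x + 0 *\<^sub>R e) e *v e) (\<xi> + 0 *\<^sub>R z) z * \<kappa> (x + 0 *\<^sub>R e)
         + (\<kappa>1 (x + 0 *\<^sub>R e) \<bullet> e) * Psi1 \<epsilon> (p (x + 0 *\<^sub>R e)) (H (x + 0 *\<^sub>R e) *v e) (\<xi> + 0 *\<^sub>R z) z))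
      + pen2 (x - x0) e + pen2 (\<xi> - \<xi>0) z) (at 0)"
    unfolding F1_def pen2_def
    by (intro DERIV_add DERIV_diff DERIV_cdivide DERIV_mult DERIV_cmult line_u1 line_\<kappa> line_\<kappa>1 line_Psi line_Psi1
        DERIV_penalty(2)) (use x in auto)
  have "F 0 \<le> F t" if "\<bar>t\<bar> < d" for t
    using r(2)[of t] that d by (simp add: FQ)
  from second_derivative_test(2)[OF d(1) dF dF1 this] show ?thesis
    by (simp add: K2_def algebra_simps)
qed

lemma tendsto_Psi:
  assumes "(\<lambda>k. a k) \<longlonglongrightarrow> a0" "(\<lambda>k. b k) \<longlonglongrightarrow> b0"
  shows "(\<lambda>k. Psi \<epsilon> (a k) (b k)) \<longlonglongrightarrow> Psi \<epsilon> a0 b0"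
  unfolding Psi_def using eps by (intro tendsto_intros assms) auto

text \<open>Minimisers over a fixed compact product of balls have a convergent subsequence.
  Comparing with the value at \<open>(x0, \<xi>0)\<close> and letting the step tend to 0 shows that
  at the limit point the form of \<open>Q_nonneg\<close> plus both penalties is at most 0. The form
  is nonnegative there, so both penalties vanish.\<close>

lemma penalised_minimisers:
  obtains h x \<xi> r where "\<And>k. 0 < h k" "h \<longlonglongrightarrow> 0" "x \<longlonglongrightarrow> x0" "\<xi> \<longlonglongrightarrow> \<xi>0" "0 < (r::real)"
    "\<And>k y \<eta>. dist x0 y \<le> r \<Longrightarrow> dist \<xi>0 \<eta> \<le> r \<Longrightarrow> Qh (h k) (x k) (\<xi> k) \<le> Qh (h k) y \<eta>"
proof -
  obtain d where d: "d > 0" "ball x0 d \<subseteq> S" using open_S x0 by (meson openE)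
  \<comment> \<open>A third of the radius leaves room for a base point within \<open>r\<close> of
    \<open>x0\<close> and a further shift of length at most \<open>r\<close>.\<close>
  define r where "r = d / 3"
  have r: "r > 0" "cball x0 (2 * r) \<subseteq> S" using d by (auto simp: r_def subset_iff)
  \<comment> \<open>Steps so small that \<open>g k\<close> times any vector within \<open>r\<close>
    of \<open>\<xi>0\<close> has length at most \<open>r\<close>, so the three points of the
    quotient stay in \<open>S\<close>.\<close>
  define g where "g k = r / (norm \<xi>0 + r) * inverse (real (Suc k))" for k
  have g0: "g k > 0" for k using r by (simp add: g_def add_nonneg_pos)
  have glim: "g \<longlonglongrightarrow> 0" unfolding g_def by (intro tendsto_mult_right_zero LIMSEQ_inverse_real_of_nat)
  define K where "K = cball x0 r \<times> cball \<xi>0 r"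
  have K: "compact K" by (simp add: K_def compact_Times)
  have K0: "(x0, \<xi>0) \<in> K" using r by (simp add: K_def)
  have gS: "y + c *\<^sub>R \<eta> \<in> S" if "dist x0 y \<le> r" "dist \<xi>0 \<eta> \<le> r" "\<bar>c\<bar> \<le> g k" for y \<eta> c k
  proof -
    have "norm \<eta> \<le> norm \<xi>0 + r"
      using that(2) norm_triangle_ineq2[of \<eta> \<xi>0] by (simp add: dist_norm norm_minus_commute)
    moreover have "g k \<le> r / (norm \<xi>0 + r)"
      using r unfolding g_def by (intro mult_left_le) (auto simp: field_simps)
    ultimately have "\<bar>c\<bar> * norm \<eta> \<le> r / (norm \<xi>0 + r) * (norm \<xi>0 + r)"
      using that(3) g0[of k] r by (intro mult_mono) auto
    also have "\<dots> = r" using r by (simp add: add_nonneg_pos order_less_imp_not_eq2)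
    finally have "norm (c *\<^sub>R \<eta>) \<le> r" by simp
    then have "dist x0 (y + c *\<^sub>R \<eta>) \<le> 2 * r"
      using that(1) norm_triangle_ineq[of "y - x0" "c *\<^sub>R \<eta>"]
      by (simp add: dist_norm norm_minus_commute[of x0] algebra_simps)
    then show ?thesis using r by auto
  qed
  have yS: "y \<in> S" if "dist x0 y \<le> r" for y using gS[OF that, of \<xi>0 0 0] r g0[of 0] by simp
  have contS: "continuous_on S u" "continuous_on S p" "continuous_on S \<kappa>"
    using isCont_u isCont_p has_derivative_continuous[OF d\<kappa>] by (auto simp: continuous_at_imp_continuous_on)
  have cont: "continuous_on K (\<lambda>z. Qh (g k) (fst z) (snd z))" for k
    unfolding Qh_def Psi_def K_def
    by (intro continuous_intros continuous_on_compose2[OF contS(1)] continuous_on_compose2[OF contS(2)]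
        continuous_on_compose2[OF contS(3)])
       (use eps g0[of k] gS[where k = k and c = "g k"] gS[where k = k and c = "- g k"] yS
         in \<open>auto simp: order_less_imp_not_eq2\<close>)
  have "\<exists>z\<in>K. \<forall>z'\<in>K. Qh (g k) (fst z) (snd z) \<le> Qh (g k) (fst z') (snd z')" for k
    using continuous_attains_inf[OF K _ cont] K0 by blast
  then obtain z where z: "\<And>k. z k \<in> K" "\<And>k z'. z' \<in> K \<Longrightarrow> Qh (g k) (fst (z k)) (snd (z k)) \<le> Qh (g k) (fst z') (snd z')"
    by metis
  obtain l \<sigma> where l: "l \<in> K" "strict_mono \<sigma>" "(z \<circ> \<sigma>) \<longlonglongrightarrow> l"
    using K z(1) unfolding compact_def by metis
  define h where "h = g \<circ> \<sigma>"
  define x where "x k = fst (z (\<sigma> k))" for k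
  define \<xi> where "\<xi> k = snd (z (\<sigma> k))" for k
  have h: "\<And>k. 0 < h k" "h \<longlonglongrightarrow> 0"
    using g0 LIMSEQ_subseq_LIMSEQ[OF glim l(2)] by (auto simp: h_def)
  have xl: "x \<longlonglongrightarrow> fst l" "\<xi> \<longlonglongrightarrow> snd l"
    using tendsto_fst[OF l(3)] tendsto_snd[OF l(3)] by (auto simp: x_def[abs_def] \<xi>_def[abs_def] o_def)
  have lS: "fst l \<in> S" using l(1) yS by (auto simp: K_def)
  have Qlim: "(\<lambda>k. Qh (h k) (y k) (\<eta> k)) \<longlonglongrightarrow> \<zeta> \<bullet> (H y0 *v \<zeta>) + \<kappa> y0 * Psi \<epsilon> (p y0) \<zeta>
      + ((y0 - x0) \<bullet> (y0 - x0))\<^sup>2 + ((\<zeta> - \<xi>0) \<bullet> (\<zeta> - \<xi>0))\<^sup>2"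
    if "y \<longlonglongrightarrow> y0" "\<eta> \<longlonglongrightarrow> \<zeta>" "y0 \<in> S" for y \<eta> y0 \<zeta>
    unfolding Qh_def
    by (intro tendsto_intros u_second_difference that h tendsto_Psi isCont_tendsto_compose[OF isCont_p]
        isCont_tendsto_compose[OF has_derivative_continuous[OF d\<kappa>]])
  have "(snd l) \<bullet> (H (fst l) *v snd l) + \<kappa> (fst l) * Psi \<epsilon> (p (fst l)) (snd l)
      + ((fst l - x0) \<bullet> (fst l - x0))\<^sup>2 + ((snd l - \<xi>0) \<bullet> (snd l - \<xi>0))\<^sup>2
     \<le> \<xi>0 \<bullet> (H x0 *v \<xi>0) + \<kappa> x0 * Psi \<epsilon> (p x0) \<xi>0 + ((x0 - x0) \<bullet> (x0 - x0))\<^sup>2 + ((\<xi>0 - \<xi>0) \<bullet> (\<xi>0 - \<xi>0))\<^sup>2"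
    by (rule LIMSEQ_le[OF Qlim[OF xl lS] Qlim[OF tendsto_const tendsto_const x0]])
       (use z(2)[OF K0] in \<open>auto simp: h_def x_def \<xi>_def\<close>)
  then have "((fst l - x0) \<bullet> (fst l - x0))\<^sup>2 + ((snd l - \<xi>0) \<bullet> (snd l - \<xi>0))\<^sup>2 \<le> 0"
    using Q_zero Q_nonneg[OF lS, of "snd l"] by simp
  then have "fst l = x0" "snd l = \<xi>0"
    by (simp_all add: sum_power2_le_zero_iff)
  with xl have "x \<longlonglongrightarrow> x0" "\<xi> \<longlonglongrightarrow> \<xi>0" by auto
  moreover have "Qh (h k) (x k) (\<xi> k) \<le> Qh (h k) y \<eta>" if "dist x0 y \<le> r" "dist \<xi>0 \<eta> \<le> r" for k y \<eta>
    using z(2)[of "(y, \<eta>)" "\<sigma> k"] that by (simp add: K_def h_def x_def \<xi>_def)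
  ultimately show thesis using that[OF h] r(1) by blast
qed

end

section \<open>Concavity of ln det at three points\<close>

lemma congruence_form:
  fixes W E :: "real^'n^'n"
  shows "v \<bullet> (transpose E ** W ** E *v v) = (E *v v) \<bullet> (W *v (E *v v))"
proof -
  have "v \<bullet> (transpose E ** W ** E *v v) = ((W *v (E *v v)) v* E) \<bullet> v"
    by (simp only: matrix_vector_mul_assoc[symmetric] transpose_matrix_vector inner_commute[of v])
  also have "\<dots> = (W *v (E *v v)) \<bullet> (E *v v)" by (rule dot_lmul_matrix)
  finally show ?thesis by (metis inner_commute)
qed

lemma pos_def_congruence:
  fixes W E :: "real^'n^'n"
  assumes W: "pos_def W" and E: "det E \<noteq> 0"
  shows "pos_def (transpose E ** W ** E)"
proof -
  have "transpose (transpose E ** W ** E) = transpose E ** W ** E"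
    using pos_defD(1)[OF W] by (simp add: matrix_transpose_mul matrix_mul_assoc)
  moreover have "E *v v \<noteq> 0" if "v \<noteq> 0" for v
    using E that by (metis invertible_det_nz invertible_left_inverse matrix_left_invertible_ker)
  ultimately show ?thesis using pos_defD(2)[OF W] by (simp add: pos_def_def congruence_form)
qed

text \<open>Contribution of the determinants of the congruences that carry the frame to
  \<open>x \<plusminus> h \<xi>\<close>. Taken with factor \<open>- 2\<close>, it becomes the
  summand \<open>2 * (q \<bullet> a)\<^sup>2\<close> of the limit inequality.\<close>

lemma ln_second_difference:
  fixes \<tau> :: real
  assumes h: "\<And>k. 0 < h k" "h \<longlonglongrightarrow> 0"
  shows "(\<lambda>k. (ln (1 + h k * \<tau>) + ln (1 - h k * \<tau>)) / (h k)\<^sup>2) \<longlonglongrightarrow> - \<tau>\<^sup>2"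
proof -
  have "(\<lambda>k. (ln (1 + (0 + h k *\<^sub>R 1) * \<tau>) + ln (1 + (0 - h k *\<^sub>R 1) * \<tau>) - 2 * ln (1 + 0 * \<tau>)) / (h k)\<^sup>2)
     \<longlonglongrightarrow> - (1 * \<tau>)\<^sup>2 / (1 + 0 * \<tau>)\<^sup>2"
  proof (rule second_difference_along[where U = "{t. 0 < 1 + t * \<tau>}" and G = "\<lambda>t. ln (1 + t * \<tau>)"
        and ?G1.0 = "\<lambda>t \<zeta>. \<zeta> * \<tau> / (1 + t * \<tau>)" and ?G2.0 = "\<lambda>t \<zeta>. - (\<zeta> * \<tau>)\<^sup>2 / (1 + t * \<tau>)\<^sup>2"])
    show "open {t. 0 < 1 + t * \<tau>}" by (intro open_Collect_less continuous_intros)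
    fix y \<zeta> t :: real assume "y + t *\<^sub>R \<zeta> \<in> {t. 0 < 1 + t * \<tau>}"
    then have *: "0 < 1 + (y + t * \<zeta>) * \<tau>" by simp
    then show "((\<lambda>t. ln (1 + (y + t *\<^sub>R \<zeta>) * \<tau>)) has_real_derivative \<zeta> * \<tau> / (1 + (y + t *\<^sub>R \<zeta>) * \<tau>)) (at t)"
      by (auto intro!: derivative_eq_intros)
    show "((\<lambda>t. \<zeta> * \<tau> / (1 + (y + t *\<^sub>R \<zeta>) * \<tau>)) has_real_derivative - (\<zeta> * \<tau>)\<^sup>2 / (1 + (y + t *\<^sub>R \<zeta>) * \<tau>)\<^sup>2) (at t)"
      using * by (auto intro!: derivative_eq_intros simp: power2_eq_square)
  next
    fix y \<eta> :: "nat \<Rightarrow> real" assume "y \<longlonglongrightarrow> 0" "\<eta> \<longlonglongrightarrow> 1"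
    then show "(\<lambda>k. - (\<eta> k * \<tau>)\<^sup>2 / (1 + y k * \<tau>)\<^sup>2) \<longlonglongrightarrow> - (1 * \<tau>)\<^sup>2 / (1 + 0 * \<tau>)\<^sup>2"
      by (intro tendsto_intros) auto
  qed (use h in auto)
  then show ?thesis by simp
qed

context touching
begin

definition wm :: "real^'n \<Rightarrow> real^'n^'n" where
  "wm x = cost_hess \<epsilon> (p x) - H x"

lemma wm_form: "e \<bullet> (wm x *v f) = e \<bullet> (cost_hess \<epsilon> (p x) *v f) - e \<bullet> (H x *v f)"
  by (simp add: wm_def matrix_vector_mult_diff_rdistrib inner_diff_right)

text \<open>With \<open>q = Du / (1 - |Du|\<^sup>2)\<close> the Christoffel symbols of the metric \<open>g\<close> are \<open>- q D\<^sup>2u\<close>. Hence for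
  \<open>a = D\<^sup>2u \<xi>\<close> the direction \<open>\<xi>\<close> moves by parallel transport to first order, \<open>\<xi> + t (a \<bullet> e) q\<close>, when
  \<open>x\<close> moves to \<open>x + t e\<close>.\<close>

lemma frame_inequality:
  fixes f :: "'n \<Rightarrow> real^'n"
  assumes w_pos: "\<And>x. x \<in> S \<Longrightarrow> pos_def (wm x)"
    and h: "0 < h" and x: "x \<in> S" "x + h *\<^sub>R \<xi> \<in> S" "x - h *\<^sub>R \<xi> \<in> S"
    and r: "0 < r" "\<And>e z t. \<bar>t\<bar> * (norm e + norm z) < r \<Longrightarrow> Qh h x \<xi> \<le> Qh h (x + t *\<^sub>R e) (\<xi> + t *\<^sub>R z)"
    and f: "\<And>i j. f i \<bullet> (wm x *v f j) = (if i = j then l i else 0)" and l: "\<And>i. 0 < l i"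
    and \<tau>: "\<bar>h * (q \<bullet> a)\<bar> < 1"
    and z: "\<And>i. z i = (a \<bullet> f i) *\<^sub>R q"
  shows "0 \<le> (\<Sum>i\<in>UNIV. ((Psi \<epsilon> (p (x + h *\<^sub>R \<xi>)) (f i + h *\<^sub>R z i) + Psi \<epsilon> (p (x - h *\<^sub>R \<xi>)) (f i - h *\<^sub>R z i)
          - 2 * Psi \<epsilon> (p x) (f i)) / h\<^sup>2 + K2 x \<xi> (f i) (z i) + pen2 (x - x0) (f i) + pen2 (\<xi> - \<xi>0) (z i)) / l i)
      - (ln (det (wm (x + h *\<^sub>R \<xi>))) + ln (det (wm (x - h *\<^sub>R \<xi>))) - 2 * ln (det (wm x))) / h\<^sup>2
      - 2 * ((ln (1 + h * (q \<bullet> a)) + ln (1 - h * (q \<bullet> a))) / h\<^sup>2)"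
proof -
  \<comment> \<open>\<open>z i\<close> depends linearly on \<open>f i\<close>, so all shifted frame
    vectors are images under the one matrix \<open>E c\<close>. The forms at the outer points thus
    become those of a single congruent matrix \<open>Y c\<close> with explicit determinant.\<close>
  define E where "E c = mat 1 + outer (c *\<^sub>R q) a" for c
  define Y where "Y c = transpose (E c) ** wm (x + c *\<^sub>R \<xi>) ** E c" for c
  have Ef: "E c *v f i = f i + c *\<^sub>R z i" for c i
    by (simp add: E_def matrix_vector_mult_add_rdistrib outer_mult_vec z)
  have detE: "det (E c) = 1 + c * (q \<bullet> a)" for c by (simp add: E_def det_rank_one)
  have Yf: "f i \<bullet> (Y c *v f i) = (f i + c *\<^sub>R z i) \<bullet> (wm (x + c *\<^sub>R \<xi>) *v (f i + c *\<^sub>R z i))" for c i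
    by (simp add: Y_def congruence_form Ef)
  \<comment> \<open>The weights \<open>1 / l i\<close> are those for which the sum over the frame is
    the derivative of \<open>ln det\<close> at \<open>wm x\<close> in direction
    \<open>Y c\<close>.\<close>
  have conc: "CARD('n) + (ln (det (wm (x + c *\<^sub>R \<xi>))) + 2 * ln (1 + c * (q \<bullet> a))) - ln (det (wm x))
      \<le> (\<Sum>i\<in>UNIV. f i \<bullet> (Y c *v f i) / l i)" if c: "c = h \<or> c = - h" for c
  proof -
    have cS: "x + c *\<^sub>R \<xi> \<in> S" using x c by auto
    have pos: "0 < 1 + c * (q \<bullet> a)" using \<tau> c by auto
    have "det (Y c) = det (wm (x + c *\<^sub>R \<xi>)) * (1 + c * (q \<bullet> a))\<^sup>2"
      by (simp add: Y_def det_mul detE power2_eq_square)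
    then have "ln (det (Y c)) = ln (det (wm (x + c *\<^sub>R \<xi>))) + 2 * ln (1 + c * (q \<bullet> a))"
      using pos_def_det_pos[OF w_pos[OF cS]] pos by (simp add: ln_mult ln_realpow)
    moreover have "pos_def (Y c)"
      unfolding Y_def using pos by (intro pos_def_congruence w_pos cS) (simp add: detE)
    ultimately show ?thesis using ln_det_concave[OF w_pos[OF x(1)] _ f l, of "Y c"] by simp
  qed
  define \<Lambda> where "\<Lambda> = ln (det (wm (x + h *\<^sub>R \<xi>))) + ln (det (wm (x - h *\<^sub>R \<xi>))) - 2 * ln (det (wm x))
      + 2 * (ln (1 + h * (q \<bullet> a)) + ln (1 - h * (q \<bullet> a)))"
  have "2 * real CARD('n) + \<Lambda> \<le> (\<Sum>i\<in>UNIV. f i \<bullet> (Y h *v f i) / l i) + (\<Sum>i\<in>UNIV. f i \<bullet> (Y (- h) *v f i) / l i)"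
    using conc[of h] conc[of "- h"] by (simp add: \<Lambda>_def)
  moreover have "(\<Sum>i\<in>UNIV. f i \<bullet> (wm x *v f i) / l i) = CARD('n)"
    using l by (simp add: f less_imp_neq[symmetric])
  ultimately have "\<Lambda> \<le> (\<Sum>i\<in>UNIV. (f i \<bullet> (Y h *v f i) + f i \<bullet> (Y (- h) *v f i) - 2 * (f i \<bullet> (wm x *v f i))) / l i)"
    by (simp add: add_divide_distrib diff_divide_distrib sum.distrib sum_subtractf
        sum_distrib_left[symmetric] times_divide_eq_right[symmetric] del: times_divide_eq_right)
  then have "\<Lambda> / h\<^sup>2 \<le> (\<Sum>i\<in>UNIV. (f i \<bullet> (Y h *v f i) + f i \<bullet> (Y (- h) *v f i) - 2 * (f i \<bullet> (wm x *v f i))) / l i) / h\<^sup>2"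
    by (simp add: divide_right_mono)
  also have "\<dots> = (\<Sum>i\<in>UNIV. ((f i \<bullet> (Y h *v f i) + f i \<bullet> (Y (- h) *v f i) - 2 * (f i \<bullet> (wm x *v f i))) / h\<^sup>2) / l i)"
    by (simp add: sum_divide_distrib mult.commute)
  also have "\<dots> \<le> (\<Sum>i\<in>UNIV. ((Psi \<epsilon> (p (x + h *\<^sub>R \<xi>)) (f i + h *\<^sub>R z i) + Psi \<epsilon> (p (x - h *\<^sub>R \<xi>)) (f i - h *\<^sub>R z i)
          - 2 * Psi \<epsilon> (p x) (f i)) / h\<^sup>2 + K2 x \<xi> (f i) (z i) + pen2 (x - x0) (f i) + pen2 (\<xi> - \<xi>0) (z i)) / l i)"
  proof (intro sum_mono divide_right_mono less_imp_le[OF l])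
    fix i
    define \<rho> where "\<rho> = r / (norm (f i) + norm (z i) + 1)"
    have \<rho>: "\<rho> > 0" using r(1) by (simp add: \<rho>_def add_nonneg_pos)
    have "Qh h x \<xi> \<le> Qh h (x + t *\<^sub>R f i) (\<xi> + t *\<^sub>R z i)" if "\<bar>t\<bar> < \<rho>" for t
    proof (rule r(2))
      have "\<bar>t\<bar> * (norm (f i) + norm (z i)) \<le> \<bar>t\<bar> * (norm (f i) + norm (z i) + 1)" by (intro mult_left_mono) auto
      also have "\<dots> < r" using that by (simp add: \<rho>_def pos_less_divide_eq add_nonneg_pos)
      finally show "\<bar>t\<bar> * (norm (f i) + norm (z i)) < r" .
    qed
    \<comment> \<open>In the second-order condition along \<open>(f i, z i)\<close> the Hessian is
      split as \<open>cost_hess\<close> minus \<open>wm\<close>: the first part gives the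
      \<open>Psi\<close> terms, the second those of \<open>Y\<close>.\<close>
    from second_order_min[OF h x \<rho> this]
    show "(f i \<bullet> (Y h *v f i) + f i \<bullet> (Y (- h) *v f i) - 2 * (f i \<bullet> (wm x *v f i))) / h\<^sup>2
       \<le> (Psi \<epsilon> (p (x + h *\<^sub>R \<xi>)) (f i + h *\<^sub>R z i) + Psi \<epsilon> (p (x - h *\<^sub>R \<xi>)) (f i - h *\<^sub>R z i)
          - 2 * Psi \<epsilon> (p x) (f i)) / h\<^sup>2 + K2 x \<xi> (f i) (z i) + pen2 (x - x0) (f i) + pen2 (\<xi> - \<xi>0) (z i)"
      unfolding Yf wm_form cost_hess_Psi by (simp add: add_divide_distrib diff_divide_distrib)
  qed
  finally show ?thesis by (simp add: \<Lambda>_def add_divide_distrib diff_divide_distrib)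
qed

section \<open>Passage to the limit of vanishing step\<close>

lemma tendsto_Psi1:
  assumes "a \<longlonglongrightarrow> a0" "b \<longlonglongrightarrow> b0" "c \<longlonglongrightarrow> c0" "d \<longlonglongrightarrow> d0" "a0 \<bullet> a0 < 1"
  shows "(\<lambda>k. Psi1 \<epsilon> (a k) (b k) (c k) (d k)) \<longlonglongrightarrow> Psi1 \<epsilon> a0 b0 c0 d0"
  unfolding Psi1_def using eps assms(5) by (intro tendsto_intros assms) auto

lemma tendsto_Psi2:
  assumes "a \<longlonglongrightarrow> a0" "b \<longlonglongrightarrow> b0" "c \<longlonglongrightarrow> c0" "d \<longlonglongrightarrow> d0" "g \<longlonglongrightarrow> g0" "a0 \<bullet> a0 < 1"
  shows "(\<lambda>k. Psi2 \<epsilon> (a k) (b k) (c k) (d k) (g k)) \<longlonglongrightarrow> Psi2 \<epsilon> a0 b0 c0 d0 g0"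
  unfolding Psi2_def using eps assms(6) by (intro tendsto_intros assms) auto

lemmas isCont_tendsto = isCont_tendsto_compose[OF isCont_p] isCont_tendsto_compose[OF isCont_H]
  isCont_tendsto_compose[OF isCont_\<kappa>2]
  isCont_tendsto_compose[OF has_derivative_continuous[OF d\<kappa>]]
  isCont_tendsto_compose[OF has_derivative_continuous[OF d\<kappa>1]]

lemma Psi_second_difference:
  assumes x: "x \<in> S" and h: "\<And>k. 0 < h k" "h \<longlonglongrightarrow> 0" and y: "y \<longlonglongrightarrow> x" and v: "v \<longlonglongrightarrow> v0"
    and e: "e \<longlonglongrightarrow> e0" and z: "z \<longlonglongrightarrow> z0"
  shows "(\<lambda>k. (Psi \<epsilon> (p (y k + h k *\<^sub>R v k)) (e k + h k *\<^sub>R z k) + Psi \<epsilon> (p (y k - h k *\<^sub>R v k)) (e k - h k *\<^sub>R z k)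
      - 2 * Psi \<epsilon> (p (y k)) (e k)) / (h k)\<^sup>2) \<longlonglongrightarrow> Psi2 \<epsilon> (p x) (H x *v v0) (D3 x v0 *v v0) e0 z0"
proof -
  have "(\<lambda>k. ((\<lambda>w. Psi \<epsilon> (p (fst w)) (snd w)) ((y k, e k) + h k *\<^sub>R (v k, z k))
      + (\<lambda>w. Psi \<epsilon> (p (fst w)) (snd w)) ((y k, e k) - h k *\<^sub>R (v k, z k))
      - 2 * (\<lambda>w. Psi \<epsilon> (p (fst w)) (snd w)) (y k, e k)) / (h k)\<^sup>2)
     \<longlonglongrightarrow> (\<lambda>w \<zeta>. Psi2 \<epsilon> (p (fst w)) (H (fst w) *v fst \<zeta>) (D3 (fst w) (fst \<zeta>) *v fst \<zeta>) (snd w) (snd \<zeta>)) (x, e0) (v0, z0)"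
  proof (rule second_difference_along[where U = "S \<times> UNIV" and
      ?G1.0 = "\<lambda>w \<zeta>. Psi1 \<epsilon> (p (fst w)) (H (fst w) *v fst \<zeta>) (snd w) (snd \<zeta>)"])
    show "open (S \<times> (UNIV :: (real^'n) set))" using open_S by (simp add: open_Times)
    fix y \<eta> :: "nat \<Rightarrow> (real^'n) \<times> (real^'n)" assume y: "y \<longlonglongrightarrow> (x, e0)" and \<eta>: "\<eta> \<longlonglongrightarrow> (v0, z0)"
    note lims = tendsto_fst[OF y] tendsto_snd[OF y] tendsto_fst[OF \<eta>] tendsto_snd[OF \<eta>]
    note lims' = lims[simplified]
    show "(\<lambda>k. Psi2 \<epsilon> (p (fst (y k))) (H (fst (y k)) *v fst (\<eta> k)) (D3 (fst (y k)) (fst (\<eta> k)) *v fst (\<eta> k)) (snd (y k)) (snd (\<eta> k)))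
      \<longlonglongrightarrow> Psi2 \<epsilon> (p (fst (x, e0))) (H (fst (x, e0)) *v fst (v0, z0)) (D3 (fst (x, e0)) (fst (v0, z0)) *v fst (v0, z0)) (snd (x, e0)) (snd (v0, z0))"
      using x lims' p_less by (auto intro!: tendsto_Psi2 tendsto_matrix_vector_mult isCont_tendsto tendsto_D3)
  qed (use x h y v e z line_Psi line_Psi1 in \<open>auto intro!: tendsto_Pair\<close>)
  then show ?thesis by simp
qed

text \<open>Diagonalising frames are chosen pointwise, without any continuity, since eigenvalues may
  coincide. \<open>A\<close>-unit vectors stay bounded as long as
  \<open>sqrt (1 - p \<bullet> p)\<close> stays away from 0, and compactness then yields a
  subsequence along which frames and eigenvalues converge.\<close>

lemma frame_limit:
  assumes x: "x \<longlonglongrightarrow> x0"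
    and w_pos: "\<And>x. x \<in> S \<Longrightarrow> pos_def (wm x)"
  obtains f l f0 l0 and \<sigma> :: "nat \<Rightarrow> nat" where "strict_mono \<sigma>"
    "\<And>k i j. x k \<in> S \<Longrightarrow> f k i \<bullet> (wm (x k) *v f k j) = (if i = j then l k i else (0::real))"
    "\<And>k i. x k \<in> S \<Longrightarrow> 0 < l k i"
    "\<And>i :: 'n. (\<lambda>k. f (\<sigma> k) i) \<longlonglongrightarrow> f0 i" "\<And>i. (\<lambda>k. l (\<sigma> k) i) \<longlonglongrightarrow> l0 i"
    "\<And>i j. f0 i \<bullet> (cost_hess \<epsilon> (p x0) *v f0 j) = (if i = j then 1 else 0)"
    "\<And>i j. f0 i \<bullet> (wm x0 *v f0 j) = (if i = j then l0 i else 0)"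
    "\<And>i. 0 < l0 i"
proof -
  have "\<exists>f l. y \<in> S \<longrightarrow> (\<forall>i j :: 'n. f i \<bullet> (cost_hess \<epsilon> (p y) *v f j) = (if i = j then 1 else 0)) \<and>
      (\<forall>i j. f i \<bullet> (wm y *v f j) = (if i = j then l i else 0))" for y
    using simultaneous_diag[OF cost_hess_pos_def[OF eps p_less] pos_defD(1)[OF w_pos], of y y]
    by metis
  then obtain F L where FL: "\<And>y i j. y \<in> S \<Longrightarrow> F y i \<bullet> (cost_hess \<epsilon> (p y) *v F y j) = (if i = (j::'n) then 1 else 0)"
      "\<And>y i j. y \<in> S \<Longrightarrow> F y i \<bullet> (wm y *v F y j) = (if i = j then L y i else 0)" by metis
  have Lpos: "0 < L y i" if "y \<in> S" for y i
  proof -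
    have "F y i \<noteq> 0" using FL(1)[OF that, of i i] by auto
    then show ?thesis using pos_defD(2)[OF w_pos[OF that], of "F y i"] FL(2)[OF that, of i i] by simp
  qed
  define s where "s y = sqrt (1 - p y \<bullet> p y)" for y
  have s0: "s y > 0" if "y \<in> S" for y using p_less[OF that] by (simp add: s_def)
  have plim: "(\<lambda>k. p (x k)) \<longlonglongrightarrow> p x0" by (rule isCont_tendsto(1)[OF x0 x])
  have "(\<lambda>k. s (x k)) \<longlonglongrightarrow> s x0" unfolding s_def by (intro tendsto_intros plim)
  then have e1: "\<forall>\<^sub>F k in sequentially. s (x k) > s x0 / 2" using s0[OF x0] by (intro order_tendstoD(1)) auto
  have e2: "\<forall>\<^sub>F k in sequentially. x k \<in> S" using topological_tendstoD[OF x open_S x0] .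
  \<comment> \<open>From \<open>s ^ 3 / \<epsilon> * |f|\<^sup>2 \<le> A(f, f) = 1\<close>, once
    \<open>s\<close> along the sequence exceeds half its limit.\<close>
  define B where "B = sqrt (\<epsilon> / (s x0 / 2) ^ 3)"
  have "\<forall>\<^sub>F k in sequentially. \<forall>i. norm (F (x k) i) \<le> B"
    using e1 e2
  proof eventually_elim
    case (elim k)
    show ?case
    proof
      fix i
      let ?f = "F (x k) i"
      have "(s x0 / 2) ^ 3 * (?f \<bullet> ?f) \<le> s (x k) ^ 3 * (?f \<bullet> ?f)"
        using elim s0[OF x0] by (intro mult_right_mono power_mono) auto
      also have "\<dots> = s (x k) * ((1 - p (x k) \<bullet> p (x k)) * (?f \<bullet> ?f))"
        using p_less[OF elim(2)] by (simp add: s_def power3_eq_cube)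
      also have "\<dots> \<le> s (x k) * (?f \<bullet> ?f - (p (x k) \<bullet> ?f)\<^sup>2)"
        using s0[OF elim(2)] by (intro mult_left_mono metric_lower) auto
      also have "\<dots> = \<epsilon>"
        using FL(1)[OF elim(2), of i i] eps unfolding cost_hess_Psi by (simp add: Psi_def s_def field_simps)
      finally have "?f \<bullet> ?f \<le> \<epsilon> / (s x0 / 2) ^ 3" using s0[OF x0] by (simp add: field_simps)
      then show "norm ?f \<le> B" unfolding B_def norm_eq_sqrt_inner by (rule real_sqrt_le_mono)
    qed
  qed
  then obtain N where N: "\<And>k i. k \<ge> N \<Longrightarrow> norm (F (x k) i) \<le> B" unfolding eventually_sequentially by blast
  \<comment> \<open>Packing the frame into one matrix gives a single subsequence for all its
    vectors; the shift by \<open>N\<close> skips the indices where the norm bound is not yet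
    known.\<close>
  define M where "M k = (\<chi> i. F (x (k + N)) i)" for k
  have "norm (M k) \<le> (\<Sum>i\<in>(UNIV :: 'n set). B)" for k
  proof -
    have "norm (M k) \<le> (\<Sum>i\<in>UNIV. norm (M k $ i))" unfolding norm_vec_def[of "M k"] by (rule L2_set_le_sum) simp
    also have "\<dots> \<le> (\<Sum>i\<in>(UNIV :: 'n set). B)" by (intro sum_mono) (simp add: M_def N)
    finally show ?thesis .
  qed
  then have "bounded (range M)" by (auto simp: bounded_iff)
  then obtain m \<tau> where m: "strict_mono \<tau>" "(M \<circ> \<tau>) \<longlonglongrightarrow> m" using bounded_imp_convergent_subsequence by blast
  define \<sigma> where "\<sigma> k = \<tau> k + N" for k
  have \<sigma>: "strict_mono \<sigma>" using m(1) by (simp add: \<sigma>_def strict_mono_def)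
  have flim: "(\<lambda>k. F (x (\<sigma> k)) i) \<longlonglongrightarrow> m $ i" for i
    using tendsto_vec_nth[OF m(2), of i] by (simp add: M_def \<sigma>_def o_def)
  have xlim: "(\<lambda>k. x (\<sigma> k)) \<longlonglongrightarrow> x0" using LIMSEQ_subseq_LIMSEQ[OF x \<sigma>] by (simp add: o_def)
  have chlim: "(\<lambda>k. cost_hess \<epsilon> (p (x (\<sigma> k)))) \<longlonglongrightarrow> cost_hess \<epsilon> (p x0)"
    unfolding cost_hess_def outer_def
    by (intro tendsto_intros tendsto_vec_lambda isCont_tendsto x0 xlim) (use eps in auto)
  have wlim: "(\<lambda>k. wm (x (\<sigma> k))) \<longlonglongrightarrow> wm x0"
    unfolding wm_def by (intro tendsto_intros chlim isCont_tendsto x0 xlim)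
  have inS: "\<forall>\<^sub>F k in sequentially. x (\<sigma> k) \<in> S" using topological_tendstoD[OF xlim open_S x0] .
  have w0: "(\<lambda>k. F (x (\<sigma> k)) i \<bullet> (wm (x (\<sigma> k)) *v F (x (\<sigma> k)) j)) \<longlonglongrightarrow> m $ i \<bullet> (wm x0 *v m $ j)" for i j
    by (intro tendsto_intros tendsto_matrix_vector_mult wlim flim)
  have a0: "(\<lambda>k. F (x (\<sigma> k)) i \<bullet> (cost_hess \<epsilon> (p (x (\<sigma> k))) *v F (x (\<sigma> k)) j))
      \<longlonglongrightarrow> m $ i \<bullet> (cost_hess \<epsilon> (p x0) *v m $ j)" for i j
    by (intro tendsto_intros tendsto_matrix_vector_mult chlim flim)
  have A: "m $ i \<bullet> (cost_hess \<epsilon> (p x0) *v m $ j) = (if i = j then 1 else 0)" for i j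
    by (rule LIMSEQ_unique[OF a0], rule Lim_transform_eventually[OF tendsto_const])
       (use inS in eventually_elim, simp add: FL)
  have W: "m $ i \<bullet> (wm x0 *v m $ j) = 0" if "i \<noteq> j" for i j
    by (rule LIMSEQ_unique[OF w0], rule Lim_transform_eventually[OF tendsto_const])
       (use inS in eventually_elim, simp add: FL that)
  have Ll: "(\<lambda>k. L (x (\<sigma> k)) i) \<longlonglongrightarrow> m $ i \<bullet> (wm x0 *v m $ i)" for i
    by (rule Lim_transform_eventually[OF w0]) (use inS in eventually_elim, simp add: FL)
  have "m $ i \<noteq> 0" for i using A[of i i] by auto
  then have "0 < m $ i \<bullet> (wm x0 *v m $ i)" for i by (rule pos_defD(2)[OF w_pos[OF x0]])
  note pos = this
  show thesis
  proof (rule that[OF \<sigma>, of "\<lambda>k. F (x k)" "\<lambda>k. L (x k)" "\<lambda>i. m $ i" "\<lambda>i. m $ i \<bullet> (wm x0 *v m $ i)"])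
    show "m $ i \<bullet> (wm x0 *v m $ j) = (if i = j then m $ i \<bullet> (wm x0 *v m $ i) else 0)" for i j
      using W by simp
  qed (fact FL(2) Lpos flim Ll A pos)+
qed

text \<open>The second difference of \<open>ln det w\<close> may have no limit, since
  \<open>ln f\<close> and \<open>ln g\<close> have only Lipschitz gradients. Therefore
  \<open>m\<close> is the limit of lower bounds \<open>b\<close>, which suffices because this
  difference enters with a negative sign.\<close>

lemma limit_inequality:
  assumes w_pos: "\<And>x. x \<in> S \<Longrightarrow> pos_def (wm x)"
    and m: "\<And>h x \<xi>. (\<And>k. 0 < h k) \<Longrightarrow> h \<longlonglongrightarrow> 0 \<Longrightarrow> x \<longlonglongrightarrow> x0 \<Longrightarrow> \<xi> \<longlonglongrightarrow> \<xi>0 \<Longrightarrow>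
       \<exists>b. b \<longlonglongrightarrow> m \<and> (\<forall>\<^sub>F k in sequentially. b k \<le>
         (ln (det (wm (x k + h k *\<^sub>R \<xi> k))) + ln (det (wm (x k - h k *\<^sub>R \<xi> k))) - 2 * ln (det (wm (x k)))) / (h k)\<^sup>2)"
  obtains f :: "'n \<Rightarrow> real^'n" and l where
    "\<And>i j. f i \<bullet> (cost_hess \<epsilon> (p x0) *v f j) = (if i = j then 1 else 0)"
    "\<And>i j. f i \<bullet> (wm x0 *v f j) = (if i = j then l i else 0)" "\<And>i. 0 < l i"
    "0 \<le> (\<Sum>i\<in>UNIV. (Psi2 \<epsilon> (p x0) (H x0 *v \<xi>0) (D3 x0 \<xi>0 *v \<xi>0) (f i) ((a \<bullet> f i) *\<^sub>R q)
        + K2 x0 \<xi>0 (f i) ((a \<bullet> f i) *\<^sub>R q)) / l i) - m + 2 * (q \<bullet> a)\<^sup>2"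
proof -
  obtain h' x' \<xi>' r where seq': "\<And>k. 0 < h' k" "h' \<longlonglongrightarrow> 0" "x' \<longlonglongrightarrow> x0" "\<xi>' \<longlonglongrightarrow> \<xi>0" "0 < (r::real)"
    "\<And>k y \<eta>. dist x0 y \<le> r \<Longrightarrow> dist \<xi>0 \<eta> \<le> r \<Longrightarrow> Qh (h' k) (x' k) (\<xi>' k) \<le> Qh (h' k) y \<eta>"
    using penalised_minimisers by blast
  obtain f' l' f0 l0 \<sigma> where fr: "strict_mono (\<sigma> :: nat \<Rightarrow> nat)"
    "\<And>k i j. x' k \<in> S \<Longrightarrow> f' k i \<bullet> (wm (x' k) *v f' k j) = (if i = j then l' k i else (0::real))"
    "\<And>k i. x' k \<in> S \<Longrightarrow> 0 < l' k i"
    "\<And>i :: 'n. (\<lambda>k. f' (\<sigma> k) i) \<longlonglongrightarrow> f0 i" "\<And>i. (\<lambda>k. l' (\<sigma> k) i) \<longlonglongrightarrow> l0 i"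
    "\<And>i j. f0 i \<bullet> (cost_hess \<epsilon> (p x0) *v f0 j) = (if i = j then 1 else 0)"
    "\<And>i j. f0 i \<bullet> (wm x0 *v f0 j) = (if i = j then l0 i else 0)"
    "\<And>i. 0 < l0 i"
    by (rule frame_limit[OF seq'(3) w_pos], assumption) (rule that; assumption)
  define h where "h = h' \<circ> \<sigma>"
  define x where "x = x' \<circ> \<sigma>"
  define \<xi> where "\<xi> = \<xi>' \<circ> \<sigma>"
  define f where "f k = f' (\<sigma> k)" for k
  define l where "l k = l' (\<sigma> k)" for k
  have lims: "h \<longlonglongrightarrow> 0" "x \<longlonglongrightarrow> x0" "\<xi> \<longlonglongrightarrow> \<xi>0"
    using LIMSEQ_subseq_LIMSEQ[OF _ fr(1)] seq'(2-4) by (auto simp: h_def x_def \<xi>_def)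
  have hpos: "0 < h k" for k using seq'(1) by (simp add: h_def)
  have flim: "(\<lambda>k. f k i) \<longlonglongrightarrow> f0 i" "(\<lambda>k. l k i) \<longlonglongrightarrow> l0 i" for i using fr(4,5) by (auto simp: f_def l_def)
  have qmin: "Qh (h k) (x k) (\<xi> k) \<le> Qh (h k) y \<eta>" if "dist x0 y \<le> r" "dist \<xi>0 \<eta> \<le> r" for k y \<eta>
    using seq'(6)[OF that] by (simp add: h_def x_def \<xi>_def)
  obtain b where b: "b \<longlonglongrightarrow> m" "\<forall>\<^sub>F k in sequentially. b k \<le>
         (ln (det (wm (x k + h k *\<^sub>R \<xi> k))) + ln (det (wm (x k - h k *\<^sub>R \<xi> k))) - 2 * ln (det (wm (x k)))) / (h k)\<^sup>2"
    using m[OF hpos lims] by blast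
  define z where "z k i = (a \<bullet> f k i) *\<^sub>R q" for k i
  have zlim: "(\<lambda>k. z k i) \<longlonglongrightarrow> (a \<bullet> f0 i) *\<^sub>R q" for i unfolding z_def by (intro tendsto_intros flim)
  define R where "R k = (\<Sum>i\<in>UNIV. ((Psi \<epsilon> (p (x k + h k *\<^sub>R \<xi> k)) (f k i + h k *\<^sub>R z k i)
          + Psi \<epsilon> (p (x k - h k *\<^sub>R \<xi> k)) (f k i - h k *\<^sub>R z k i)
          - 2 * Psi \<epsilon> (p (x k)) (f k i)) / (h k)\<^sup>2 + K2 (x k) (\<xi> k) (f k i) (z k i)
          + pen2 (x k - x0) (f k i) + pen2 (\<xi> k - \<xi>0) (z k i)) / l k i)
      - b k - 2 * ((ln (1 + h k * (q \<bullet> a)) + ln (1 - h k * (q \<bullet> a))) / (h k)\<^sup>2)" for k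
  have pen0: "(\<lambda>k. pen2 (y k - y0) (v k)) \<longlonglongrightarrow> 0" if "y \<longlonglongrightarrow> y0" "v \<longlonglongrightarrow> v0" for y v :: "nat \<Rightarrow> real^'n" and y0 v0
  proof -
    have "(\<lambda>k. pen2 (y k - y0) (v k)) \<longlonglongrightarrow> pen2 (y0 - y0) v0"
      unfolding pen2_def by (intro tendsto_intros that)
    then show ?thesis by (simp add: pen2_def)
  qed
  have K2lim: "(\<lambda>k. K2 (x k) (\<xi> k) (f k i) (z k i)) \<longlonglongrightarrow> K2 x0 \<xi>0 (f0 i) ((a \<bullet> f0 i) *\<^sub>R q)" for i
    unfolding K2_def
    by (intro tendsto_intros tendsto_matrix_vector_mult tendsto_Psi tendsto_Psi1 tendsto_Psi2 tendsto_D3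
        isCont_tendsto x0 lims flim zlim p_less)
  have "R \<longlonglongrightarrow> (\<Sum>i\<in>UNIV. (Psi2 \<epsilon> (p x0) (H x0 *v \<xi>0) (D3 x0 \<xi>0 *v \<xi>0) (f0 i) ((a \<bullet> f0 i) *\<^sub>R q)
        + K2 x0 \<xi>0 (f0 i) ((a \<bullet> f0 i) *\<^sub>R q) + 0 + 0) / l0 i) - m - 2 * (- (q \<bullet> a)\<^sup>2)"
    unfolding R_def
    by (intro tendsto_diff tendsto_sum tendsto_divide tendsto_add tendsto_mult tendsto_const Psi_second_difference K2lim
        pen0[OF lims(2) flim(1)] pen0[OF lims(3) zlim] ln_second_difference hpos lims flim zlim x0 b(1))
       (use fr(8) in \<open>auto simp: less_imp_neq[symmetric]\<close>)
  moreover have "\<forall>\<^sub>F k in sequentially. 0 \<le> R k"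
  proof -
    have l1: "(\<lambda>k. x k + h k *\<^sub>R \<xi> k) \<longlonglongrightarrow> x0 + 0 *\<^sub>R \<xi>0" "(\<lambda>k. x k - h k *\<^sub>R \<xi> k) \<longlonglongrightarrow> x0 - 0 *\<^sub>R \<xi>0"
      by (intro tendsto_intros lims)+
    have l2: "(\<lambda>k. \<bar>h k * (q \<bullet> a)\<bar>) \<longlonglongrightarrow> \<bar>0 * (q \<bullet> a)\<bar>" by (intro tendsto_intros lims)
    have "\<forall>\<^sub>F k in sequentially. x k \<in> S" "\<forall>\<^sub>F k in sequentially. x k + h k *\<^sub>R \<xi> k \<in> S"
      "\<forall>\<^sub>F k in sequentially. x k - h k *\<^sub>R \<xi> k \<in> S"
      using l1 x0 by (auto intro!: topological_tendstoD[OF _ open_S] lims)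
    moreover have "\<forall>\<^sub>F k in sequentially. \<bar>h k * (q \<bullet> a)\<bar> < 1" using l2 by (intro order_tendstoD(2)) auto
    moreover have "\<forall>\<^sub>F k in sequentially. dist (x k) x0 < r / 2" "\<forall>\<^sub>F k in sequentially. dist (\<xi> k) \<xi>0 < r / 2"
      using tendstoD[OF lims(2), of "r / 2"] tendstoD[OF lims(3), of "r / 2"] seq'(5) by simp_all
    ultimately show ?thesis using b(2)
    proof eventually_elim
      case (elim k)
      have min: "Qh (h k) (x k) (\<xi> k) \<le> Qh (h k) (x k + t *\<^sub>R e) (\<xi> k + t *\<^sub>R v)"
        if "\<bar>t\<bar> * (norm e + norm v) < r / 2" for e v t
      proof (rule qmin)
        have "\<bar>t\<bar> * norm e \<le> \<bar>t\<bar> * (norm e + norm v)" "\<bar>t\<bar> * norm v \<le> \<bar>t\<bar> * (norm e + norm v)"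
          by (auto intro!: mult_left_mono)
        then have te: "norm (t *\<^sub>R e) < r / 2" "norm (t *\<^sub>R v) < r / 2" using that by auto
        show "dist x0 (x k + t *\<^sub>R e) \<le> r"
          using norm_triangle_ineq[of "x k - x0" "t *\<^sub>R e"] te elim
          by (simp add: dist_norm norm_minus_commute[of x0] algebra_simps)
        show "dist \<xi>0 (\<xi> k + t *\<^sub>R v) \<le> r"
          using norm_triangle_ineq[of "\<xi> k - \<xi>0" "t *\<^sub>R v"] te elim
          by (simp add: dist_norm norm_minus_commute[of \<xi>0] algebra_simps)
      qed
      have xk: "x' (\<sigma> k) \<in> S" using elim by (simp add: x_def)
      have fk: "f k i \<bullet> (wm (x k) *v f k j) = (if i = j then l k i else 0)" and lk: "0 < l k i" for i j
        using fr(2,3)[OF xk] by (simp_all add: x_def f_def l_def)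
      have r2: "0 < r / 2" using seq'(5) by simp
      from frame_inequality[OF w_pos hpos elim(1-3) r2 min fk lk elim(4) z_def] elim
      show ?case unfolding R_def by linarith
    qed
  qed
  ultimately have "0 \<le> (\<Sum>i\<in>UNIV. (Psi2 \<epsilon> (p x0) (H x0 *v \<xi>0) (D3 x0 \<xi>0 *v \<xi>0) (f0 i) ((a \<bullet> f0 i) *\<^sub>R q)
        + K2 x0 \<xi>0 (f0 i) ((a \<bullet> f0 i) *\<^sub>R q) + 0 + 0) / l0 i) - m - 2 * (- (q \<bullet> a)\<^sup>2)"
    by (intro tendsto_lowerbound[of R _ sequentially]) auto
  then show thesis using that[OF fr(6-8)] by simp
qed

end

section \<open>The curvature identity\<close>

text \<open>For \<open>e' = c q\<close> the quadratic part
  \<open>e \<bullet> e - (p \<bullet> e)\<^sup>2\<close> is stationary to first order: parallel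
  transport preserves the metric. The first derivative of \<open>Psi\<close> then stems from the
  factor \<open>sqrt (1 - p \<bullet> p) / \<epsilon>\<close> alone.\<close>

lemma Psi2_parallel:
  fixes p \<pi> k e :: "real^'n"
  assumes eps: "0 < \<epsilon>" and p: "p \<bullet> p < 1" and e: "Psi \<epsilon> p e = 1"
    and q: "q = (1 / (1 - p \<bullet> p)) *\<^sub>R p" and s: "s = sqrt (1 - p \<bullet> p)"
    and c: "c = \<pi> \<bullet> e"
  shows "Psi2 \<epsilon> p \<pi> k e (c *\<^sub>R q) = - (\<pi> \<bullet> \<pi> / s\<^sup>2 + (q \<bullet> \<pi>)\<^sup>2 + q \<bullet> k)
      - 4 * (q \<bullet> \<pi>) * c * (s / \<epsilon> * (p \<bullet> e)) - 2 * (1 / (\<epsilon> * s)) * c\<^sup>2 - 2 * (k \<bullet> e) * (s / \<epsilon> * (p \<bullet> e))"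
    and "Psi1 \<epsilon> p \<pi> e (c *\<^sub>R q) = - (q \<bullet> \<pi>)"
proof -
  have s0: "s > 0" "s\<^sup>2 = 1 - p \<bullet> p" using p by (auto simp: s)
  have m: "e \<bullet> e - (p \<bullet> e)\<^sup>2 = \<epsilon> / s" using e s0 eps by (simp add: Psi_def s[symmetric] field_simps)
  have pp: "p \<bullet> p = 1 - s\<^sup>2" using s0 by simp
  have q': "q = (1 / s\<^sup>2) *\<^sub>R p" by (simp add: q s0)
  have ez: "e \<bullet> (c *\<^sub>R q) = c * (p \<bullet> e) / s\<^sup>2" and pz: "p \<bullet> (c *\<^sub>R q) = c * (1 - s\<^sup>2) / s\<^sup>2"
    and zz: "(c *\<^sub>R q) \<bullet> (c *\<^sub>R q) = c\<^sup>2 * (1 - s\<^sup>2) / (s\<^sup>2)\<^sup>2" and \<pi>z: "\<pi> \<bullet> (c *\<^sub>R q) = c * (p \<bullet> \<pi>) / s\<^sup>2"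
    and qp: "q \<bullet> \<pi> = p \<bullet> \<pi> / s\<^sup>2" "q \<bullet> k = p \<bullet> k / s\<^sup>2"
    by (simp_all add: q' pp inner_commute power2_eq_square)
  have m1: "2 * (c * (p \<bullet> e) / s\<^sup>2) - 2 * (p \<bullet> e) * (c / s\<^sup>2) = 0"
    by simp
  have cz: "c + p \<bullet> (c *\<^sub>R q) = c / s\<^sup>2" unfolding pz using s0(1) by (simp add: field_simps)
  show "Psi1 \<epsilon> p \<pi> e (c *\<^sub>R q) = - (q \<bullet> \<pi>)"
    unfolding Psi1_def m s[symmetric] c[symmetric] cz ez m1 qp(1)
    using s0(1) eps by (simp add: field_simps power2_eq_square)
  show "Psi2 \<epsilon> p \<pi> k e (c *\<^sub>R q) = - (\<pi> \<bullet> \<pi> / s\<^sup>2 + (q \<bullet> \<pi>)\<^sup>2 + q \<bullet> k)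
      - 4 * (q \<bullet> \<pi>) * c * (s / \<epsilon> * (p \<bullet> e)) - 2 * (1 / (\<epsilon> * s)) * c\<^sup>2 - 2 * (k \<bullet> e) * (s / \<epsilon> * (p \<bullet> e))"
    unfolding Psi2_def m s[symmetric] c[symmetric] cz ez m1 zz \<pi>z qp using s0(1) eps
    by (simp add: field_simps power2_eq_square power3_eq_cube)
qed

text \<open>With \<open>e\<close> held fixed the metric varies as well, which accounts for the
  second summand. The first-order conditions deliver their derivatives in this form.\<close>

lemma Psi1_zero:
  fixes p \<pi> e :: "real^'n"
  assumes eps: "0 < \<epsilon>" and p: "p \<bullet> p < 1" and e: "Psi \<epsilon> p e = 1"
    and q: "q = (1 / (1 - p \<bullet> p)) *\<^sub>R p" and s: "s = sqrt (1 - p \<bullet> p)"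
  shows "Psi1 \<epsilon> p \<pi> e 0 = - (q \<bullet> \<pi>) - 2 * (\<pi> \<bullet> e) * (s / \<epsilon> * (p \<bullet> e))"
proof -
  have s0: "s > 0" "s\<^sup>2 = 1 - p \<bullet> p" using p by (auto simp: s)
  have m: "e \<bullet> e - (p \<bullet> e)\<^sup>2 = \<epsilon> / s" using e s0 eps by (simp add: Psi_def s[symmetric] field_simps)
  have qp: "q \<bullet> \<pi> = p \<bullet> \<pi> / s\<^sup>2" by (simp add: q s0)
  show ?thesis unfolding Psi1_def m s[symmetric] qp using s0(1) eps by (simp add: field_simps power2_eq_square)
qed

section \<open>Frames at the maximum point\<close>

locale frame =
  fixes \<epsilon> :: real and p :: "real^'n" and f :: "'n \<Rightarrow> real^'n"
  assumes eps: "0 < \<epsilon>" and p_less: "p \<bullet> p < 1"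
    and orth: "f i \<bullet> (cost_hess \<epsilon> p *v f j) = (if i = j then 1 else 0)"
begin

abbreviation "A \<equiv> cost_hess \<epsilon> p"
definition s where "s = sqrt (1 - p \<bullet> p)"
text \<open>The gradient \<open>p\<close> with its index raised by the metric
  \<open>I - p p\<^sup>T\<close>; \<open>Q i\<close> is its component \<open>A(q, f i)\<close> in
  the frame.\<close>

definition q where "q = (1 / (1 - p \<bullet> p)) *\<^sub>R p"
definition Q where "Q i = s / \<epsilon> * (p \<bullet> f i)"

lemma s_pos: "s > 0" and s_sq: "s\<^sup>2 = 1 - p \<bullet> p"
  using p_less by (auto simp: s_def)

lemma A_mult: "A *v v = (s / \<epsilon>) *\<^sub>R (v - (p \<bullet> v) *\<^sub>R p)"
  by (simp add: cost_hess_def s_def scaleR_matrix_vector_assoc[symmetric] matrix_vector_mult_diff_rdistrib outer_mult_vec)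

lemma A_q: "A *v q = (s / \<epsilon>) *\<^sub>R p"
proof -
  have "q - (p \<bullet> q) *\<^sub>R p = (1 / s\<^sup>2 - (p \<bullet> p) / s\<^sup>2) *\<^sub>R p"
    by (simp add: q_def s_sq scaleR_diff_left)
  also have "1 / s\<^sup>2 - (p \<bullet> p) / s\<^sup>2 = 1" using p_less s_sq by (simp add: diff_divide_distrib[symmetric])
  finally show ?thesis by (simp add: A_mult)
qed

lemma A_q_inner: "(A *v q) \<bullet> f i = Q i" "(A *v q) \<bullet> v = s / \<epsilon> * (p \<bullet> v)"
  by (simp_all add: A_q Q_def)

lemma A_sym: "(A *v v) \<bullet> w = v \<bullet> (A *v w)"
  using symmetric_matrix_inner[OF cost_hess_sym] by (metis inner_commute)

lemma dual_inner: "v \<bullet> y = (\<Sum>i\<in>UNIV. (v \<bullet> f i) * ((A *v y) \<bullet> f i))"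
proof -
  have "v \<bullet> y = (\<Sum>i\<in>UNIV. (v \<bullet> f i) *\<^sub>R (A *v f i)) \<bullet> y"
    using orthonormal_dual_expansion[OF orth, of v] by metis
  also have "\<dots> = (\<Sum>i\<in>UNIV. (v \<bullet> f i) * ((A *v y) \<bullet> f i))"
  proof -
    have "(A *v f i) \<bullet> y = (A *v y) \<bullet> f i" for i by (metis A_sym inner_commute)
    then show ?thesis by (simp add: inner_sum_left)
  qed
  finally show ?thesis .
qed

lemma q_inner: "q \<bullet> v = (\<Sum>i\<in>UNIV. (v \<bullet> f i) * Q i)"
  using dual_inner[of v q] unfolding A_q_inner(1) by (simp add: inner_commute[of q])

text \<open>Both sides are \<open>1 / s\<^sup>2\<close> times the square of the covector
  \<open>v\<close> in the inverse of the metric \<open>I - p p\<^sup>T\<close>, computed directly on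
  the left and in the frame on the right. This is where the factor
  \<open>1 / (\<epsilon> * s)\<close> originates.\<close>

lemma dual_norm: "v \<bullet> v / s\<^sup>2 + (q \<bullet> v)\<^sup>2 = 1 / (\<epsilon> * s) * (\<Sum>i\<in>UNIV. (v \<bullet> f i)\<^sup>2)"
proof -
  define y where "y = (\<Sum>i\<in>UNIV. (v \<bullet> f i) *\<^sub>R f i)"
  have Ay: "A *v y = v"
    unfolding y_def using orthonormal_dual_expansion[OF orth, of v]
    by (simp add: linear_sum[OF matrix_vector_mul_linear] matrix_vector_mult_scaleR)
  have vy: "v \<bullet> y = (\<Sum>i\<in>UNIV. (v \<bullet> f i)\<^sup>2)"
    using dual_inner[of v y] by (simp add: Ay power2_eq_square)
  have qv: "q \<bullet> v = s / \<epsilon> * (p \<bullet> y)" using A_q_inner(2)[of y] by (simp add: A_sym Ay)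
  have pv: "p \<bullet> v = s\<^sup>2 * (q \<bullet> v)" using s_pos by (simp add: q_def s_sq[symmetric])
  have "v \<bullet> v = v \<bullet> (A *v y)" by (simp add: Ay)
  also have "\<dots> = s / \<epsilon> * (v \<bullet> y - (p \<bullet> y) * (p \<bullet> v))"
    by (simp add: A_mult inner_diff_right inner_commute)
  also have "\<dots> = s / \<epsilon> * (v \<bullet> y) - s\<^sup>2 * (q \<bullet> v)\<^sup>2"
    using eps unfolding pv qv by (simp add: field_simps power2_eq_square)
  finally have "v \<bullet> v / s\<^sup>2 + (q \<bullet> v)\<^sup>2 = s / \<epsilon> * (v \<bullet> y) / s\<^sup>2"
    using s_pos by (simp add: diff_divide_distrib)
  then show ?thesis unfolding vy using s_pos eps by (simp add: power2_eq_square)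
qed

lemma Psi_frame: "Psi \<epsilon> p (f i) = 1"
  using orth[of i i] by (simp add: cost_hess_Psi)

end

text \<open>\<open>H\<xi>\<close> is the first-order condition in the vector variable: \<xi> is an
  eigenvector of \<open>w\<close> relative to \<open>A\<close> with eigenvalue
  \<open>\<kappa> + 1\<close>. It need not be one of the frame vectors, since the frame arises as a
  limit.\<close>

locale eigenframe = frame \<epsilon> p f for \<epsilon> :: real and p :: "real^'n" and f +
  fixes H :: "real^'n^'n" and l :: "'n \<Rightarrow> real" and \<xi> :: "real^'n" and \<kappa> :: real
  assumes H_sym: "transpose H = H"
    and wdiag: "f i \<bullet> ((cost_hess \<epsilon> p - H) *v f j) = (if i = j then l i else 0)"
    and l_pos: "0 < l i"
    and H\<xi>: "H *v \<xi> = (- \<kappa>) *\<^sub>R (cost_hess \<epsilon> p *v \<xi>)"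
    and Psi_\<xi>: "Psi \<epsilon> p \<xi> = 1"
begin

definition X where "X i = (A *v \<xi>) \<bullet> f i"
definition a where "a = H *v \<xi>"

lemma H_f: "H *v f i = (1 - l i) *\<^sub>R (A *v f i)"
proof -
  have "(H *v f i) \<bullet> f j = (if i = j then 1 - l i else 0)" for j
    using wdiag[of j i] orth[of j i]
    by (auto simp: matrix_vector_mult_diff_rdistrib inner_diff_right inner_commute)
  then have "H *v f i = (\<Sum>j\<in>UNIV. (if i = j then 1 - l i else 0) *\<^sub>R (A *v f j))"
    by (subst orthonormal_dual_expansion[OF orth, of "H *v f i"]) simp
  also have "\<dots> = (\<Sum>j\<in>UNIV. if i = j then (1 - l i) *\<^sub>R (A *v f j) else 0)" by (intro sum.cong) auto
  finally show ?thesis by simp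
qed

lemma H_inner: "(H *v v) \<bullet> w = v \<bullet> (H *v w)"
  using symmetric_matrix_inner[OF H_sym] by (metis inner_commute)

text \<open>The pairing of \<open>H *v f i\<close> with \<xi> is evaluated twice, through the
  eigenvector equation of \<xi> and through that of \<open>f i\<close>; comparison gives
  \<open>X_eigen\<close>.\<close>

lemma a_f: "a \<bullet> f i = - \<kappa> * X i" and Hf_\<xi>: "(H *v f i) \<bullet> \<xi> = - \<kappa> * X i"
  and X_eigen: "(l i - (\<kappa> + 1)) * X i = 0"
proof -
  show 1: "a \<bullet> f i = - \<kappa> * X i" by (simp add: a_def H\<xi> X_def)
  show 2: "(H *v f i) \<bullet> \<xi> = - \<kappa> * X i"
    by (metis 1 H_inner a_def inner_commute)
  have "(A *v f i) \<bullet> \<xi> = X i" by (metis X_def A_sym inner_commute)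
  then have "(H *v f i) \<bullet> \<xi> = (1 - l i) * X i" by (simp add: H_f)
  with 2 show "(l i - (\<kappa> + 1)) * X i = 0" by (simp add: algebra_simps)
qed

lemma X_norm: "(\<Sum>i\<in>UNIV. (X i)\<^sup>2) = 1"
proof -
  have "1 = (A *v \<xi>) \<bullet> \<xi>" using Psi_\<xi> by (simp add: cost_hess_Psi[symmetric] inner_commute)
  also have "\<dots> = (\<Sum>i\<in>UNIV. (X i)\<^sup>2)" by (subst dual_inner) (simp add: X_def power2_eq_square)
  finally show ?thesis by simp
qed

lemma lambda_pos: "0 < \<kappa> + 1"
proof -
  have "\<exists>i. X i \<noteq> 0"
  proof (rule ccontr)
    assume "\<nexists>i. X i \<noteq> 0"
    then show False using X_norm by simp
  qed
  then obtain i where "X i \<noteq> 0" by blast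
  then have "l i = \<kappa> + 1" using X_eigen[of i] by simp
  then show ?thesis using l_pos[of i] by simp
qed

text \<open>In any term with a factor \<open>X i\<close> the weight \<open>1 / l i\<close> may be
  replaced by a constant, because \<xi> has components only along frame vectors with its own
  eigenvalue.\<close>

lemma X_div: "X i / l i = X i / (\<kappa> + 1)"
  using X_eigen[of i] l_pos[of i] lambda_pos by (cases "X i = 0") auto

lemma a_sum: "(\<Sum>i\<in>UNIV. (a \<bullet> f i)\<^sup>2) = \<kappa>\<^sup>2"
  using X_norm by (simp add: a_f power_mult_distrib sum_distrib_left[symmetric])

text \<open>Here \<open>k\<close> stands for \<open>D\<^sup>3u(\<xi>,\<xi>)\<close> and \<open>d i\<close> for \<open>D\<^sup>3u(f i, f i)\<close>: the first is eliminated by the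
  first-order condition at the maximum, the second by the differentiated equation. The first summand on the
  right comes from the Gauss equation, and the term with \<open>(q \<bullet> a)\<^sup>2\<close> is there because \<open>w\<close> is \<open>1 / L\<close>
  times a Codazzi tensor.\<close>

lemma curvature_identity:
  fixes c k \<phi> :: "real^'n" and d :: "'n \<Rightarrow> real^'n" and g :: "'n \<Rightarrow> real"
  assumes k: "\<And>v. k \<bullet> v = - (c \<bullet> v) - \<kappa> * Psi1 \<epsilon> p (H *v v) \<xi> 0"
    and d: "\<And>v. (\<Sum>i\<in>UNIV. (d i \<bullet> v) / l i) = (\<Sum>i\<in>UNIV. Psi1 \<epsilon> p (H *v v) (f i) 0 / l i)
        - (\<phi> \<bullet> v - (CARD('n) + 2) * (p \<bullet> (H *v v)) / (1 - p \<bullet> p))"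
  shows "(\<Sum>i\<in>UNIV. (Psi2 \<epsilon> p a k (f i) ((a \<bullet> f i) *\<^sub>R q)
       + (g i + 2 * (c \<bullet> f i) * Psi1 \<epsilon> p (H *v f i) \<xi> ((a \<bullet> f i) *\<^sub>R q)
          + \<kappa> * Psi2 \<epsilon> p (H *v f i) (d i) \<xi> ((a \<bullet> f i) *\<^sub>R q))) / l i)
     + 2 * (q \<bullet> a)\<^sup>2 - (CARD('n) + 2) * (- (a \<bullet> a + p \<bullet> k) / s\<^sup>2 - 2 * (q \<bullet> a)\<^sup>2)
   = - (1 / (\<epsilon> * s)) * \<kappa> * ((\<kappa> + 1) * (\<Sum>i\<in>UNIV. 1 / l i) - CARD('n) * (\<kappa> + 1) - CARD('n) + (\<Sum>i\<in>UNIV. l i))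
     + CARD('n) * (q \<bullet> a)\<^sup>2 + (\<Sum>i\<in>UNIV. g i / l i) + ((\<Sum>i\<in>UNIV. 1 / l i) - CARD('n)) * (q \<bullet> c)
     + \<kappa> * (q \<bullet> \<phi>) - 2 * (q \<bullet> a) * (\<xi> \<bullet> \<phi>)"
proof -
  define n where "n = real CARD('n)"
  define \<mu> where "\<mu> = 1 / (\<epsilon> * s)"
  define \<Lambda> where "\<Lambda> = \<kappa> + 1"
  define b where "b i = a \<bullet> f i" for i
  define t where "t = q \<bullet> a"
  define R where "R = (\<Sum>i\<in>UNIV. 1 / l i)"
  define x where "x = s / \<epsilon> * (p \<bullet> \<xi>)"
  have \<Lambda>: "\<Lambda> > 0" using lambda_pos by (simp add: \<Lambda>_def)
  have lnz: "l i \<noteq> 0" for i using l_pos[of i] by simp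
  have b_div: "b i / l i = b i / \<Lambda>" for i
    using X_div[of i] by (simp add: b_def a_f \<Lambda>_def times_divide_eq_right[symmetric] del: times_divide_eq_right)
  have Hf_b: "(H *v f i) \<bullet> \<xi> = b i" for i by (simp add: b_def a_f Hf_\<xi>)
  \<comment> \<open>The eigenvector equation of \<xi> paired with \<open>q\<close>; it turns every
    product \<open>\<kappa> * x\<close> below into \<open>t\<close>.\<close>
  have \<kappa>x: "\<kappa> * x = - t"
  proof -
    have "x = (A *v q) \<bullet> \<xi>" by (simp add: x_def A_q_inner)
    then have "\<kappa> * x = - (q \<bullet> ((- \<kappa>) *\<^sub>R (A *v \<xi>)))" by (simp add: A_sym)
    then show ?thesis by (simp add: t_def a_def H\<xi>)
  qed
  have qHf: "q \<bullet> (H *v f i) = (1 - l i) * Q i" for i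
    by (simp add: H_f A_sym[symmetric] A_q_inner Q_def)
  have norm_a: "a \<bullet> a / s\<^sup>2 + t\<^sup>2 = \<mu> * \<kappa>\<^sup>2"
    using dual_norm[of a] a_sum by (simp add: t_def \<mu>_def)
  have norm_Hf: "(H *v f i) \<bullet> (H *v f i) / s\<^sup>2 + (q \<bullet> (H *v f i))\<^sup>2 = \<mu> * (1 - l i)\<^sup>2" for i
  proof -
    have "((H *v f i) \<bullet> f j)\<^sup>2 = (if j = i then (1 - l i)\<^sup>2 else 0)" for j
      using orth[of j i] by (simp add: H_f inner_commute)
    then show ?thesis unfolding dual_norm \<mu>_def by simp
  qed
  have kf: "k \<bullet> f i = - (c \<bullet> f i) + \<kappa> * ((1 - l i) * Q i) - 2 * t * b i" for i
  proof -
    have "k \<bullet> f i = - (c \<bullet> f i) - \<kappa> * (- (q \<bullet> (H *v f i)) - 2 * ((H *v f i) \<bullet> \<xi>) * x)"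
      unfolding k Psi1_zero[OF eps p_less Psi_\<xi> q_def s_def] x_def ..
    also have "\<dots> = - (c \<bullet> f i) + \<kappa> * ((1 - l i) * Q i) + 2 * (\<kappa> * x) * b i"
      by (simp add: qHf Hf_b algebra_simps)
    finally show ?thesis by (simp add: \<kappa>x)
  qed
  \<comment> \<open>The sums \<open>S0\<close>, \<open>S1\<close>, \<open>Sl\<close>,
    \<open>C1\<close> and all multiples of \<open>t\<^sup>2 / \<Lambda>\<close> cancel in the end.
    With names for them the cancellation is a matter of comparing coefficients.\<close>
  define S0 where "S0 = (\<Sum>i\<in>UNIV. (Q i)\<^sup>2)"
  define S1 where "S1 = (\<Sum>i\<in>UNIV. (Q i)\<^sup>2 / l i)"
  define Sl where "Sl = (\<Sum>i\<in>UNIV. l i * (Q i)\<^sup>2)"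
  define C1 where "C1 = (\<Sum>i\<in>UNIV. (c \<bullet> f i) * Q i / l i)"
  have tb: "(\<Sum>i\<in>UNIV. b i * Q i) = t" by (simp add: t_def q_inner b_def)
  have tb1: "(\<Sum>i\<in>UNIV. b i * Q i / l i) = t / \<Lambda>"
  proof -
    have "b i * Q i / l i = b i * Q i / \<Lambda>" for i
      using b_div[of i] by (metis times_divide_eq_left)
    then have "(\<Sum>i\<in>UNIV. b i * Q i / l i) = (\<Sum>i\<in>UNIV. b i * Q i / \<Lambda>)" by (rule sum.cong[OF refl])
    then show ?thesis by (simp only: tb sum_divide_distrib[symmetric])
  qed
  define y where "y = \<kappa>\<^sup>2 / \<Lambda>"
  have bb1: "(\<Sum>i\<in>UNIV. (b i)\<^sup>2 / l i) = y"
  proof -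
    have "(b i)\<^sup>2 / l i = (b i)\<^sup>2 / \<Lambda>" for i
      using b_div[of i] by (metis times_divide_eq_left power2_eq_square)
    then have "(\<Sum>i\<in>UNIV. (b i)\<^sup>2 / l i) = (\<Sum>i\<in>UNIV. (b i)\<^sup>2 / \<Lambda>)" by (rule sum.cong[OF refl])
    then show ?thesis using a_sum by (simp only: y_def b_def sum_divide_distrib[symmetric])
  qed
  have qc: "q \<bullet> c = (\<Sum>i\<in>UNIV. (c \<bullet> f i) * Q i)" by (rule q_inner)
  have qk: "q \<bullet> k = - (q \<bullet> c) + \<kappa> * (S0 - Sl) - 2 * t\<^sup>2"
  proof -
    have "q \<bullet> k = (\<Sum>i\<in>UNIV. - ((c \<bullet> f i) * Q i) + \<kappa> * ((Q i)\<^sup>2 - l i * (Q i)\<^sup>2) - 2 * t * (b i * Q i))"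
      unfolding q_inner[of k] by (intro sum.cong) (auto simp: kf algebra_simps power2_eq_square)
    also have "\<dots> = - (q \<bullet> c) + \<kappa> * (S0 - Sl) - 2 * t * t"
      by (simp only: sum_subtractf sum.distrib sum_negf sum_distrib_left[symmetric] qc S0_def Sl_def tb)
    finally show ?thesis by (simp add: power2_eq_square)
  qed
  have k1: "(\<Sum>i\<in>UNIV. (k \<bullet> f i) * Q i / l i) = - C1 + \<kappa> * (S1 - S0) - 2 * t\<^sup>2 / \<Lambda>"
  proof -
    have "(\<Sum>i\<in>UNIV. (k \<bullet> f i) * Q i / l i)
      = (\<Sum>i\<in>UNIV. - ((c \<bullet> f i) * Q i / l i) + \<kappa> * ((Q i)\<^sup>2 / l i - (Q i)\<^sup>2) - 2 * t * (b i * Q i / l i))"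
      using lnz by (intro sum.cong) (auto simp: kf field_simps power2_eq_square)
    also have "\<dots> = - C1 + \<kappa> * (S1 - S0) - 2 * t * (t / \<Lambda>)"
      by (simp only: sum_subtractf sum.distrib sum_negf sum_distrib_left[symmetric] C1_def S0_def S1_def tb1)
    finally show ?thesis by (simp add: power2_eq_square)
  qed
  have qHq: "q \<bullet> (H *v q) = S0 - Sl"
  proof -
    have "q \<bullet> (H *v q) = (\<Sum>i\<in>UNIV. (Q i)\<^sup>2 - l i * (Q i)\<^sup>2)"
      unfolding q_inner[of "H *v q"] by (intro sum.cong) (auto simp: H_inner qHf algebra_simps power2_eq_square)
    then show ?thesis by (simp add: sum_subtractf S0_def Sl_def)
  qed
  have dsum: "(\<Sum>i\<in>UNIV. (d i \<bullet> v) / l i) = - R * (q \<bullet> (H *v v)) - 2 * (\<Sum>i\<in>UNIV. ((H *v v) \<bullet> f i) * Q i / l i)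
      - \<phi> \<bullet> v + (n + 2) * (q \<bullet> (H *v v))" for v
  proof -
    have "(\<Sum>i\<in>UNIV. Psi1 \<epsilon> p (H *v v) (f i) 0 / l i)
      = (\<Sum>i\<in>UNIV. (- (q \<bullet> (H *v v))) * (1 / l i) - 2 * (((H *v v) \<bullet> f i) * Q i / l i))"
      by (intro sum.cong)
         (auto simp: Psi1_zero[OF eps p_less Psi_frame q_def s_def] Q_def diff_divide_distrib)
    also have "\<dots> = (- (q \<bullet> (H *v v))) * R - 2 * (\<Sum>i\<in>UNIV. ((H *v v) \<bullet> f i) * Q i / l i)"
      by (simp only: sum_subtractf sum_distrib_left[symmetric] R_def)
    finally show ?thesis unfolding d by (simp add: q_def n_def algebra_simps)
  qed
  have dq: "(\<Sum>i\<in>UNIV. (d i \<bullet> q) / l i) = (n + 2 - R) * (S0 - Sl) - 2 * (S1 - S0) - q \<bullet> \<phi>"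
  proof -
    have "(\<Sum>i\<in>UNIV. ((H *v q) \<bullet> f i) * Q i / l i) = (\<Sum>i\<in>UNIV. (Q i)\<^sup>2 / l i - (Q i)\<^sup>2)"
      using lnz by (intro sum.cong) (auto simp: H_inner qHf field_simps power2_eq_square)
    then show ?thesis unfolding dsum qHq by (simp add: sum_subtractf S0_def S1_def inner_commute algebra_simps)
  qed
  have d\<xi>: "(\<Sum>i\<in>UNIV. (d i \<bullet> \<xi>) / l i) = (n + 2 - R) * t - 2 * t / \<Lambda> - \<xi> \<bullet> \<phi>"
    unfolding dsum a_def[symmetric] b_def[symmetric] tb1 t_def[symmetric] by (simp add: inner_commute algebra_simps)
  have LS: "- (a \<bullet> a + p \<bullet> k) / s\<^sup>2 - 2 * t\<^sup>2 = - (\<mu> * \<kappa>\<^sup>2) - q \<bullet> k - t\<^sup>2"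
  proof -
    have "q \<bullet> k = p \<bullet> k / s\<^sup>2" by (simp add: q_def s_sq)
    with norm_a show ?thesis by (simp add: add_divide_distrib diff_divide_distrib)
  qed
  have T1: "Psi2 \<epsilon> p a k (f i) (b i *\<^sub>R q)
      = - (\<mu> * \<kappa>\<^sup>2 + q \<bullet> k) - 4 * t * (b i * Q i) - 2 * \<mu> * (b i)\<^sup>2 - 2 * ((k \<bullet> f i) * Q i)" for i
    unfolding Psi2_parallel(1)[OF eps p_less Psi_frame q_def s_def b_def] Q_def[symmetric]
        t_def[symmetric] \<mu>_def[symmetric] using norm_a by simp
  have T2: "Psi1 \<epsilon> p (H *v f i) \<xi> (b i *\<^sub>R q) = - ((1 - l i) * Q i)" for i
    using Psi2_parallel(2)[OF eps p_less Psi_\<xi> q_def s_def Hf_b[symmetric]] qHf by simp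
  have T3: "\<kappa> * Psi2 \<epsilon> p (H *v f i) (d i) \<xi> (b i *\<^sub>R q)
     = - (\<kappa> * \<mu> * (1 - l i)\<^sup>2) - \<kappa> * (d i \<bullet> q) + 4 * t * ((1 - l i) * (b i * Q i)) - 2 * \<kappa> * \<mu> * (b i)\<^sup>2 + 2 * t * (d i \<bullet> \<xi>)" for i
  proof -
    have P2: "Psi2 \<epsilon> p (H *v f i) (d i) \<xi> (b i *\<^sub>R q)
      = - (\<mu> * (1 - l i)\<^sup>2 + d i \<bullet> q) - 4 * ((1 - l i) * Q i) * b i * x - 2 * \<mu> * (b i)\<^sup>2 - 2 * (d i \<bullet> \<xi>) * x"
      using Psi2_parallel(1)[OF eps p_less Psi_\<xi> q_def s_def Hf_b[symmetric], where k = "d i"] norm_Hf[of i]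
      by (simp add: qHf x_def \<mu>_def inner_commute)
    have "\<kappa> * Psi2 \<epsilon> p (H *v f i) (d i) \<xi> (b i *\<^sub>R q)
      = - (\<kappa> * \<mu> * (1 - l i)\<^sup>2) - \<kappa> * (d i \<bullet> q) - 4 * (\<kappa> * x) * ((1 - l i) * (b i * Q i)) - 2 * \<kappa> * \<mu> * (b i)\<^sup>2
        - 2 * (\<kappa> * x) * (d i \<bullet> \<xi>)"
      unfolding P2 by (simp add: algebra_simps)
    then show ?thesis by (simp add: \<kappa>x)
  qed
  have summand: "(Psi2 \<epsilon> p a k (f i) (b i *\<^sub>R q)
       + (g i + 2 * (c \<bullet> f i) * Psi1 \<epsilon> p (H *v f i) \<xi> (b i *\<^sub>R q)
          + \<kappa> * Psi2 \<epsilon> p (H *v f i) (d i) \<xi> (b i *\<^sub>R q))) / l i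
     = (- (\<mu> * \<kappa>\<^sup>2 + q \<bullet> k)) * (1 / l i) - 4 * t * (b i * Q i / l i) - (2 * \<mu>) * ((b i)\<^sup>2 / l i)
       - 2 * ((k \<bullet> f i) * Q i / l i) + g i / l i - 2 * ((c \<bullet> f i) * Q i / l i) + 2 * ((c \<bullet> f i) * Q i)
       - (\<kappa> * \<mu>) * (1 / l i) + \<kappa> * \<mu> * 2 - (\<kappa> * \<mu>) * l i - \<kappa> * ((d i \<bullet> q) / l i)
       + (4 * t) * (b i * Q i / l i) - (4 * t) * (b i * Q i) - (2 * \<kappa> * \<mu>) * ((b i)\<^sup>2 / l i) + (2 * t) * ((d i \<bullet> \<xi>) / l i)" for i
    unfolding T1 T2 T3 using lnz[of i] by (simp add: field_simps power2_eq_square)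
  have "(\<Sum>i\<in>UNIV. (Psi2 \<epsilon> p a k (f i) (b i *\<^sub>R q)
       + (g i + 2 * (c \<bullet> f i) * Psi1 \<epsilon> p (H *v f i) \<xi> (b i *\<^sub>R q)
          + \<kappa> * Psi2 \<epsilon> p (H *v f i) (d i) \<xi> (b i *\<^sub>R q))) / l i)
     = (- (\<mu> * \<kappa>\<^sup>2 + q \<bullet> k)) * R - 4 * t * (t / \<Lambda>) - (2 * \<mu>) * y
       - 2 * (- C1 + \<kappa> * (S1 - S0) - 2 * t\<^sup>2 / \<Lambda>) + (\<Sum>i\<in>UNIV. g i / l i) - 2 * C1 + 2 * (q \<bullet> c)
       - (\<kappa> * \<mu>) * R + n * (\<kappa> * \<mu> * 2) - (\<kappa> * \<mu>) * (\<Sum>i\<in>UNIV. l i)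
       - \<kappa> * ((n + 2 - R) * (S0 - Sl) - 2 * (S1 - S0) - q \<bullet> \<phi>)
       + (4 * t) * (t / \<Lambda>) - (4 * t) * t - (2 * \<kappa> * \<mu>) * y
       + (2 * t) * ((n + 2 - R) * t - 2 * t / \<Lambda> - \<xi> \<bullet> \<phi>)"
    unfolding summand sum.distrib sum_subtractf sum_distrib_left[symmetric] R_def[symmetric] tb1 bb1 k1 C1_def[symmetric]
      qc[symmetric] dq d\<xi> tb by (simp add: n_def)
  \<comment> \<open>\<open>y\<close> enters only through \<open>(1 + \<kappa>) * y\<close>, so no
    division by \<open>\<Lambda>\<close> survives.\<close>
  moreover have "\<Lambda> * y = \<kappa>\<^sup>2" using \<Lambda> by (simp add: y_def)
  then have "2 * \<mu> * y + 2 * \<kappa> * \<mu> * y = 2 * \<mu> * \<kappa>\<^sup>2"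
    unfolding \<Lambda>_def by algebra
  ultimately show ?thesis
    unfolding b_def[symmetric] t_def[symmetric] LS qk R_def[symmetric] n_def \<mu>_def[symmetric]
    by (simp add: algebra_simps power2_eq_square)
qed

end

section \<open>Second differences of the equation\<close>

text \<open>Replaces the second-order Taylor formula for \<open>ln f\<close> and
  \<open>ln g\<close>. The constant \<open>K\<close> instead of the sharp \<open>K / 2\<close> is
  what a single use of the mean value theorem gives.\<close>

lemma lipschitz_gradient_taylor:
  fixes \<phi> :: "real^'n \<Rightarrow> real" and g :: "real^'n \<Rightarrow> real^'n"
  assumes C: "convex U" "x \<in> U" "y \<in> U"
    and d: "\<And>z. z \<in> U \<Longrightarrow> (\<phi> has_derivative (\<lambda>v. g z \<bullet> v)) (at z)"
    and lip: "\<And>z w. z \<in> U \<Longrightarrow> w \<in> U \<Longrightarrow> norm (g z - g w) \<le> K * norm (z - w)"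
  shows "\<bar>\<phi> y - \<phi> x - g x \<bullet> (y - x)\<bar> \<le> K * (norm (y - x))\<^sup>2"
proof (cases "x = y")
  case False
  have inU: "x + t *\<^sub>R (y - x) \<in> U" if "0 \<le> t" "t \<le> 1" for t
    using convexD_alt[OF C that] by (simp add: algebra_simps)
  have K: "0 \<le> K" using lip[OF C(2,3)] False norm_ge_zero[of "g x - g y"]
    by (smt (verit) mult_nonneg_nonneg mult_neg_pos right_minus_eq zero_less_norm_iff)
  have "((\<lambda>t. \<phi> (x + t *\<^sub>R (y - x))) has_real_derivative g (x + t *\<^sub>R (y - x)) \<bullet> (y - x)) (at t)"
    if "0 \<le> t" "t \<le> 1" for t
    by (intro DERIV_along_line d inU that)
  from MVT2[of 0 1, OF _ this] obtain t where t: "0 < t" "t < 1"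
    "\<phi> (x + 1 *\<^sub>R (y - x)) - \<phi> (x + 0 *\<^sub>R (y - x)) = (1 - 0) * (g (x + t *\<^sub>R (y - x)) \<bullet> (y - x))" by auto
  then have "\<bar>\<phi> y - \<phi> x - g x \<bullet> (y - x)\<bar> = \<bar>(g (x + t *\<^sub>R (y - x)) - g x) \<bullet> (y - x)\<bar>"
    by (simp add: inner_diff_left)
  also have "\<dots> \<le> norm (g (x + t *\<^sub>R (y - x)) - g x) * norm (y - x)" by (rule Cauchy_Schwarz_ineq2)
  also have "\<dots> \<le> (K * norm (t *\<^sub>R (y - x))) * norm (y - x)"
    using lip[OF inU C(2), of t] t by (intro mult_right_mono) auto
  also have "\<dots> \<le> (K * (1 * norm (y - x))) * norm (y - x)"
    using t K by (intro mult_right_mono mult_left_mono) (auto intro: mult_left_le_one_le)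
  finally show ?thesis by (simp add: power2_eq_square mult.assoc)
qed simp

lemma first_difference_along:
  fixes G :: "'a::real_normed_vector \<Rightarrow> real"
  assumes U: "open U" "z \<in> U"
    and d1: "\<And>y \<zeta> t. y + t *\<^sub>R \<zeta> \<in> U \<Longrightarrow> ((\<lambda>t. G (y + t *\<^sub>R \<zeta>)) has_real_derivative G1 (y + t *\<^sub>R \<zeta>) \<zeta>) (at t)"
    and c: "\<And>y \<eta>. y \<longlonglongrightarrow> z \<Longrightarrow> \<eta> \<longlonglongrightarrow> \<zeta> \<Longrightarrow> (\<lambda>k. G1 (y k) (\<eta> k)) \<longlonglongrightarrow> G1 z \<zeta>"
    and h: "\<And>k. 0 < h k" "h \<longlonglongrightarrow> 0" and y: "y \<longlonglongrightarrow> z" and \<eta>: "\<eta> \<longlonglongrightarrow> \<zeta>"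
  shows "(\<lambda>k. (G (y k + h k *\<^sub>R \<eta> k) - G (y k)) / h k) \<longlonglongrightarrow> G1 z \<zeta>"
proof -
  obtain d where d: "d > 0" "ball z d \<subseteq> U" using U by (meson openE)
  have "(\<lambda>k. h k * norm (\<eta> k)) \<longlonglongrightarrow> 0 * norm \<zeta>" by (intro tendsto_intros h \<eta>)
  then have e1: "\<forall>\<^sub>F k in sequentially. h k * norm (\<eta> k) < d / 2" using d by (intro order_tendstoD(2)) auto
  have e2: "\<forall>\<^sub>F k in sequentially. dist (y k) z < d / 2" using y d by (intro tendstoD) auto
  have "\<forall>\<^sub>F k in sequentially. \<exists>\<theta>. 0 \<le> \<theta> \<and> \<theta> \<le> h k \<and> (G (y k + h k *\<^sub>R \<eta> k) - G (y k)) / h k = G1 (y k + \<theta> *\<^sub>R \<eta> k) (\<eta> k)"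
    using e1 e2
  proof eventually_elim
    case (elim k)
    have inU: "y k + t *\<^sub>R \<eta> k \<in> U" if "0 \<le> t" "t \<le> h k" for t
    proof -
      have "\<bar>t\<bar> * norm (\<eta> k) \<le> h k * norm (\<eta> k)" using that by (intro mult_right_mono) auto
      then have "norm (t *\<^sub>R \<eta> k) < d / 2" using elim by simp
      then have "dist z (y k + t *\<^sub>R \<eta> k) < d"
        using elim norm_triangle_ineq[of "y k - z" "t *\<^sub>R \<eta> k"]
        by (simp add: dist_norm norm_minus_commute[of z] algebra_simps)
      then show ?thesis using d by auto
    qed
    obtain \<theta> where "0 < \<theta>" "\<theta> < h k"
      "G (y k + h k *\<^sub>R \<eta> k) - G (y k + 0 *\<^sub>R \<eta> k) = (h k - 0) * G1 (y k + \<theta> *\<^sub>R \<eta> k) (\<eta> k)"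
      using MVT2[OF h(1)[of k], of "\<lambda>t. G (y k + t *\<^sub>R \<eta> k)" "\<lambda>t. G1 (y k + t *\<^sub>R \<eta> k) (\<eta> k)"] d1 inU by blast
    then show ?case using h(1)[of k] by (intro exI[of _ \<theta>]) auto
  qed
  then obtain N where N: "\<And>k. k \<ge> N \<Longrightarrow> \<exists>\<theta>. 0 \<le> \<theta> \<and> \<theta> \<le> h k \<and> (G (y k + h k *\<^sub>R \<eta> k) - G (y k)) / h k = G1 (y k + \<theta> *\<^sub>R \<eta> k) (\<eta> k)"
    unfolding eventually_sequentially by blast
  have "\<exists>\<theta>. 0 \<le> \<theta> \<and> \<theta> \<le> h k \<and> (k \<ge> N \<longrightarrow> (G (y k + h k *\<^sub>R \<eta> k) - G (y k)) / h k = G1 (y k + \<theta> *\<^sub>R \<eta> k) (\<eta> k))" for k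
    using N[of k] h(1)[of k] by (cases "k \<ge> N") (auto intro: exI[of _ 0] simp: less_imp_le)
  then obtain \<theta> where \<theta>: "\<And>k. 0 \<le> \<theta> k" "\<And>k. \<theta> k \<le> h k"
     "\<And>k. k \<ge> N \<Longrightarrow> (G (y k + h k *\<^sub>R \<eta> k) - G (y k)) / h k = G1 (y k + \<theta> k *\<^sub>R \<eta> k) (\<eta> k)" by metis
  have "\<theta> \<longlonglongrightarrow> 0" by (rule tendsto_sandwich[OF _ _ tendsto_const h(2)]) (use \<theta> in auto)
  then have "(\<lambda>k. y k + \<theta> k *\<^sub>R \<eta> k) \<longlonglongrightarrow> z + 0 *\<^sub>R \<zeta>" by (intro tendsto_intros y \<eta>)
  then have "(\<lambda>k. G1 (y k + \<theta> k *\<^sub>R \<eta> k) (\<eta> k)) \<longlonglongrightarrow> G1 z \<zeta>" by (intro c \<eta>) simp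
  then show ?thesis
    by (rule Lim_transform_eventually) (rule eventually_sequentiallyI[of N], rule \<theta>(3)[symmetric])
qed

lemma tendsto_vecI_inner:
  fixes f :: "'a \<Rightarrow> 'b::euclidean_space"
  assumes "\<And>b. ((\<lambda>k. f k \<bullet> b) \<longlongrightarrow> l \<bullet> b) F"
  shows "(f \<longlongrightarrow> l) F"
  using assms by (subst tendsto_componentwise_iff) auto

section \<open>Derivatives of \<open>T\<close> and of \<open>ln sf\<close> along lines\<close>

context touching
begin

definition sf :: "real^'n \<Rightarrow> real" where "sf x = sqrt (1 - p x \<bullet> p x)"

definition T :: "real^'n \<Rightarrow> real^'n" where "T x = x - \<epsilon> *\<^sub>R ((1 / sf x) *\<^sub>R p x)"

text \<open>\<open>T1\<close> and \<open>T2\<close> are the first and second derivatives of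
  \<open>T\<close> along the line through \<open>x\<close> with direction \<open>v\<close>;
  \<open>ls1\<close> and \<open>ls2\<close> are those of \<open>ln sf\<close>.\<close>

definition T1 :: "real^'n \<Rightarrow> real^'n \<Rightarrow> real^'n" where
  "T1 x v = v - \<epsilon> *\<^sub>R ((1 / sf x) *\<^sub>R (H x *v v) + ((p x \<bullet> (H x *v v)) / sf x ^ 3) *\<^sub>R p x)"

definition T2 :: "real^'n \<Rightarrow> real^'n \<Rightarrow> real^'n" where
  "T2 x v = - \<epsilon> *\<^sub>R ((1 / sf x) *\<^sub>R (D3 x v *v v) + (2 * (p x \<bullet> (H x *v v)) / sf x ^ 3) *\<^sub>R (H x *v v)
     + (((H x *v v) \<bullet> (H x *v v) + p x \<bullet> (D3 x v *v v)) / sf x ^ 3 + 3 * (p x \<bullet> (H x *v v))\<^sup>2 / sf x ^ 5) *\<^sub>R p x)"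

definition ls1 :: "real^'n \<Rightarrow> real^'n \<Rightarrow> real" where
  "ls1 x v = - (p x \<bullet> (H x *v v)) / (sf x)\<^sup>2"

definition ls2 :: "real^'n \<Rightarrow> real^'n \<Rightarrow> real" where
  "ls2 x v = - ((H x *v v) \<bullet> (H x *v v) + p x \<bullet> (D3 x v *v v)) / (sf x)\<^sup>2 - 2 * (p x \<bullet> (H x *v v))\<^sup>2 / sf x ^ 4"

lemma sf_pos: "x \<in> S \<Longrightarrow> 0 < sf x" and sf_sq: "x \<in> S \<Longrightarrow> (sf x)\<^sup>2 = 1 - p x \<bullet> p x"
  using p_less by (auto simp: sf_def less_imp_le)

lemma line_pHe: "y + t *\<^sub>R e \<in> S \<Longrightarrow> ((\<lambda>t. p (y + t *\<^sub>R e) \<bullet> (H (y + t *\<^sub>R e) *v e)) has_real_derivative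
    ((H (y + t *\<^sub>R e) *v e) \<bullet> (H (y + t *\<^sub>R e) *v e) + p (y + t *\<^sub>R e) \<bullet> (D3 (y + t *\<^sub>R e) e *v e))) (at t)"
  using DERIV_inner_vector[OF line_p line_H, of y t e] by (simp add: add.commute)

lemma line_sf: "y + t *\<^sub>R e \<in> S \<Longrightarrow> ((\<lambda>t. sf (y + t *\<^sub>R e)) has_real_derivative
    - (p (y + t *\<^sub>R e) \<bullet> (H (y + t *\<^sub>R e) *v e)) / sf (y + t *\<^sub>R e)) (at t)"
  unfolding sf_def using p_less[of "y + t *\<^sub>R e"]
  by (auto intro!: derivative_eq_intros DERIV_inner_vector[OF line_p line_p] simp: inner_commute field_simps)

context
  fixes y e :: "real^'n" and t :: real
  assumes yS: "y + t *\<^sub>R e \<in> S"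
begin

lemma sy: "sf (y + t *\<^sub>R e) \<noteq> 0" "0 < sf (y + t *\<^sub>R e)" using sf_pos[OF yS] by auto

lemma line_inv: "((\<lambda>t. 1 / sf (y + t *\<^sub>R e)) has_real_derivative
    (p (y + t *\<^sub>R e) \<bullet> (H (y + t *\<^sub>R e) *v e)) / sf (y + t *\<^sub>R e) ^ 3) (at t)"
  by (rule DERIV_cong[OF DERIV_divide[OF DERIV_const line_sf[OF yS] sy(1)]])
     (use sy in \<open>simp add: field_simps power3_eq_cube\<close>)

lemma line_inv1: "((\<lambda>t. (p (y + t *\<^sub>R e) \<bullet> (H (y + t *\<^sub>R e) *v e)) / sf (y + t *\<^sub>R e) ^ 3) has_real_derivative
    ((H (y + t *\<^sub>R e) *v e) \<bullet> (H (y + t *\<^sub>R e) *v e) + p (y + t *\<^sub>R e) \<bullet> (D3 (y + t *\<^sub>R e) e *v e)) / sf (y + t *\<^sub>R e) ^ 3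
      + 3 * (p (y + t *\<^sub>R e) \<bullet> (H (y + t *\<^sub>R e) *v e))\<^sup>2 / sf (y + t *\<^sub>R e) ^ 5) (at t)"
  by (rule DERIV_cong[OF DERIV_divide[OF line_pHe[OF yS] DERIV_power[OF line_sf[OF yS], where n = 3]]])
     (use sy in \<open>simp_all add: field_simps eval_nat_numeral\<close>)

lemma line_ln: "((\<lambda>t. ln (sf (y + t *\<^sub>R e))) has_real_derivative ls1 (y + t *\<^sub>R e) e) (at t)"
  unfolding ls1_def using sy
  by (auto intro!: derivative_eq_intros line_sf[OF yS] simp: field_simps power2_eq_square)

lemma line_ln1: "((\<lambda>t. ls1 (y + t *\<^sub>R e) e) has_real_derivative ls2 (y + t *\<^sub>R e) e) (at t)"
  unfolding ls1_def ls2_def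
  by (rule DERIV_cong[OF DERIV_divide[OF DERIV_minus[OF line_pHe[OF yS]] DERIV_power[OF line_sf[OF yS], where n = 2]]])
     (use sy in \<open>simp_all add: field_simps eval_nat_numeral\<close>)

lemma line_T: "((\<lambda>t. T (y + t *\<^sub>R e) \<bullet> b) has_real_derivative T1 (y + t *\<^sub>R e) e \<bullet> b) (at t)"
proof -
  have "((\<lambda>t. (y \<bullet> b + t * (e \<bullet> b)) - \<epsilon> * (1 / sf (y + t *\<^sub>R e) * (p (y + t *\<^sub>R e) \<bullet> b))) has_real_derivative
     (e \<bullet> b) - \<epsilon> * ((p (y + t *\<^sub>R e) \<bullet> (H (y + t *\<^sub>R e) *v e)) / sf (y + t *\<^sub>R e) ^ 3 * (p (y + t *\<^sub>R e) \<bullet> b)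
       + (p (y + t *\<^sub>R e) \<bullet> 0 + (H (y + t *\<^sub>R e) *v e) \<bullet> b) * (1 / sf (y + t *\<^sub>R e)))) (at t)"
    by (intro DERIV_diff DERIV_cmult DERIV_mult line_inv DERIV_inner_vector[OF line_p[OF yS] has_vector_derivative_const])
       (auto intro!: derivative_eq_intros)
  then show ?thesis
    by (simp add: T_def T1_def inner_diff_left inner_add_left algebra_simps)
qed

lemma line_T1: "((\<lambda>t. T1 (y + t *\<^sub>R e) e \<bullet> b) has_real_derivative T2 (y + t *\<^sub>R e) e \<bullet> b) (at t)"
proof -
  have "((\<lambda>t. (e \<bullet> b) - \<epsilon> * ((p (y + t *\<^sub>R e) \<bullet> (H (y + t *\<^sub>R e) *v e)) / sf (y + t *\<^sub>R e) ^ 3 * (p (y + t *\<^sub>R e) \<bullet> b)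
       + ((H (y + t *\<^sub>R e) *v e) \<bullet> b) * (1 / sf (y + t *\<^sub>R e)))) has_real_derivative
      0 - \<epsilon> * ((((H (y + t *\<^sub>R e) *v e) \<bullet> (H (y + t *\<^sub>R e) *v e) + p (y + t *\<^sub>R e) \<bullet> (D3 (y + t *\<^sub>R e) e *v e)) / sf (y + t *\<^sub>R e) ^ 3
      + 3 * (p (y + t *\<^sub>R e) \<bullet> (H (y + t *\<^sub>R e) *v e))\<^sup>2 / sf (y + t *\<^sub>R e) ^ 5) * (p (y + t *\<^sub>R e) \<bullet> b)
      + (p (y + t *\<^sub>R e) \<bullet> 0 + (H (y + t *\<^sub>R e) *v e) \<bullet> b) * ((p (y + t *\<^sub>R e) \<bullet> (H (y + t *\<^sub>R e) *v e)) / sf (y + t *\<^sub>R e) ^ 3)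
      + (((H (y + t *\<^sub>R e) *v e) \<bullet> 0 + (D3 (y + t *\<^sub>R e) e *v e) \<bullet> b) * (1 / sf (y + t *\<^sub>R e))
        + (p (y + t *\<^sub>R e) \<bullet> (H (y + t *\<^sub>R e) *v e)) / sf (y + t *\<^sub>R e) ^ 3 * ((H (y + t *\<^sub>R e) *v e) \<bullet> b)))) (at t)"
    by (intro DERIV_diff DERIV_cmult DERIV_mult DERIV_add line_inv line_inv1 DERIV_const
        DERIV_inner_vector[OF line_p[OF yS] has_vector_derivative_const]
        DERIV_inner_vector[OF line_H[OF yS] has_vector_derivative_const])
  then show ?thesis
    by (simp add: T1_def T2_def inner_diff_left inner_add_left algebra_simps add_divide_distrib diff_divide_distrib)
qed

end

lemma sf_tendsto: "x \<in> S \<Longrightarrow> y \<longlonglongrightarrow> x \<Longrightarrow> (\<lambda>k. sf (y k)) \<longlonglongrightarrow> sf x"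
  unfolding sf_def by (intro tendsto_intros isCont_tendsto)

lemma sf_nz: "x \<in> S \<Longrightarrow> sf x \<noteq> 0" using sf_pos by force

lemma tendsto_T: "x \<in> S \<Longrightarrow> y \<longlonglongrightarrow> x \<Longrightarrow> (\<lambda>k. T (y k)) \<longlonglongrightarrow> T x"
  unfolding T_def by (intro tendsto_intros isCont_tendsto sf_tendsto) (auto simp: sf_nz)

lemma T_first_difference:
  assumes "x \<in> S" "\<And>k. 0 < h k" "h \<longlonglongrightarrow> 0" "y \<longlonglongrightarrow> x" "\<eta> \<longlonglongrightarrow> \<zeta>"
  shows "(\<lambda>k. (1 / h k) *\<^sub>R (T (y k + h k *\<^sub>R \<eta> k) - T (y k))) \<longlonglongrightarrow> T1 x \<zeta>"
proof (rule tendsto_vecI_inner)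
  fix b :: "real^'n"
  have "(\<lambda>k. (T (y k + h k *\<^sub>R \<eta> k) \<bullet> b - T (y k) \<bullet> b) / h k) \<longlonglongrightarrow> T1 x \<zeta> \<bullet> b"
  proof (rule first_difference_along[OF open_S assms(1) line_T _ assms(2-5)])
    fix y \<eta> :: "nat \<Rightarrow> real^'n" assume "y \<longlonglongrightarrow> x" "\<eta> \<longlonglongrightarrow> \<zeta>"
    then show "(\<lambda>k. T1 (y k) (\<eta> k) \<bullet> b) \<longlonglongrightarrow> T1 x \<zeta> \<bullet> b"
      unfolding T1_def using assms(1)
      by (intro tendsto_intros tendsto_matrix_vector_mult isCont_tendsto sf_tendsto) (auto simp: sf_nz)
  qed
  then show "(\<lambda>k. ((1 / h k) *\<^sub>R (T (y k + h k *\<^sub>R \<eta> k) - T (y k))) \<bullet> b) \<longlonglongrightarrow> T1 x \<zeta> \<bullet> b"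
    by (simp add: inner_diff_left)
qed

lemma T_second_difference:
  assumes "x \<in> S" "\<And>k. 0 < h k" "h \<longlonglongrightarrow> 0" "y \<longlonglongrightarrow> x" "\<eta> \<longlonglongrightarrow> \<zeta>"
  shows "(\<lambda>k. (1 / (h k)\<^sup>2) *\<^sub>R (T (y k + h k *\<^sub>R \<eta> k) + T (y k - h k *\<^sub>R \<eta> k) - 2 *\<^sub>R T (y k))) \<longlonglongrightarrow> T2 x \<zeta>"
proof (rule tendsto_vecI_inner)
  fix b :: "real^'n"
  have "(\<lambda>k. (T (y k + h k *\<^sub>R \<eta> k) \<bullet> b + T (y k - h k *\<^sub>R \<eta> k) \<bullet> b - 2 * (T (y k) \<bullet> b)) / (h k)\<^sup>2) \<longlonglongrightarrow> T2 x \<zeta> \<bullet> b"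
  proof (rule second_difference_along[OF open_S assms(1) line_T line_T1 _ assms(2-5)])
    fix y \<eta> :: "nat \<Rightarrow> real^'n" assume "y \<longlonglongrightarrow> x" "\<eta> \<longlonglongrightarrow> \<zeta>"
    then show "(\<lambda>k. T2 (y k) (\<eta> k) \<bullet> b) \<longlonglongrightarrow> T2 x \<zeta> \<bullet> b"
      unfolding T2_def using assms(1)
      by (intro tendsto_intros tendsto_matrix_vector_mult isCont_tendsto sf_tendsto tendsto_D3) (auto simp: sf_nz)
  qed
  then show "(\<lambda>k. ((1 / (h k)\<^sup>2) *\<^sub>R (T (y k + h k *\<^sub>R \<eta> k) + T (y k - h k *\<^sub>R \<eta> k) - 2 *\<^sub>R T (y k))) \<bullet> b) \<longlonglongrightarrow> T2 x \<zeta> \<bullet> b"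
    by (simp add: inner_diff_left inner_add_left)
qed

lemma ln_sf_second_difference:
  assumes "x \<in> S" "\<And>k. 0 < h k" "h \<longlonglongrightarrow> 0" "y \<longlonglongrightarrow> x" "\<eta> \<longlonglongrightarrow> \<zeta>"
  shows "(\<lambda>k. (ln (sf (y k + h k *\<^sub>R \<eta> k)) + ln (sf (y k - h k *\<^sub>R \<eta> k)) - 2 * ln (sf (y k))) / (h k)\<^sup>2) \<longlonglongrightarrow> ls2 x \<zeta>"
proof (rule second_difference_along[OF open_S assms(1) line_ln line_ln1 _ assms(2-5)])
  fix y \<eta> :: "nat \<Rightarrow> real^'n" assume "y \<longlonglongrightarrow> x" "\<eta> \<longlonglongrightarrow> \<zeta>"
  then show "(\<lambda>k. ls2 (y k) (\<eta> k)) \<longlonglongrightarrow> ls2 x \<zeta>"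
    unfolding ls2_def using assms(1)
    by (intro tendsto_intros tendsto_matrix_vector_mult isCont_tendsto sf_tendsto tendsto_D3) (auto simp: sf_nz)
qed

end

section \<open>The inverse of \<open>A\<close> and Euclidean bounds in terms of
  \<open>s\<close>\<close>

context frame
begin

text \<open>In the notation of \<open>L\<close> this is
  \<open>L (I + (L\<^sup>2 / \<epsilon>\<^sup>2) p p\<^sup>T)\<close>, applied to
  \<open>v\<close>.\<close>

definition Ainv :: "real^'n \<Rightarrow> real^'n" where
  "Ainv v = (\<epsilon> / s) *\<^sub>R (v + (q \<bullet> v) *\<^sub>R p)"

lemma p_q: "p \<bullet> v = s\<^sup>2 * (q \<bullet> v)"
  using s_pos by (simp add: q_def s_sq[symmetric])

lemma Ainv_A: "Ainv (A *v v) = v"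
proof -
  have "q \<bullet> (A *v v) = s / \<epsilon> * (p \<bullet> v)" by (metis A_q_inner(2) A_sym)
  then have "Ainv (A *v v) = (\<epsilon> / s) *\<^sub>R ((s / \<epsilon>) *\<^sub>R v)"
    unfolding Ainv_def A_mult by (simp add: scaleR_diff_right)
  then show ?thesis using s_pos eps by simp
qed

lemma Ainv_linear: "Ainv (v + w) = Ainv v + Ainv w" "Ainv (r *\<^sub>R v) = r *\<^sub>R Ainv v" "Ainv (v - w) = Ainv v - Ainv w"
  by (simp_all add: Ainv_def inner_add_right inner_diff_right algebra_simps)

lemma Ainv_sym: "Ainv v \<bullet> w = v \<bullet> Ainv w"
  using p_q[of v] p_q[of w] s_pos
  by (simp add: Ainv_def inner_add_left inner_add_right inner_commute)

lemma norm_q: "norm q \<le> 1 / s\<^sup>2"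
proof -
  have "norm p \<le> 1" using p_less by (simp add: norm_eq_sqrt_inner)
  then show ?thesis using s_pos by (simp add: q_def s_sq[symmetric] divide_right_mono)
qed

lemma norm_Ainv: "norm (Ainv v) \<le> \<epsilon> / s ^ 3 * norm v"
proof -
  have "norm ((q \<bullet> v) *\<^sub>R p) \<le> (norm p)\<^sup>2 / s\<^sup>2 * norm v"
  proof -
    have "norm ((q \<bullet> v) *\<^sub>R p) = \<bar>p \<bullet> v\<bar> / s\<^sup>2 * norm p" by (simp add: q_def s_sq[symmetric])
    also have "\<dots> \<le> (norm p * norm v) / s\<^sup>2 * norm p"
      by (intro mult_right_mono divide_right_mono Cauchy_Schwarz_ineq2) auto
    finally show ?thesis by (simp add: power2_eq_square mult_ac)
  qed
  then have "norm (v + (q \<bullet> v) *\<^sub>R p) \<le> norm v + (norm p)\<^sup>2 / s\<^sup>2 * norm v"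
    by (intro order_trans[OF norm_triangle_ineq]) auto
  also have "\<dots> = (s\<^sup>2 + (norm p)\<^sup>2) / s\<^sup>2 * norm v" using s_pos by (simp add: field_simps)
  also have "s\<^sup>2 + (norm p)\<^sup>2 = 1" by (simp add: s_sq power2_norm_eq_inner)
  finally have "norm (v + (q \<bullet> v) *\<^sub>R p) \<le> 1 / s\<^sup>2 * norm v" .
  then have "\<epsilon> / s * norm (v + (q \<bullet> v) *\<^sub>R p) \<le> \<epsilon> / s * (1 / s\<^sup>2 * norm v)"
    using eps s_pos by (intro mult_left_mono) auto
  then show ?thesis using eps s_pos by (simp add: Ainv_def power3_eq_cube power2_eq_square)
qed

lemma Psi_lower: "s ^ 3 / \<epsilon> * (e \<bullet> e) \<le> Psi \<epsilon> p e"
proof -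
  have "s ^ 3 / \<epsilon> * (e \<bullet> e) = s / \<epsilon> * ((1 - p \<bullet> p) * (e \<bullet> e))"
    by (simp add: s_sq[symmetric] power3_eq_cube power2_eq_square)
  also have "\<dots> \<le> s / \<epsilon> * (e \<bullet> e - (p \<bullet> e)\<^sup>2)"
    using s_pos eps by (intro mult_left_mono metric_lower) auto
  finally show ?thesis by (simp add: Psi_def s_def)
qed

lemma norm_unit: "Psi \<epsilon> p e = 1 \<Longrightarrow> e \<bullet> e \<le> \<epsilon> / s ^ 3"
  using Psi_lower[of e] eps s_pos by (simp add: field_simps)

end

section \<open>The equation at the maximum point\<close>

text \<open>\<open>\<phi>\<close> and \<open>\<gamma>\<close> stand for \<open>ln f\<close> and
  \<open>ln g\<close>. In the application \<open>S\<close> is a ball and \<open>\<Omega>'\<close> a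
  small ball around \<open>T x0\<close>, since the Lipschitz bounds for the gradients hold on convex
  sets.\<close>

locale pde = touching S u p H D \<epsilon> \<kappa> \<kappa>1 \<kappa>2 x0 \<xi>0
  for S :: "(real^'n) set" and u p H D \<epsilon> \<kappa> \<kappa>1 \<kappa>2 x0 \<xi>0 +
  fixes \<Omega>' :: "(real^'n) set" and \<phi> \<gamma> :: "real^'n \<Rightarrow> real" and gF gG :: "real^'n \<Rightarrow> real^'n" and K c0 :: real
  assumes w_pos: "x \<in> S \<Longrightarrow> pos_def (wm x)"
    and convex_S: "convex S" and open_\<Omega>': "open \<Omega>'"
    and unit: "Psi \<epsilon> (p x0) \<xi>0 = 1"
    and T_in: "T x0 \<in> \<Omega>'"
    and d\<phi>: "x \<in> S \<Longrightarrow> (\<phi> has_derivative (\<lambda>v. gF x \<bullet> v)) (at x)"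
    and lip\<phi>: "x \<in> S \<Longrightarrow> y \<in> S \<Longrightarrow> norm (gF x - gF y) \<le> K * norm (x - y)"
    and d\<gamma>: "z \<in> \<Omega>' \<Longrightarrow> (\<gamma> has_derivative (\<lambda>v. gG z \<bullet> v)) (at z)"
    and lip\<gamma>: "z \<in> \<Omega>' \<Longrightarrow> w \<in> \<Omega>' \<Longrightarrow> norm (gG z - gG w) \<le> K * norm (z - w)"
    and equation: "x \<in> S \<Longrightarrow> ln (det (wm x)) = (CARD('n) + 2) * ln (sf x) + c0 + \<phi> x - \<gamma> (T x)"
begin

text \<open>The gradient terms of \<open>\<phi>\<close> cancel because
  \<open>x \<plusminus> h \<xi>\<close> are symmetric about \<open>x\<close>. Their images under
  \<open>T\<close> are not, which leaves \<open>gG\<close> paired with the second derivative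
  \<open>T2\<close>. The quadratic remainders occur once at each outer point, hence the factors
  2.\<close>

lemma ln_det_second_difference:
  assumes h: "\<And>k. 0 < h k" "h \<longlonglongrightarrow> 0" and x: "x \<longlonglongrightarrow> x0" and \<xi>: "\<xi> \<longlonglongrightarrow> \<xi>0"
  shows "\<exists>b. b \<longlonglongrightarrow> (CARD('n) + 2) * ls2 x0 \<xi>0 - 2 * K * (norm \<xi>0)\<^sup>2
        - (gG (T x0) \<bullet> T2 x0 \<xi>0 + 2 * K * (norm (T1 x0 \<xi>0))\<^sup>2) \<and>
     (\<forall>\<^sub>F k in sequentially. b k \<le>
       (ln (det (wm (x k + h k *\<^sub>R \<xi> k))) + ln (det (wm (x k - h k *\<^sub>R \<xi> k))) - 2 * ln (det (wm (x k)))) / (h k)\<^sup>2)"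
proof -
  define xp where "xp k = x k + h k *\<^sub>R \<xi> k" for k
  define xm where "xm k = x k - h k *\<^sub>R \<xi> k" for k
  have l: "xp \<longlonglongrightarrow> x0 + 0 *\<^sub>R \<xi>0" "xm \<longlonglongrightarrow> x0 - 0 *\<^sub>R \<xi>0"
    unfolding xp_def xm_def by (intro tendsto_intros x \<xi> h)+
  then have l: "xp \<longlonglongrightarrow> x0" "xm \<longlonglongrightarrow> x0" by simp_all
  define a where "a k = (ln (sf (xp k)) + ln (sf (xm k)) - 2 * ln (sf (x k))) / (h k)\<^sup>2" for k
  have a: "a \<longlonglongrightarrow> ls2 x0 \<xi>0" unfolding a_def xp_def xm_def by (rule ln_sf_second_difference[OF x0 h x \<xi>])
  define t2 where "t2 k = (1 / (h k)\<^sup>2) *\<^sub>R (T (xp k) + T (xm k) - 2 *\<^sub>R T (x k))" for k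
  have t2: "t2 \<longlonglongrightarrow> T2 x0 \<xi>0" unfolding t2_def xp_def xm_def by (rule T_second_difference[OF x0 h x \<xi>])
  define tp where "tp k = (1 / h k) *\<^sub>R (T (xp k) - T (x k))" for k
  define tm where "tm k = (1 / h k) *\<^sub>R (T (xm k) - T (x k))" for k
  have tp: "tp \<longlonglongrightarrow> T1 x0 \<xi>0" unfolding tp_def xp_def by (rule T_first_difference[OF x0 h x \<xi>])
  have "tm \<longlonglongrightarrow> T1 x0 (- \<xi>0)"
    using T_first_difference[OF x0 h x tendsto_minus[OF \<xi>]] by (simp add: tm_def[abs_def] xm_def)
  moreover have "T1 x0 (- \<xi>0) = - T1 x0 \<xi>0" by (simp add: T1_def linear_neg[OF matrix_vector_mul_linear] algebra_simps)
  ultimately have tm: "tm \<longlonglongrightarrow> - T1 x0 \<xi>0" by simp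
  have Tx: "(\<lambda>k. T (x k)) \<longlonglongrightarrow> T x0" "(\<lambda>k. T (xp k)) \<longlonglongrightarrow> T x0" "(\<lambda>k. T (xm k)) \<longlonglongrightarrow> T x0"
    by (intro tendsto_T x0 x l)+
  \<comment> \<open>The Taylor estimate for \<open>\<gamma>\<close> needs a convex set containing
    the three image points.\<close>
  obtain d where d: "d > 0" "ball (T x0) d \<subseteq> \<Omega>'" using open_\<Omega>' T_in by (meson openE)
  have centre: "T x0 \<in> ball (T x0) d" using d by simp
  have gG: "(\<lambda>k. gG (T (x k))) \<longlonglongrightarrow> gG (T x0)"
  proof -
    have "(\<lambda>k. K * norm (T (x k) - T x0)) \<longlonglongrightarrow> K * norm (T x0 - T x0)" by (intro tendsto_intros Tx)
    then have lim0: "(\<lambda>k. K * norm (T (x k) - T x0)) \<longlonglongrightarrow> 0" by simp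
    have "\<forall>\<^sub>F k in sequentially. T (x k) \<in> \<Omega>'" using topological_tendstoD[OF Tx(1) open_\<Omega>' T_in] .
    then have "\<forall>\<^sub>F k in sequentially. norm (gG (T (x k)) - gG (T x0)) \<le> K * norm (T (x k) - T x0)"
      by eventually_elim (intro lip\<gamma> T_in)
    from tendsto_0_le[OF lim0, of _ 1] this show ?thesis
      by (subst Lim_null) (auto elim!: eventually_mono intro: order_trans[OF _ abs_ge_self] intro!: Lim_null_comparison[OF _ lim0])
  qed
  define b where "b k = (CARD('n) + 2) * a k - 2 * K * (norm (\<xi> k))\<^sup>2
      - (gG (T (x k)) \<bullet> t2 k + (K * (norm (tp k))\<^sup>2 + K * (norm (tm k))\<^sup>2))" for k
  have "b \<longlonglongrightarrow> (CARD('n) + 2) * ls2 x0 \<xi>0 - 2 * K * (norm \<xi>0)\<^sup>2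
        - (gG (T x0) \<bullet> T2 x0 \<xi>0 + (K * (norm (T1 x0 \<xi>0))\<^sup>2 + K * (norm (- T1 x0 \<xi>0))\<^sup>2))"
    unfolding b_def by (intro tendsto_intros a \<xi> gG t2 tp tm)
  then have "b \<longlonglongrightarrow> (CARD('n) + 2) * ls2 x0 \<xi>0 - 2 * K * (norm \<xi>0)\<^sup>2
        - (gG (T x0) \<bullet> T2 x0 \<xi>0 + 2 * K * (norm (T1 x0 \<xi>0))\<^sup>2)" by (simp add: mult.assoc)
  moreover have "\<forall>\<^sub>F k in sequentially. x k \<in> S" "\<forall>\<^sub>F k in sequentially. xp k \<in> S" "\<forall>\<^sub>F k in sequentially. xm k \<in> S"
    by (intro topological_tendstoD[OF _ open_S x0] x l)+
  moreover have "\<forall>\<^sub>F k in sequentially. T (x k) \<in> ball (T x0) d" "\<forall>\<^sub>F k in sequentially. T (xp k) \<in> ball (T x0) d"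
    "\<forall>\<^sub>F k in sequentially. T (xm k) \<in> ball (T x0) d"
    by (intro topological_tendstoD[OF _ open_ball centre] Tx)+
  ultimately have "b \<longlonglongrightarrow> (CARD('n) + 2) * ls2 x0 \<xi>0 - 2 * K * (norm \<xi>0)\<^sup>2
        - (gG (T x0) \<bullet> T2 x0 \<xi>0 + 2 * K * (norm (T1 x0 \<xi>0))\<^sup>2)"
    and "\<forall>\<^sub>F k in sequentially. b k \<le>
       (ln (det (wm (xp k))) + ln (det (wm (xm k))) - 2 * ln (det (wm (x k)))) / (h k)\<^sup>2"
  proof -
    assume ev: "\<forall>\<^sub>F k in sequentially. x k \<in> S" "\<forall>\<^sub>F k in sequentially. xp k \<in> S" "\<forall>\<^sub>F k in sequentially. xm k \<in> S"
      "\<forall>\<^sub>F k in sequentially. T (x k) \<in> ball (T x0) d" "\<forall>\<^sub>F k in sequentially. T (xp k) \<in> ball (T x0) d"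
      "\<forall>\<^sub>F k in sequentially. T (xm k) \<in> ball (T x0) d"
    from ev show "\<forall>\<^sub>F k in sequentially. b k \<le>
       (ln (det (wm (xp k))) + ln (det (wm (xm k))) - 2 * ln (det (wm (x k)))) / (h k)\<^sup>2"
    proof eventually_elim
      case (elim k)
      have hk: "0 < h k" by (rule h)
      have ball: "\<And>z. z \<in> ball (T x0) d \<Longrightarrow> (\<gamma> has_derivative (\<lambda>v. gG z \<bullet> v)) (at z)"
        "\<And>z w. z \<in> ball (T x0) d \<Longrightarrow> w \<in> ball (T x0) d \<Longrightarrow> norm (gG z - gG w) \<le> K * norm (z - w)"
        using d d\<gamma> lip\<gamma> by blast+
      have F1: "\<phi> (xp k) - \<phi> (x k) - gF (x k) \<bullet> (h k *\<^sub>R \<xi> k) \<ge> - (K * (norm (h k *\<^sub>R \<xi> k))\<^sup>2)"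
        using lipschitz_gradient_taylor[OF convex_S elim(1,2) d\<phi> lip\<phi>] by (simp add: xp_def abs_le_iff)
      have F2: "\<phi> (xm k) - \<phi> (x k) - gF (x k) \<bullet> (- (h k *\<^sub>R \<xi> k)) \<ge> - (K * (norm (h k *\<^sub>R \<xi> k))\<^sup>2)"
        using lipschitz_gradient_taylor[OF convex_S elim(1,3) d\<phi> lip\<phi>] by (simp add: xm_def abs_le_iff)
      have G1: "\<gamma> (T (xp k)) - \<gamma> (T (x k)) - gG (T (x k)) \<bullet> (T (xp k) - T (x k)) \<le> K * (norm (T (xp k) - T (x k)))\<^sup>2"
        using lipschitz_gradient_taylor[OF convex_ball elim(4,5) ball] by (simp add: abs_le_iff)
      have G2: "\<gamma> (T (xm k)) - \<gamma> (T (x k)) - gG (T (x k)) \<bullet> (T (xm k) - T (x k)) \<le> K * (norm (T (xm k) - T (x k)))\<^sup>2"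
        using lipschitz_gradient_taylor[OF convex_ball elim(4,6) ball] by (simp add: abs_le_iff)
      have e: "(h k)\<^sup>2 * a k = ln (sf (xp k)) + ln (sf (xm k)) - 2 * ln (sf (x k))"
        "(h k)\<^sup>2 *\<^sub>R t2 k = T (xp k) + T (xm k) - 2 *\<^sub>R T (x k)"
        "h k *\<^sub>R tp k = T (xp k) - T (x k)" "h k *\<^sub>R tm k = T (xm k) - T (x k)"
        using hk by (simp_all add: a_def t2_def tp_def tm_def)
      have "(h k)\<^sup>2 * b k = (CARD('n) + 2) * ((h k)\<^sup>2 * a k) - 2 * K * (norm (h k *\<^sub>R \<xi> k))\<^sup>2
         - (gG (T (x k)) \<bullet> ((h k)\<^sup>2 *\<^sub>R t2 k) + (K * (norm (h k *\<^sub>R tp k))\<^sup>2 + K * (norm (h k *\<^sub>R tm k))\<^sup>2))"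
        by (simp add: b_def power_mult_distrib algebra_simps)
      also have "\<dots> = (CARD('n) + 2) * (ln (sf (xp k)) + ln (sf (xm k)) - 2 * ln (sf (x k)))
         - 2 * K * (norm (h k *\<^sub>R \<xi> k))\<^sup>2
         - (gG (T (x k)) \<bullet> (T (xp k) + T (xm k) - 2 *\<^sub>R T (x k))
            + (K * (norm (T (xp k) - T (x k)))\<^sup>2 + K * (norm (T (xm k) - T (x k)))\<^sup>2))"
        unfolding e ..
      also have "\<dots> \<le> ln (det (wm (xp k))) + ln (det (wm (xm k))) - 2 * ln (det (wm (x k)))"
        using F1 F2 G1 G2 unfolding equation[OF elim(1)] equation[OF elim(2)] equation[OF elim(3)]
        by (simp add: inner_diff_right inner_add_right algebra_simps)
      finally show ?case using hk by (simp add: pos_le_divide_eq mult.commute)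
    qed
  qed
  then show ?thesis unfolding xp_def xm_def by blast
qed

text \<open>No third derivative of \<open>u\<close> is left. In the \<open>let\<close> the name
  \<open>R\<close> denotes the sum of the inverse eigenvalues, not a radius; constants of the locale
  \<open>frame\<close> appear with explicit parameters because the frame is obtained only
  here.\<close>

lemma maximum_inequality:
  obtains f :: "'n \<Rightarrow> real^'n" and l where
    "eigenframe \<epsilon> (p x0) f (H x0) l \<xi>0 (\<kappa> x0)"
    "let s = sf x0; q = frame.q (p x0); R = (\<Sum>i\<in>UNIV. 1 / l i); n = real CARD('n); k = \<kappa> x0;
        t = q \<bullet> (H x0 *v \<xi>0); gF = gF x0; gG = gG (T x0) in
     0 \<le> - (1 / (\<epsilon> * s)) * k * ((k + 1) * R - n * (k + 1) - n + (\<Sum>i\<in>UNIV. l i))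
       + n * t\<^sup>2 + (\<Sum>i\<in>UNIV. (f i \<bullet> (\<kappa>2 x0 *v f i)) / l i) + (R - n) * (q \<bullet> \<kappa>1 x0)
       + k * (gF \<bullet> q) - 2 * t * (gF \<bullet> \<xi>0 - (k + 1) * (gG \<bullet> \<xi>0)) + 2 * K * (norm \<xi>0)\<^sup>2 * (1 + (k + 1)\<^sup>2)
       + gG \<bullet> (frame.Ainv \<epsilon> (p x0) (\<kappa>1 x0) - (k\<^sup>2 + k) *\<^sub>R q)"
proof -
  define q where "q = frame.q (p x0)"
  define a where "a = H x0 *v \<xi>0"
  define n where "n = real CARD('n)"
  obtain f :: "'n \<Rightarrow> real^'n" and l where fr:
    "\<And>i j. f i \<bullet> (cost_hess \<epsilon> (p x0) *v f j) = (if i = j then 1 else 0)"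
    "\<And>i j. f i \<bullet> (wm x0 *v f j) = (if i = j then l i else 0)" "\<And>i. 0 < l i"
    "0 \<le> (\<Sum>i\<in>UNIV. (Psi2 \<epsilon> (p x0) (H x0 *v \<xi>0) (D3 x0 \<xi>0 *v \<xi>0) (f i) ((a \<bullet> f i) *\<^sub>R q)
        + K2 x0 \<xi>0 (f i) ((a \<bullet> f i) *\<^sub>R q)) / l i)
       - ((CARD('n) + 2) * ls2 x0 \<xi>0 - 2 * K * (norm \<xi>0)\<^sup>2 - (gG (T x0) \<bullet> T2 x0 \<xi>0 + 2 * K * (norm (T1 x0 \<xi>0))\<^sup>2))
       + 2 * (q \<bullet> a)\<^sup>2"
    by (rule limit_inequality[OF w_pos ln_det_second_difference, of a q], assumption+) (rule that; assumption)
  \<comment> \<open>Its form is nonnegative and vanishes at \<open>\<xi>0\<close>, so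
    \<open>\<xi>0\<close> lies in its kernel: this is the eigenvector equation.\<close>
  define M where "M = H x0 + \<kappa> x0 *\<^sub>R cost_hess \<epsilon> (p x0)"
  have Mform: "v \<bullet> (M *v v) = v \<bullet> (H x0 *v v) + \<kappa> x0 * Psi \<epsilon> (p x0) v" for v
    by (simp add: M_def matrix_vector_mult_add_rdistrib scaleR_matrix_vector_assoc[symmetric] inner_add_right cost_hess_Psi)
  have Msym: "transpose M = M"
    using H_sym[OF x0] cost_hess_sym[of \<epsilon> "p x0"] by (simp add: M_def transpose_def vec_eq_iff)
  have "M *v \<xi>0 = 0"
    by (rule psd_zero_vector[OF Msym]) (use Q_nonneg[OF x0] Q_zero in \<open>simp_all add: Mform\<close>)
  then have H\<xi>: "H x0 *v \<xi>0 = (- \<kappa> x0) *\<^sub>R (cost_hess \<epsilon> (p x0) *v \<xi>0)"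
    by (simp add: M_def matrix_vector_mult_add_rdistrib scaleR_matrix_vector_assoc[symmetric] eq_neg_iff_add_eq_0)
  interpret E: eigenframe \<epsilon> "p x0" f "H x0" l \<xi>0 "\<kappa> x0"
    by standard (use eps p_less[OF x0] fr H_sym[OF x0] H\<xi> unit in \<open>auto simp: wm_def\<close>)
  have sE: "E.s = sf x0" by (simp add: E.s_def sf_def)
  have qE: "E.q = q" by (simp add: q_def)
  have aE: "E.a = a" by (simp add: E.a_def a_def)
  let ?A = "cost_hess \<epsilon> (p x0)"
  let ?k = "D3 x0 \<xi>0 *v \<xi>0"
  let ?\<kappa> = "\<kappa> x0"
  let ?\<gamma> = "gG (T x0)"
  \<comment> \<open>Gradient of \<open>\<phi> - \<gamma> \<circ> T\<close> at \<open>x0\<close>: the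
    derivative of \<open>T\<close> is the identity minus \<open>E.Ainv\<close> after
    \<open>H x0\<close>, and its transpose acts on \<open>gG (T x0)\<close>.\<close>
  define \<Phi> where "\<Phi> = gF x0 - ?\<gamma> + H x0 *v (E.Ainv ?\<gamma>)"
  have x0S: "x0 + 0 *\<^sub>R v \<in> S" for v using x0 by simp
  \<comment> \<open>First-order condition in \<open>x\<close> with the vector frozen at
    \<open>\<xi>0\<close>; symmetry of the third derivatives brings the direction \<open>v\<close>
    to the last place.\<close>
  have keq: "?k \<bullet> v = - (\<kappa>1 x0 \<bullet> v) - ?\<kappa> * Psi1 \<epsilon> (p x0) (H x0 *v v) \<xi>0 0" for v
  proof -
    obtain r where r: "r > 0" "\<And>t. \<bar>t\<bar> < r \<Longrightarrow> x0 + t *\<^sub>R v \<in> S" using line_in_S[OF x0] by blast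
    have dH1: "((\<lambda>t. \<xi>0 \<bullet> (H (x0 + t *\<^sub>R v) *v \<xi>0)) has_real_derivative \<xi>0 \<bullet> (D3 x0 v *v \<xi>0)) (at 0)"
      using DERIV_inner_vector[OF has_vector_derivative_const
          vector_derivative_along_line[OF matrix_vector_mult_has_derivative[OF dH'[OF x0S]]], of \<xi>0 v \<xi>0] by simp
    have dP: "((\<lambda>t. Psi \<epsilon> (p (x0 + t *\<^sub>R v)) \<xi>0) has_real_derivative Psi1 \<epsilon> (p x0) (H x0 *v v) \<xi>0 0) (at 0)"
      using line_Psi[OF x0S, of v \<xi>0 0] by simp
    have dk: "((\<lambda>t. \<kappa> (x0 + t *\<^sub>R v)) has_real_derivative \<kappa>1 x0 \<bullet> v) (at 0)" using line_\<kappa>[OF x0S, of v] by simp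
    have "((\<lambda>t. \<xi>0 \<bullet> (H (x0 + t *\<^sub>R v) *v \<xi>0) + \<kappa> (x0 + t *\<^sub>R v) * Psi \<epsilon> (p (x0 + t *\<^sub>R v)) \<xi>0) has_real_derivative
       \<xi>0 \<bullet> (D3 x0 v *v \<xi>0) + ((\<kappa>1 x0 \<bullet> v) * 1 + Psi1 \<epsilon> (p x0) (H x0 *v v) \<xi>0 0 * ?\<kappa>)) (at 0)"
      using DERIV_add[OF dH1 DERIV_mult[OF dk dP]] by (simp add: unit)
    from DERIV_local_min[OF this r(1)]
    have "\<xi>0 \<bullet> (D3 x0 v *v \<xi>0) + ((\<kappa>1 x0 \<bullet> v) * 1 + Psi1 \<epsilon> (p x0) (H x0 *v v) \<xi>0 0 * ?\<kappa>) = 0"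
      using Q_zero Q_nonneg r(2) by simp
    moreover have "\<xi>0 \<bullet> (D3 x0 v *v \<xi>0) = ?k \<bullet> v"
      using D3_sym_swap[OF x0, of v \<xi>0 \<xi>0] by (simp add: inner_commute)
    ultimately show ?thesis by (simp add: algebra_simps)
  qed
  have T1v: "T1 x0 v = v - E.Ainv (H x0 *v v)" for v
    using E.s_pos by (simp add: T1_def E.Ainv_def sE E.p_q[of "H x0 *v v"] algebra_simps power3_eq_cube power2_eq_square)
  have \<Phi>v: "\<Phi> \<bullet> v = gF x0 \<bullet> v - ?\<gamma> \<bullet> T1 x0 v" for v
    by (simp add: \<Phi>_def T1v inner_add_left inner_diff_left inner_diff_right E.H_inner E.Ainv_sym)
  have deq: "(\<Sum>i\<in>UNIV. ((D3 x0 (f i) *v f i) \<bullet> v) / l i) = (\<Sum>i\<in>UNIV. Psi1 \<epsilon> (p x0) (H x0 *v v) (f i) 0 / l i)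
        - (\<Phi> \<bullet> v - (CARD('n) + 2) * (p x0 \<bullet> (H x0 *v v)) / (1 - p x0 \<bullet> p x0))" for v
  proof -
    obtain r where r: "r > 0" "\<And>t. \<bar>t\<bar> < r \<Longrightarrow> x0 + t *\<^sub>R v \<in> S" using line_in_S[OF x0] by blast
    \<comment> \<open>\<open>J\<close> compares \<open>ln det w\<close> with its supporting linear function, so its derivative vanishes at 0;
      this replaces Jacobi's formula for the derivative of a determinant.\<close>
    define J where "J t = (\<Sum>i\<in>UNIV. (Psi \<epsilon> (p (x0 + t *\<^sub>R v)) (f i) - f i \<bullet> (H (x0 + t *\<^sub>R v) *v f i)) / l i)
        - ((CARD('n) + 2) * ln (sf (x0 + t *\<^sub>R v)) + c0 + \<phi> (x0 + t *\<^sub>R v) - \<gamma> (T (x0 + t *\<^sub>R v)))" for t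
    have Jeq: "J t = (\<Sum>i\<in>UNIV. f i \<bullet> (wm (x0 + t *\<^sub>R v) *v f i) / l i) - ln (det (wm (x0 + t *\<^sub>R v)))"
      if "\<bar>t\<bar> < r" for t
      unfolding J_def equation[OF r(2)[OF that]] wm_form cost_hess_Psi ..
    have "J 0 \<le> J t" if "\<bar>t\<bar> < r" for t
    proof -
      have "J 0 = CARD('n) - ln (det (wm x0))" using Jeq[of 0] r fr(3) by (simp add: fr less_imp_neq[symmetric])
      also have "\<dots> \<le> J t"
        using ln_det_concave[OF w_pos[OF x0] w_pos[OF r(2)[OF that]] fr(2,3)] by (simp add: Jeq[OF that])
      finally show ?thesis .
    qed
    moreover have dT: "((\<lambda>t. \<gamma> (T (x0 + t *\<^sub>R v))) has_real_derivative ?\<gamma> \<bullet> T1 x0 v) (at 0)"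
    proof -
      have "((\<lambda>t. T (x0 + t *\<^sub>R v)) has_vector_derivative T1 x0 v) (at 0)"
        unfolding has_vector_derivative_def
      proof (subst has_derivative_componentwise_within, intro ballI)
        fix b :: "real^'n"
        show "((\<lambda>t. T (x0 + t *\<^sub>R v) \<bullet> b) has_derivative (\<lambda>h. (h *\<^sub>R T1 x0 v) \<bullet> b)) (at 0)"
          using line_T[OF x0S, of v b] by (simp add: has_field_derivative_def mult.commute[of "T1 x0 v \<bullet> b"] mult_commute_abs)
      qed
      then have "((\<lambda>t. T (x0 + t *\<^sub>R v)) has_derivative (\<lambda>h. h *\<^sub>R T1 x0 v)) (at 0)"
        by (simp add: has_vector_derivative_def)
      from diff_chain_at[OF this, of \<gamma> "\<lambda>w. ?\<gamma> \<bullet> w"] d\<gamma>[OF T_in]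
      show ?thesis by (simp add: o_def has_field_derivative_def mult_commute_abs)
    qed
    have dJ: "(J has_real_derivative (\<Sum>i\<in>UNIV. (Psi1 \<epsilon> (p x0) (H x0 *v v) (f i) 0 - f i \<bullet> (D3 x0 v *v f i)) / l i)
        - ((CARD('n) + 2) * ls1 x0 v + 0 + gF x0 \<bullet> v - ?\<gamma> \<bullet> T1 x0 v)) (at 0)"
      unfolding J_def
    proof (intro DERIV_diff DERIV_add DERIV_sum DERIV_cdivide DERIV_cmult DERIV_const dT)
      fix i
      show "((\<lambda>t. Psi \<epsilon> (p (x0 + t *\<^sub>R v)) (f i)) has_real_derivative Psi1 \<epsilon> (p x0) (H x0 *v v) (f i) 0) (at 0)"
        using line_Psi[OF x0S, of v "f i" 0] by simp
      show "((\<lambda>t. f i \<bullet> (H (x0 + t *\<^sub>R v) *v f i)) has_real_derivative f i \<bullet> (D3 x0 v *v f i)) (at 0)"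
        using DERIV_inner_vector[OF has_vector_derivative_const
          vector_derivative_along_line[OF matrix_vector_mult_has_derivative[OF dH'[OF x0S]]], of "f i" v "f i"] by simp
      show "((\<lambda>t. ln (sf (x0 + t *\<^sub>R v))) has_real_derivative ls1 x0 v) (at 0)" using line_ln[OF x0S, of v] by simp
      show "((\<lambda>t. \<phi> (x0 + t *\<^sub>R v)) has_real_derivative gF x0 \<bullet> v) (at 0)"
        using DERIV_along_line[OF d\<phi>[OF x0S]] by simp
    qed
    ultimately have "(\<Sum>i\<in>UNIV. (Psi1 \<epsilon> (p x0) (H x0 *v v) (f i) 0 - f i \<bullet> (D3 x0 v *v f i)) / l i)
        - ((CARD('n) + 2) * ls1 x0 v + 0 + gF x0 \<bullet> v - ?\<gamma> \<bullet> T1 x0 v) = 0"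
      by (intro DERIV_local_min[OF dJ r(1)]) auto
    moreover have "f i \<bullet> (D3 x0 v *v f i) = (D3 x0 (f i) *v f i) \<bullet> v" for i
      using D3_sym_swap[OF x0, of v "f i" "f i"] by (simp add: inner_commute)
    moreover have "ls1 x0 v = - (p x0 \<bullet> (H x0 *v v)) / (1 - p x0 \<bullet> p x0)"
      by (simp add: ls1_def sf_sq[OF x0])
    ultimately show ?thesis unfolding \<Phi>v by (simp add: diff_divide_distrib sum_subtractf algebra_simps)
  qed
  have s2: "(sf x0)\<^sup>2 = 1 - p x0 \<bullet> p x0" and s0: "sf x0 > 0" using sf_sq sf_pos x0 by auto
  have pa: "p x0 \<bullet> a = (sf x0)\<^sup>2 * (q \<bullet> a)" "p x0 \<bullet> ?k = (sf x0)\<^sup>2 * (q \<bullet> ?k)"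
    using E.p_q by (simp_all add: sE qE)
  have ls2: "ls2 x0 \<xi>0 = - (a \<bullet> a + p x0 \<bullet> ?k) / (sf x0)\<^sup>2 - 2 * (q \<bullet> a)\<^sup>2"
    using s0 by (simp add: ls2_def a_def[symmetric] pa(1) power_mult_distrib power4_eq_xxxx power2_eq_square)
  have id: "(\<Sum>i\<in>UNIV. (Psi2 \<epsilon> (p x0) (H x0 *v \<xi>0) ?k (f i) ((a \<bullet> f i) *\<^sub>R q)
        + K2 x0 \<xi>0 (f i) ((a \<bullet> f i) *\<^sub>R q)) / l i) + 2 * (q \<bullet> a)\<^sup>2 - (CARD('n) + 2) * ls2 x0 \<xi>0
    = - (1 / (\<epsilon> * sf x0)) * ?\<kappa> * ((?\<kappa> + 1) * (\<Sum>i\<in>UNIV. 1 / l i) - CARD('n) * (?\<kappa> + 1) - CARD('n) + (\<Sum>i\<in>UNIV. l i))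
     + CARD('n) * (q \<bullet> a)\<^sup>2 + (\<Sum>i\<in>UNIV. (f i \<bullet> (\<kappa>2 x0 *v f i)) / l i) + ((\<Sum>i\<in>UNIV. 1 / l i) - CARD('n)) * (q \<bullet> \<kappa>1 x0)
     + ?\<kappa> * (q \<bullet> \<Phi>) - 2 * (q \<bullet> a) * (\<xi>0 \<bullet> \<Phi>)"
    using E.curvature_identity[OF keq deq, of "\<lambda>i. f i \<bullet> (\<kappa>2 x0 *v f i)"]
    unfolding aE qE sE ls2 K2_def unit a_def[symmetric] by simp
  have Aa: "E.Ainv a = (- ?\<kappa>) *\<^sub>R \<xi>0"
    by (simp add: a_def H\<xi> E.Ainv_linear(2) E.Ainv_A del: scaleR_minus_left)
  \<comment> \<open>The derivative of \<open>T\<close> is the inverse of \<open>A\<close> times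
    \<open>w\<close>, so it stretches the eigenvector \<open>\<xi>0\<close> by its
    eigenvalue.\<close>
  have T1\<xi>: "T1 x0 \<xi>0 = (?\<kappa> + 1) *\<^sub>R \<xi>0"
    by (simp add: T1v a_def[symmetric] Aa algebra_simps)
  \<comment> \<open>The first-order condition in vector form, to be inserted into \<open>T2\<close>,
    where \<open>?k\<close> occurs under \<open>E.Ainv\<close>.\<close>
  have kvec: "?k = - \<kappa>1 x0 + ?\<kappa> *\<^sub>R (H x0 *v q) - (2 * (q \<bullet> a)) *\<^sub>R a"
  proof -
    have "?k \<bullet> v = (- \<kappa>1 x0 + ?\<kappa> *\<^sub>R (H x0 *v q) - (2 * (q \<bullet> a)) *\<^sub>R a) \<bullet> v" for v
    proof -
      have x: "?\<kappa> * (sf x0 / \<epsilon> * (p x0 \<bullet> \<xi>0)) = - (q \<bullet> a)"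
      proof -
        have "q \<bullet> a = (- ?\<kappa>) * (q \<bullet> (?A *v \<xi>0))" by (simp add: a_def H\<xi>)
        also have "q \<bullet> (?A *v \<xi>0) = sf x0 / \<epsilon> * (p x0 \<bullet> \<xi>0)"
          using E.A_q_inner(2)[of \<xi>0] by (simp add: E.A_sym qE sE)
        finally show ?thesis by simp
      qed
      have P1: "Psi1 \<epsilon> (p x0) (H x0 *v v) \<xi>0 0 = - (q \<bullet> (H x0 *v v)) - 2 * ((H x0 *v v) \<bullet> \<xi>0) * (sf x0 / \<epsilon> * (p x0 \<bullet> \<xi>0))"
        using Psi1_zero[OF eps p_less[OF x0] unit E.q_def E.s_def] by (simp only: qE sE)
      have sw: "q \<bullet> (H x0 *v v) = (H x0 *v q) \<bullet> v" "(H x0 *v v) \<bullet> \<xi>0 = a \<bullet> v"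
        by (simp_all add: E.H_inner a_def inner_commute[of v])
      have "?k \<bullet> v = - (\<kappa>1 x0 \<bullet> v) + ?\<kappa> * ((H x0 *v q) \<bullet> v) + 2 * (a \<bullet> v) * (?\<kappa> * (sf x0 / \<epsilon> * (p x0 \<bullet> \<xi>0)))"
        unfolding keq P1 sw by (simp add: algebra_simps)
      then show ?thesis unfolding x by (simp add: inner_diff_left inner_add_left)
    qed
    then show ?thesis by (metis vector_eq_rdot)
  qed
  have na: "a \<bullet> a / (sf x0)\<^sup>2 + (q \<bullet> a)\<^sup>2 = 1 / (\<epsilon> * sf x0) * ?\<kappa>\<^sup>2"
    using E.dual_norm[of a] E.a_sum by (simp add: sE qE aE)
  have pq: "p x0 = (sf x0)\<^sup>2 *\<^sub>R q" using s0 by (simp add: q_def E.q_def s2[symmetric])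
  have T2\<xi>: "T2 x0 \<xi>0 = E.Ainv (\<kappa>1 x0) - ?\<kappa> *\<^sub>R E.Ainv (H x0 *v q) - ?\<kappa>\<^sup>2 *\<^sub>R q"
  proof -
    have c1: "2 * (p x0 \<bullet> a) / sf x0 ^ 3 = 2 * (q \<bullet> a) / sf x0"
      using s0 by (simp add: pa power3_eq_cube power2_eq_square)
    have c2: "(a \<bullet> a + p x0 \<bullet> ?k) / sf x0 ^ 3 + 3 * (p x0 \<bullet> a)\<^sup>2 / sf x0 ^ 5
       = (1 / (\<epsilon> * sf x0) * ?\<kappa>\<^sup>2 + q \<bullet> ?k + 2 * (q \<bullet> a)\<^sup>2) / sf x0"
      unfolding na[symmetric] pa using s0 by (simp add: field_simps eval_nat_numeral)
    have "T2 x0 \<xi>0 = - \<epsilon> *\<^sub>R ((1 / sf x0) *\<^sub>R ?k + (2 * (q \<bullet> a) / sf x0) *\<^sub>R a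
       + ((1 / (\<epsilon> * sf x0) * ?\<kappa>\<^sup>2 + q \<bullet> ?k + 2 * (q \<bullet> a)\<^sup>2) / sf x0) *\<^sub>R p x0)"
      unfolding T2_def a_def[symmetric] c1 c2 ..
    also have "\<dots> = - (\<epsilon> / sf x0) *\<^sub>R (?k + (q \<bullet> ?k) *\<^sub>R p x0)
       - (2 * (q \<bullet> a)) *\<^sub>R ((\<epsilon> / sf x0) *\<^sub>R (a + (q \<bullet> a) *\<^sub>R p x0)) - (?\<kappa>\<^sup>2 / (sf x0)\<^sup>2) *\<^sub>R p x0"
      using eps s0 by (simp add: algebra_simps add_divide_distrib power2_eq_square)
    also have "(?\<kappa>\<^sup>2 / (sf x0)\<^sup>2) *\<^sub>R p x0 = ?\<kappa>\<^sup>2 *\<^sub>R q" using s0 by (subst pq) simp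
    also have "(\<epsilon> / sf x0) *\<^sub>R (a + (q \<bullet> a) *\<^sub>R p x0) = E.Ainv a" by (simp add: E.Ainv_def sE qE)
    also have "- (\<epsilon> / sf x0) *\<^sub>R (?k + (q \<bullet> ?k) *\<^sub>R p x0) = - E.Ainv ?k" by (simp add: E.Ainv_def sE qE)
    finally have "T2 x0 \<xi>0 = - E.Ainv ?k - (2 * (q \<bullet> a)) *\<^sub>R E.Ainv a - ?\<kappa>\<^sup>2 *\<^sub>R q" .
    moreover have "E.Ainv ?k = - E.Ainv (\<kappa>1 x0) + ?\<kappa> *\<^sub>R E.Ainv (H x0 *v q) - (2 * (q \<bullet> a)) *\<^sub>R E.Ainv a"
    proof -
      have neg: "E.Ainv (- \<kappa>1 x0) = - E.Ainv (\<kappa>1 x0)" using E.Ainv_linear(2)[of "-1" "\<kappa>1 x0"] by simp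
      show ?thesis by (subst kvec) (simp only: E.Ainv_linear neg)
    qed
    ultimately show ?thesis by simp
  qed
  \<comment> \<open>The term with \<open>E.Ainv (H x0 *v q)\<close> cancels against the one in
    \<open>T2\<xi>\<close>; only \<open>- (\<kappa>\<^sup>2 + \<kappa>)\<close> times
    \<open>q\<close> remains paired with \<open>gG\<close>.\<close>
  have q\<Phi>: "q \<bullet> \<Phi> = gF x0 \<bullet> q - ?\<gamma> \<bullet> (q - E.Ainv (H x0 *v q))" and \<xi>\<Phi>: "\<xi>0 \<bullet> \<Phi> = gF x0 \<bullet> \<xi>0 - (?\<kappa> + 1) * (?\<gamma> \<bullet> \<xi>0)"
    using \<Phi>v[of q] \<Phi>v[of \<xi>0] by (simp_all add: inner_commute[of _ \<Phi>] T1v[of q] T1\<xi>)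
  have "0 \<le> - (1 / (\<epsilon> * sf x0)) * ?\<kappa> * ((?\<kappa> + 1) * (\<Sum>i\<in>UNIV. 1 / l i) - n * (?\<kappa> + 1) - n + (\<Sum>i\<in>UNIV. l i))
     + n * (q \<bullet> a)\<^sup>2 + (\<Sum>i\<in>UNIV. (f i \<bullet> (\<kappa>2 x0 *v f i)) / l i) + ((\<Sum>i\<in>UNIV. 1 / l i) - n) * (q \<bullet> \<kappa>1 x0)
     + ?\<kappa> * (q \<bullet> \<Phi>) - 2 * (q \<bullet> a) * (\<xi>0 \<bullet> \<Phi>) + 2 * K * (norm \<xi>0)\<^sup>2
     + (?\<gamma> \<bullet> T2 x0 \<xi>0 + 2 * K * (norm (T1 x0 \<xi>0))\<^sup>2)"
    using fr(4) id unfolding n_def by linarith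
  also have "(norm (T1 x0 \<xi>0))\<^sup>2 = (?\<kappa> + 1)\<^sup>2 * (norm \<xi>0)\<^sup>2"
    by (simp add: T1\<xi> power_mult_distrib)
  finally have "0 \<le> - (1 / (\<epsilon> * sf x0)) * ?\<kappa> * ((?\<kappa> + 1) * (\<Sum>i\<in>UNIV. 1 / l i) - n * (?\<kappa> + 1) - n + (\<Sum>i\<in>UNIV. l i))
     + n * (q \<bullet> a)\<^sup>2 + (\<Sum>i\<in>UNIV. (f i \<bullet> (\<kappa>2 x0 *v f i)) / l i) + ((\<Sum>i\<in>UNIV. 1 / l i) - n) * (q \<bullet> \<kappa>1 x0)
     + ?\<kappa> * (gF x0 \<bullet> q) - 2 * (q \<bullet> a) * (gF x0 \<bullet> \<xi>0 - (?\<kappa> + 1) * (?\<gamma> \<bullet> \<xi>0)) + 2 * K * (norm \<xi>0)\<^sup>2 * (1 + (?\<kappa> + 1)\<^sup>2)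
     + ?\<gamma> \<bullet> (E.Ainv (\<kappa>1 x0) - (?\<kappa>\<^sup>2 + ?\<kappa>) *\<^sub>R q)"
    unfolding T2\<xi> q\<Phi> \<xi>\<Phi> by (simp add: inner_diff_right inner_add_right algebra_simps)
  then show thesis
    by (intro that[OF E.eigenframe_axioms]) (simp add: Let_def q_def a_def n_def)
qed

end

section \<open>The estimate\<close>

text \<open>\<open>A1\<close> to \<open>A6\<close> are the error terms of
  \<open>maximum_inequality\<close> in their order, all bounded by multiples of \<mu>, which divides
  out. With \<open>\<Lambda> = k + 1\<close>, errors of order \<open>\<Lambda>\<^sup>2\<close> are
  absorbed by the curvature term of order \<open>\<Lambda>\<^sup>2 r\<close> for large
  \<open>r\<close>, and those of order \<open>\<Lambda> r / \<rho>\<^sup>2\<close> give the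
  bound.\<close>

lemma scalar_bound:
  fixes \<mu> k r n L C1 K R \<rho> :: real
  assumes \<mu>: "0 < \<mu>" and k: "1 \<le> k" and n: "1 \<le> n" and \<sigma>: "0 \<le> \<sigma>"
    and L: "0 \<le> L" and C1: "0 \<le> C1" and K: "0 \<le> K" and R: "0 < R" and \<rho>: "0 < \<rho>" "\<rho> \<le> R\<^sup>2"
    and r: "4 * (2 * n + (7 * C1 * L + 4 * K * L\<^sup>2)) \<le> r"
    and ineq: "0 \<le> - \<mu> * k * ((k + 1) * r - n * (k + 1) - n + \<sigma>) + n * t\<^sup>2 + A1 + (r - n) * A2 + A3 - 2 * A4 + A5 + A6"
    and t: "t\<^sup>2 \<le> k\<^sup>2 * \<mu>"
    and A1: "A1 \<le> (k + 1) * (28 * R\<^sup>2 / \<rho>\<^sup>2) * L\<^sup>2 * \<mu> * r"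
    and A2: "\<bar>A2\<bar> \<le> (k + 1) * (4 * R / \<rho>) * L * \<mu>"
    and A3: "A3 \<le> k * C1 * L * \<mu>"
    and A4: "\<bar>A4\<bar> \<le> k * (k + 2) * C1 * L * \<mu>"
    and A5: "A5 \<le> 2 * K * L\<^sup>2 * \<mu> * (1 + (k + 1)\<^sup>2)"
    and A6: "A6 \<le> C1 * (L\<^sup>2 * \<mu> * ((k + 1) * (4 * R / \<rho>)) + (k\<^sup>2 + k) * L * \<mu>)"
  shows "(k + 1) * \<rho>\<^sup>2 \<le> 4 * (28 * R\<^sup>2 * L\<^sup>2 + (2 * L + C1 * L\<^sup>2) * (4 * R ^ 3))"
proof -
  define b where "b = 28 * R\<^sup>2 / \<rho>\<^sup>2"
  define b1 where "b1 = 4 * R / \<rho>"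
  define \<Lambda> where "\<Lambda> = k + 1"
  \<comment> \<open>The 7 is 1 + 4 + 2, from \<open>A3\<close>, from twice \<open>A4\<close> and
    from the part of \<open>A6\<close> with \<open>q\<close>; the 4 comes from \<open>A5\<close>
    with \<open>1 + \<Lambda>\<^sup>2 \<le> 2 * \<Lambda>\<^sup>2\<close>.\<close>
  define P where "P = 7 * C1 * L + 4 * K * L\<^sup>2"
  define B where "B = 28 * R\<^sup>2 * L\<^sup>2 + (2 * L + C1 * L\<^sup>2) * (4 * R ^ 3)"
  have P0: "0 \<le> P" unfolding P_def using C1 L K by simp
  have "8 * n + 4 * P \<le> r" using r unfolding P_def by (simp add: algebra_simps)
  then have r8: "8 * n \<le> r" using P0 by simp
  have r0: "8 * n \<le> r" "1 \<le> r" using r8 n by auto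
  have b0: "0 \<le> b" "0 \<le> b1" using R \<rho> by (auto simp: b_def b1_def)
  have \<Lambda>: "2 \<le> \<Lambda>" using k by (simp add: \<Lambda>_def)
  have A2': "(r - n) * A2 \<le> r * (\<Lambda> * b1 * L * \<mu>)"
  proof -
    have "(r - n) * A2 \<le> (r - n) * \<bar>A2\<bar>" using r0 n by (intro mult_left_mono) auto
    also have "\<dots> \<le> r * (\<Lambda> * b1 * L * \<mu>)" using A2 r0 n by (intro mult_mono) (auto simp: \<Lambda>_def b1_def)
    finally show ?thesis .
  qed
  have "\<mu> * (k * (\<Lambda> * r - n * \<Lambda> - n + \<sigma>)) \<le> n * (k\<^sup>2 * \<mu>) + \<Lambda> * b * L\<^sup>2 * \<mu> * r + r * (\<Lambda> * b1 * L * \<mu>) + k * C1 * L * \<mu>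
     + 2 * (k * (k + 2) * C1 * L * \<mu>) + 2 * K * L\<^sup>2 * \<mu> * (1 + \<Lambda>\<^sup>2) + C1 * (L\<^sup>2 * \<mu> * (\<Lambda> * b1) + (k\<^sup>2 + k) * L * \<mu>)"
  proof -
    have "n * t\<^sup>2 \<le> n * (k\<^sup>2 * \<mu>)" using t n by (intro mult_left_mono) auto
    moreover have "- A4 \<le> k * (k + 2) * C1 * L * \<mu>" using A4 by linarith
    ultimately show ?thesis
      using ineq A1 A2' A3 A5 A6 unfolding \<Lambda>_def[symmetric] b_def[symmetric] b1_def[symmetric]
      by (simp add: mult.assoc)
  qed
  also have "\<dots> = \<mu> * (n * k\<^sup>2 + \<Lambda> * b * L\<^sup>2 * r + r * (\<Lambda> * b1 * L) + k * C1 * L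
     + 2 * (k * (k + 2) * C1 * L) + 2 * K * L\<^sup>2 * (1 + \<Lambda>\<^sup>2) + C1 * (L\<^sup>2 * (\<Lambda> * b1) + (k\<^sup>2 + k) * L))"
    by (simp add: algebra_simps)
  finally have main: "k * (\<Lambda> * r - n * \<Lambda> - n + \<sigma>) \<le> n * k\<^sup>2 + \<Lambda> * b * L\<^sup>2 * r + r * (\<Lambda> * b1 * L) + k * C1 * L
     + 2 * (k * (k + 2) * C1 * L) + 2 * K * L\<^sup>2 * (1 + \<Lambda>\<^sup>2) + C1 * (L\<^sup>2 * (\<Lambda> * b1) + (k\<^sup>2 + k) * L)"
    using \<mu> by (simp only: mult_le_cancel_left_pos)
  \<comment> \<open>Half of the leading coefficient is given away by
    \<open>k \<ge> \<Lambda> / 2\<close>, which is where \<open>k \<ge> 1\<close> enters.\<close>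
  have "\<Lambda>\<^sup>2 * (r / 2 - n) = (\<Lambda> / 2) * (\<Lambda> * r - 2 * n * \<Lambda>)" by (simp add: field_simps power2_eq_square)
  also have "\<dots> \<le> k * (\<Lambda> * r - n * \<Lambda> - n + \<sigma>)"
  proof (rule mult_mono)
    show "\<Lambda> / 2 \<le> k" using k by (simp add: \<Lambda>_def)
    have "n * 1 \<le> n * \<Lambda>" using n \<Lambda> by (intro mult_left_mono) auto
    moreover have "2 * n * \<Lambda> = n * \<Lambda> + n * \<Lambda>" by simp
    ultimately show "\<Lambda> * r - 2 * n * \<Lambda> \<le> \<Lambda> * r - n * \<Lambda> - n + \<sigma>" using \<sigma> by linarith
    have "\<Lambda> * (2 * n) \<le> \<Lambda> * r" using \<Lambda> r0 n by (intro mult_left_mono) auto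
    then show "0 \<le> \<Lambda> * r - 2 * n * \<Lambda>" by (simp add: mult_ac)
  qed (use k in auto)
  also note main
  also have "n * k\<^sup>2 + \<Lambda> * b * L\<^sup>2 * r + r * (\<Lambda> * b1 * L) + k * C1 * L
     + 2 * (k * (k + 2) * C1 * L) + 2 * K * L\<^sup>2 * (1 + \<Lambda>\<^sup>2) + C1 * (L\<^sup>2 * (\<Lambda> * b1) + (k\<^sup>2 + k) * L)
     \<le> n * \<Lambda>\<^sup>2 + \<Lambda> * b * L\<^sup>2 * r + r * (\<Lambda> * b1 * (2 * L)) + \<Lambda>\<^sup>2 * (C1 * L) + 2 * ((2 * \<Lambda>\<^sup>2) * (C1 * L))
       + 2 * K * L\<^sup>2 * (2 * \<Lambda>\<^sup>2) + (C1 * L\<^sup>2 * (\<Lambda> * b1) * r + (2 * \<Lambda>\<^sup>2) * (C1 * L))"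
  proof -
    have k2: "k\<^sup>2 \<le> \<Lambda>\<^sup>2" "k \<le> \<Lambda>\<^sup>2" "k * (k + 2) \<le> 2 * \<Lambda>\<^sup>2" "1 + \<Lambda>\<^sup>2 \<le> 2 * \<Lambda>\<^sup>2" "k\<^sup>2 + k \<le> 2 * \<Lambda>\<^sup>2"
      using k by (simp_all add: \<Lambda>_def power2_eq_square algebra_simps)
    have CL: "0 \<le> C1 * L" using C1 L by simp
    have i1: "n * k\<^sup>2 \<le> n * \<Lambda>\<^sup>2" using k2 n by (intro mult_left_mono) auto
    have i2: "r * (\<Lambda> * b1 * L) \<le> r * (\<Lambda> * b1 * (2 * L))" using r0 \<Lambda> b0 L by (intro mult_left_mono) auto
    have i3: "k * (C1 * L) \<le> \<Lambda>\<^sup>2 * (C1 * L)" using k2 CL by (intro mult_right_mono) auto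
    have i4: "k * (k + 2) * (C1 * L) \<le> (2 * \<Lambda>\<^sup>2) * (C1 * L)" using k2 CL by (intro mult_right_mono) auto
    have i5: "2 * K * L\<^sup>2 * (1 + \<Lambda>\<^sup>2) \<le> 2 * K * L\<^sup>2 * (2 * \<Lambda>\<^sup>2)" using k2 K by (intro mult_left_mono) auto
    have i6: "C1 * L\<^sup>2 * (\<Lambda> * b1) * 1 \<le> C1 * L\<^sup>2 * (\<Lambda> * b1) * r" using r0 C1 \<Lambda> b0 by (intro mult_left_mono) auto
    have i7: "(k\<^sup>2 + k) * (C1 * L) \<le> (2 * \<Lambda>\<^sup>2) * (C1 * L)" using k2 CL by (intro mult_right_mono) auto
    have e: "k * C1 * L = k * (C1 * L)" "k * (k + 2) * C1 * L = k * (k + 2) * (C1 * L)"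
      "C1 * (L\<^sup>2 * (\<Lambda> * b1) + (k\<^sup>2 + k) * L) = C1 * L\<^sup>2 * (\<Lambda> * b1) * 1 + (k\<^sup>2 + k) * (C1 * L)"
      by (simp_all add: algebra_simps)
    show ?thesis unfolding e using i1 i2 i3 i4 i5 i6 i7 by linarith
  qed
  also have "\<dots> = n * \<Lambda>\<^sup>2 + \<Lambda> * r * (b * L\<^sup>2 + b1 * (2 * L + C1 * L\<^sup>2)) + \<Lambda>\<^sup>2 * P"
    by (simp add: P_def algebra_simps)
  finally have "\<Lambda>\<^sup>2 * (r / 2 - 2 * n - P) \<le> \<Lambda> * r * (b * L\<^sup>2 + b1 * (2 * L + C1 * L\<^sup>2))"
    by (simp add: algebra_simps)
  \<comment> \<open>Exactly the threshold \<open>4 * (2 * n + P) \<le> r\<close>.\<close>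
  moreover have "\<Lambda>\<^sup>2 * (r / 4) \<le> \<Lambda>\<^sup>2 * (r / 2 - 2 * n - P)"
    using r unfolding P_def[symmetric] by (intro mult_left_mono) auto
  moreover have "b * L\<^sup>2 + b1 * (2 * L + C1 * L\<^sup>2) \<le> B / \<rho>\<^sup>2"
  proof -
    \<comment> \<open>The gradient of the cutoff contributes only \<open>1 / \<rho>\<close>;
      \<open>\<rho> \<le> R\<^sup>2\<close> brings it to the scale \<open>1 / \<rho>\<^sup>2\<close>
      of the Hessian term.\<close>
    have "b1 \<le> 4 * R ^ 3 / \<rho>\<^sup>2"
    proof -
      have "b1 = 4 * R * \<rho> / \<rho>\<^sup>2" using \<rho> by (simp add: b1_def power2_eq_square)
      also have "\<dots> \<le> 4 * R * R\<^sup>2 / \<rho>\<^sup>2" using \<rho> R by (intro divide_right_mono mult_left_mono) auto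
      finally show ?thesis by (simp add: power3_eq_cube power2_eq_square)
    qed
    then have "b1 * (2 * L + C1 * L\<^sup>2) \<le> 4 * R ^ 3 / \<rho>\<^sup>2 * (2 * L + C1 * L\<^sup>2)"
      using L C1 by (intro mult_right_mono) auto
    then show ?thesis by (simp add: b_def B_def add_divide_distrib mult_ac)
  qed
  then have "\<Lambda> * r * (b * L\<^sup>2 + b1 * (2 * L + C1 * L\<^sup>2)) \<le> \<Lambda> * r * (B / \<rho>\<^sup>2)"
    using \<Lambda> r0 by (intro mult_left_mono) auto
  ultimately have "\<Lambda>\<^sup>2 * (r / 4) \<le> \<Lambda> * r * (B / \<rho>\<^sup>2)" by linarith
  moreover have "\<Lambda>\<^sup>2 * (r / 4) = (\<Lambda> * r) * (\<Lambda> / 4)" by (simp add: power2_eq_square)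
  ultimately have "(\<Lambda> * r) * (\<Lambda> / 4) \<le> (\<Lambda> * r) * (B / \<rho>\<^sup>2)" by (simp only:)
  moreover have "0 < \<Lambda> * r" using \<Lambda> r0 by simp
  ultimately have "\<Lambda> / 4 \<le> B / \<rho>\<^sup>2" by (simp only: mult_le_cancel_left_pos)
  then show ?thesis using \<rho> by (simp add: \<Lambda>_def B_def field_simps)
qed

section \<open>Bounds for the data and for the eigenvalues\<close>

text \<open>A gradient bound makes \<open>f\<close> Lipschitz only along segments inside the set, so
  the Lipschitz bound for the logarithmic gradient is stated on convex subsets. Its constant is
  nevertheless the same for all of them.\<close>

lemma C11_log_gradient:
  fixes f :: "real^'n \<Rightarrow> real"
  assumes S: "open S" and f: "C11_on S f" and m: "0 < m" "\<And>x. x \<in> S \<Longrightarrow> m \<le> f x"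
  obtains C K where "0 \<le> C" "0 \<le> K"
    "\<And>x. x \<in> S \<Longrightarrow> ((\<lambda>x. ln (f x)) has_derivative (\<lambda>v. ((1 / f x) *\<^sub>R grad f x) \<bullet> v)) (at x)"
    "\<And>x. x \<in> S \<Longrightarrow> norm ((1 / f x) *\<^sub>R grad f x) \<le> C"
    "\<And>U x y. convex U \<Longrightarrow> U \<subseteq> S \<Longrightarrow> x \<in> U \<Longrightarrow> y \<in> U \<Longrightarrow>
       norm ((1 / f x) *\<^sub>R grad f x - (1 / f y) *\<^sub>R grad f y) \<le> K * norm (x - y)"
proof -
  have "\<exists>B. \<forall>x\<in>S. \<bar>partial i f x\<bar> \<le> B" for i
    using f unfolding C11_on_def bounded_iff by auto
  then obtain b where b: "\<And>i x. x \<in> S \<Longrightarrow> \<bar>partial i f x\<bar> \<le> b i" by metis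
  have "\<exists>k. k-lipschitz_on S (partial i f)" for i using f unfolding C11_on_def by auto
  then obtain k where k: "\<And>i. (k i)-lipschitz_on S (partial i f)" by metis
  define B where "B = (\<Sum>i\<in>UNIV. \<bar>b i\<bar>)"
  define M where "M = (\<Sum>i\<in>UNIV. k i)"
  have B0: "0 \<le> B" by (simp add: B_def sum_nonneg)
  have M0: "0 \<le> M" unfolding M_def by (intro sum_nonneg lipschitz_on_nonneg[OF k])
  have gB: "norm (grad f x) \<le> B" if "x \<in> S" for x
  proof -
    have "norm (grad f x) \<le> (\<Sum>i\<in>UNIV. \<bar>grad f x $ i\<bar>)" by (rule norm_le_l1_cart)
    also have "\<dots> \<le> B" unfolding B_def grad_def
      using b[OF that] by (intro sum_mono) (auto intro: order_trans[OF _ abs_ge_self])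
    finally show ?thesis .
  qed
  have gM: "norm (grad f x - grad f y) \<le> M * norm (x - y)" if "x \<in> S" "y \<in> S" for x y
  proof -
    have "norm (grad f x - grad f y) \<le> (\<Sum>i\<in>UNIV. \<bar>(grad f x - grad f y) $ i\<bar>)" by (rule norm_le_l1_cart)
    also have "\<dots> \<le> (\<Sum>i\<in>UNIV. k i * norm (x - y))" unfolding grad_def
      using lipschitz_onD[OF k that] by (intro sum_mono) (simp add: dist_norm)
    finally show ?thesis by (simp add: M_def sum_distrib_right)
  qed
  have df: "(f has_derivative (\<lambda>v. grad f x \<bullet> v)) (at x)" if "x \<in> S" for x
  proof -
    have "f differentiable (at x)" using f that by (simp add: C11_on_def)
    from differentiable_partial[OF this] show ?thesis by (simp add: grad_def inner_vec_def mult.commute)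
  qed
  have f0: "0 < f x" if "x \<in> S" for x using m that by (meson less_le_trans)
  define C where "C = B / m"
  \<comment> \<open>The first summand is the variation of the gradient, the second that of
    \<open>1 / f\<close>, whose difference is at most that of \<open>f\<close> over
    \<open>m * m\<close>.\<close>
  define K where "K = M / m + B * B / (m * m)"
  show thesis
  proof (rule that[of C K])
    show "0 \<le> C" "0 \<le> K" using B0 M0 m by (auto simp: C_def K_def)
  next
    fix x assume x: "x \<in> S"
    have "((\<lambda>x. ln (f x)) has_derivative (\<lambda>v. (grad f x \<bullet> v) * (1 / f x))) (at x)"
      using has_derivative_ln[OF f0[OF x] df[OF x]] by (simp add: divide_inverse)
    then show "((\<lambda>x. ln (f x)) has_derivative (\<lambda>v. ((1 / f x) *\<^sub>R grad f x) \<bullet> v)) (at x)"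
      by (simp add: mult.commute)
    have "norm (grad f x) / f x \<le> B / m"
      using gB[OF x] m x f0[OF x] B0 by (intro frac_le) auto
    then show "norm ((1 / f x) *\<^sub>R grad f x) \<le> C" using f0[OF x] by (simp add: C_def)
  next
    fix U x y assume U: "convex U" "U \<subseteq> S" and xy: "x \<in> U" "y \<in> U"
    have xyS: "x \<in> S" "y \<in> S" using U xy by auto
    note fx = f0[OF xyS(1)] and fy = f0[OF xyS(2)]
    have "norm (f x - f y) \<le> B * norm (x - y)"
    proof (rule differentiable_bound[OF U(1) _ _ xy(1) xy(2)])
      fix z assume z: "z \<in> U"
      then have zS: "z \<in> S" using U by auto
      show "(f has_derivative (\<lambda>v. grad f z \<bullet> v)) (at z within U)" by (rule has_derivative_at_withinI[OF df[OF zS]])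
      show "onorm (\<lambda>v. grad f z \<bullet> v) \<le> B"
      proof (rule onorm_bound[OF B0])
        fix v
        have "norm (grad f z \<bullet> v) \<le> norm (grad f z) * norm v" using Cauchy_Schwarz_ineq2 by simp
        also have "\<dots> \<le> B * norm v" using gB[OF zS] by (rule mult_right_mono) simp
        finally show "norm (grad f z \<bullet> v) \<le> B * norm v" .
      qed
    qed
    then have fd: "\<bar>f x - f y\<bar> \<le> B * norm (x - y)" by simp
    have quot: "(f y - f x) / (f x * f y) = 1 / f x - 1 / f y" using fx fy by (simp add: field_simps)
    have "(1 / f x) *\<^sub>R grad f x - (1 / f y) *\<^sub>R grad f y
       = (1 / f x) *\<^sub>R (grad f x - grad f y) + ((f y - f x) / (f x * f y)) *\<^sub>R grad f y"
      unfolding quot by (simp add: scaleR_diff_right scaleR_diff_left)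
    also have "norm \<dots> \<le> norm (grad f x - grad f y) / f x + \<bar>f x - f y\<bar> / (f x * f y) * norm (grad f y)"
      using fx fy by (intro order_trans[OF norm_triangle_ineq]) (simp add: abs_mult abs_minus_commute)
    also have "\<dots> \<le> M * norm (x - y) / m + B * norm (x - y) / (m * m) * B"
      using gM[OF xyS] fd gB[OF xyS(2)] m xyS fx fy M0 B0
      by (intro add_mono mult_mono frac_le) (auto intro!: mult_mono)
    also have "\<dots> = K * norm (x - y)" by (simp add: K_def algebra_simps add_divide_distrib)
    finally show "norm ((1 / f x) *\<^sub>R grad f x - (1 / f y) *\<^sub>R grad f y) \<le> K * norm (x - y)" .
  qed
qed

text \<open>A ball containing \<open>x\<close> and a point outside \<Omega> is connected, hence
  meets the frontier at distance less than \<delta> from \<open>x\<close>.\<close>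

lemma ball_in_domain:
  fixes \<Omega> :: "(real^'n) set"
  assumes "open \<Omega>" "bounded \<Omega>" "x \<in> \<Omega>" "\<delta> \<le> infdist x (frontier \<Omega>)"
  shows "ball x \<delta> \<subseteq> \<Omega>"
proof (rule ccontr)
  assume "\<not> ball x \<delta> \<subseteq> \<Omega>"
  then obtain y where y: "y \<in> ball x \<delta>" "y \<notin> \<Omega>" by blast
  then have d: "0 < \<delta>" by (metis ball_eq_empty empty_iff not_less)
  have "x \<in> ball x \<delta> \<inter> \<Omega>" "y \<in> ball x \<delta> - \<Omega>" using assms(3) y d by auto
  then have "ball x \<delta> \<inter> frontier \<Omega> \<noteq> {}"
    by (intro connected_Int_frontier connected_ball) blast+
  then obtain z where z: "z \<in> ball x \<delta>" "z \<in> frontier \<Omega>" by blast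
  then have "infdist x (frontier \<Omega>) \<le> dist x z" by (intro infdist_le) auto
  with z assms(4) show False by auto
qed

text \<open>Every factor is at least \<open>1 / r\<close>, so the other \<open>CARD('n) - 1\<close>
  factors have product at least the corresponding power of \<open>1 / r\<close>.\<close>

lemma factor_le_of_prod_le:
  fixes l :: "'n::finite \<Rightarrow> real"
  assumes l: "\<And>i. 0 < l i" and prod: "(\<Prod>i\<in>UNIV. l i) \<le> c" and r: "(\<Sum>i\<in>UNIV. 1 / l i) \<le> r" and r0: "0 < r"
  shows "l j \<le> c * r ^ (CARD('n) - 1)"
proof -
  have low: "1 / r \<le> l i" for i
  proof -
    have "1 / l i \<le> (\<Sum>i\<in>UNIV. 1 / l i)" using l by (intro member_le_sum) (auto simp: less_imp_le)
    then have "1 / l i \<le> r" using r by simp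
    then show ?thesis using l[of i] r0 by (simp add: field_simps)
  qed
  have "l j * (1 / r) ^ (CARD('n) - 1) \<le> l j * (\<Prod>i\<in>UNIV - {j}. l i)"
  proof (rule mult_left_mono)
    have "(1 / r) ^ (CARD('n) - 1) = (\<Prod>i\<in>UNIV - {j}. 1 / r)" by (simp add: card_Diff_singleton)
    also have "\<dots> \<le> (\<Prod>i\<in>UNIV - {j}. l i)" using low r0 by (intro prod_mono) auto
    finally show "(1 / r) ^ (CARD('n) - 1) \<le> (\<Prod>i\<in>UNIV - {j}. l i)" .
  qed (use l[of j] in simp)
  also have "\<dots> = (\<Prod>i\<in>UNIV. l i)" by (subst prod.remove[of UNIV j]) auto
  also note prod
  finally show ?thesis using r0 by (simp add: field_simps power_divide)
qed

text \<open>By the eigenvector equation the left side is a multiple of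
  \<open>(p \<bullet> \<xi>)\<^sup>2\<close>. Cauchy-Schwarz with \<open>|p| < 1\<close> and the
  Euclidean length of an \<open>A\<close>-unit vector recover the common factor
  \<open>1 / (\<epsilon> * s)\<close>.\<close>

lemma (in eigenframe) tangential_bound: "(q \<bullet> a)\<^sup>2 \<le> \<kappa>\<^sup>2 * (1 / (\<epsilon> * s))"
proof -
  have "q \<bullet> a = - \<kappa> * (s / \<epsilon> * (p \<bullet> \<xi>))"
    by (simp add: a_def H\<xi> A_sym[symmetric] A_q_inner(2))
  then have "(q \<bullet> a)\<^sup>2 = \<kappa>\<^sup>2 * ((s / \<epsilon>)\<^sup>2 * (p \<bullet> \<xi>)\<^sup>2)" by (simp add: power_mult_distrib power_divide)
  also have "\<dots> \<le> \<kappa>\<^sup>2 * ((s / \<epsilon>)\<^sup>2 * (\<epsilon> / s ^ 3))"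
  proof (intro mult_left_mono)
    have "(p \<bullet> \<xi>)\<^sup>2 \<le> (p \<bullet> p) * (\<xi> \<bullet> \<xi>)" by (rule Cauchy_Schwarz_ineq)
    also have "\<dots> \<le> 1 * (\<xi> \<bullet> \<xi>)" using p_less by (intro mult_right_mono) auto
    also have "\<dots> \<le> \<epsilon> / s ^ 3" using norm_unit[OF Psi_\<xi>] by simp
    finally show "(p \<bullet> \<xi>)\<^sup>2 \<le> \<epsilon> / s ^ 3" .
  qed auto
  also have "(s / \<epsilon>)\<^sup>2 * (\<epsilon> / s ^ 3) = 1 / (\<epsilon> * s)"
    using s_pos eps by (simp add: field_simps power2_eq_square power3_eq_cube)
  finally show ?thesis .
qed

lemma cutoff_derivatives:
  fixes c x :: "real^'n" and Z R :: real
  defines "\<rho> \<equiv> \<lambda>x. R\<^sup>2 - (x - c) \<bullet> (x - c)"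
  assumes x: "0 < \<rho> x"
  shows "((\<lambda>x. Z / (\<rho> x)\<^sup>2 - 1) has_derivative (\<lambda>v. ((4 * Z / \<rho> x ^ 3) *\<^sub>R (x - c)) \<bullet> v)) (at x)"
    and "((\<lambda>x. (4 * Z / \<rho> x ^ 3) *\<^sub>R (x - c)) has_derivative
      (\<lambda>v. ((4 * Z / \<rho> x ^ 3) *\<^sub>R mat 1 + (24 * Z / \<rho> x ^ 4) *\<^sub>R outer (x - c) (x - c)) *v v)) (at x)"
    and "isCont (\<lambda>x. (4 * Z / \<rho> x ^ 3) *\<^sub>R mat 1 + (24 * Z / \<rho> x ^ 4) *\<^sub>R outer (x - c) (x - c)) x"
proof -
  have d\<rho>: "(\<rho> has_derivative (\<lambda>v. - 2 * ((x - c) \<bullet> v))) (at x)"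
    unfolding \<rho>_def by (auto intro!: derivative_eq_intros simp: inner_commute)
  have one: "((\<lambda>r. Z / r\<^sup>2 - 1) has_real_derivative (- 2 * Z / \<rho> x ^ 3)) (at (\<rho> x))"
    using x by (auto intro!: derivative_eq_intros simp: field_simps eval_nat_numeral)
  have two: "((\<lambda>r. 4 * Z / r ^ 3) has_real_derivative (- 12 * Z / \<rho> x ^ 4)) (at (\<rho> x))"
    using x by (auto intro!: derivative_eq_intros simp: field_simps eval_nat_numeral)
  have c1: "((\<lambda>x. Z / (\<rho> x)\<^sup>2 - 1) has_derivative (\<lambda>v. (- 2 * Z / \<rho> x ^ 3) * (- 2 * ((x - c) \<bullet> v)))) (at x)"
    using diff_chain_at[OF d\<rho> one[unfolded has_field_derivative_def]] by (simp add: o_def)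
  have c2: "((\<lambda>x. 4 * Z / \<rho> x ^ 3) has_derivative (\<lambda>v. (- 12 * Z / \<rho> x ^ 4) * (- 2 * ((x - c) \<bullet> v)))) (at x)"
    using diff_chain_at[OF d\<rho> two[unfolded has_field_derivative_def]] by (simp add: o_def)
  show "((\<lambda>x. Z / (\<rho> x)\<^sup>2 - 1) has_derivative (\<lambda>v. ((4 * Z / \<rho> x ^ 3) *\<^sub>R (x - c)) \<bullet> v)) (at x)"
    using c1 by (simp add: mult.assoc)
  have c3: "((\<lambda>x. x - c) has_derivative (\<lambda>v. v)) (at x)" by (auto intro!: derivative_eq_intros)
  have "((\<lambda>x. (4 * Z / \<rho> x ^ 3) *\<^sub>R (x - c)) has_derivative
      (\<lambda>v. (4 * Z / \<rho> x ^ 3) *\<^sub>R v + ((- 12 * Z / \<rho> x ^ 4) * (- 2 * ((x - c) \<bullet> v))) *\<^sub>R (x - c))) (at x)"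
    by (rule has_derivative_scaleR[OF c2 c3])
  moreover have "(\<lambda>v. (4 * Z / \<rho> x ^ 3) *\<^sub>R v + ((- 12 * Z / \<rho> x ^ 4) * (- 2 * ((x - c) \<bullet> v))) *\<^sub>R (x - c))
    = (\<lambda>v. ((4 * Z / \<rho> x ^ 3) *\<^sub>R mat 1 + (24 * Z / \<rho> x ^ 4) *\<^sub>R outer (x - c) (x - c)) *v v)"
    by (simp add: matrix_vector_mult_add_rdistrib scaleR_matrix_vector_assoc[symmetric] outer_mult_vec mult.assoc)
  ultimately show "((\<lambda>x. (4 * Z / \<rho> x ^ 3) *\<^sub>R (x - c)) has_derivative
      (\<lambda>v. ((4 * Z / \<rho> x ^ 3) *\<^sub>R mat 1 + (24 * Z / \<rho> x ^ 4) *\<^sub>R outer (x - c) (x - c)) *v v)) (at x)" by simp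
  have "(\<rho> \<longlongrightarrow> \<rho> x) (at x)" using has_derivative_continuous[OF d\<rho>] by (simp add: isCont_def)
  then show "isCont (\<lambda>x. (4 * Z / \<rho> x ^ 3) *\<^sub>R mat 1 + (24 * Z / \<rho> x ^ 4) *\<^sub>R outer (x - c) (x - c)) x"
    unfolding isCont_def outer_def using x by (intro tendsto_intros tendsto_vec_lambda) auto
qed

text \<open>\<open>Z / \<rho>\<^sup>2\<close> is the eigenvalue \<open>\<kappa> x0 + 1\<close>, and
  \<open>r0\<close> is the threshold of \<open>scalar_bound\<close>. Above it that lemma gives the
  first summand of the bound; below it the bounded product of the eigenvalues gives the
  second.\<close>

lemma (in pde) eigenvalue_estimate:
  fixes c :: "real^'n" and Z R L C1 :: real
  defines "\<rho> \<equiv> R\<^sup>2 - (x0 - c) \<bullet> (x0 - c)"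
  assumes R: "0 < R" and \<rho>: "0 < \<rho>"
    and \<kappa>: "\<kappa> x0 = Z / \<rho>\<^sup>2 - 1" "\<kappa>1 x0 = (4 * Z / \<rho> ^ 3) *\<^sub>R (x0 - c)"
      "\<kappa>2 x0 = (4 * Z / \<rho> ^ 3) *\<^sub>R mat 1 + (24 * Z / \<rho> ^ 4) *\<^sub>R outer (x0 - c) (x0 - c)"
    and Z: "2 * \<rho>\<^sup>2 \<le> Z"
    and L: "\<epsilon> / sf x0 \<le> L" and K: "0 \<le> K" and C1: "norm (gF x0) \<le> C1" "norm (gG (T x0)) \<le> C1"
    and c3: "det (wm x0) \<le> c3 * det (cost_hess \<epsilon> (p x0))" "0 \<le> c3"
  defines "r0 \<equiv> 4 * (2 * CARD('n) + (7 * C1 * L + 4 * K * L\<^sup>2))"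
  shows "Z \<le> 4 * (28 * R\<^sup>2 * L\<^sup>2 + (2 * L + C1 * L\<^sup>2) * (4 * R ^ 3)) + c3 * r0 ^ (CARD('n) - 1) * R ^ 4"
proof -
  obtain f :: "'n \<Rightarrow> real^'n" and l where ef: "eigenframe \<epsilon> (p x0) f (H x0) l \<xi>0 (\<kappa> x0)"
    and ineq: "let s = sf x0; q = frame.q (p x0); R = (\<Sum>i\<in>UNIV. 1 / l i); n = real CARD('n); k = \<kappa> x0;
        t = q \<bullet> (H x0 *v \<xi>0); gF = gF x0; gG = gG (T x0) in
     0 \<le> - (1 / (\<epsilon> * s)) * k * ((k + 1) * R - n * (k + 1) - n + (\<Sum>i\<in>UNIV. l i))
       + n * t\<^sup>2 + (\<Sum>i\<in>UNIV. (f i \<bullet> (\<kappa>2 x0 *v f i)) / l i) + (R - n) * (q \<bullet> \<kappa>1 x0)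
       + k * (gF \<bullet> q) - 2 * t * (gF \<bullet> \<xi>0 - (k + 1) * (gG \<bullet> \<xi>0)) + 2 * K * (norm \<xi>0)\<^sup>2 * (1 + (k + 1)\<^sup>2)
       + gG \<bullet> (frame.Ainv \<epsilon> (p x0) (\<kappa>1 x0) - (k\<^sup>2 + k) *\<^sub>R q)"
    by (rule maximum_inequality)
  interpret E: eigenframe \<epsilon> "p x0" f "H x0" l \<xi>0 "\<kappa> x0" by (rule ef)
  have sE: "E.s = sf x0" by (simp add: E.s_def sf_def)
  define q where "q = E.q"
  define s where "s = sf x0"
  define \<mu> where "\<mu> = 1 / (\<epsilon> * s)"
  define k where "k = \<kappa> x0"
  define n where "n = real CARD('n)"
  define r where "r = (\<Sum>i\<in>UNIV. 1 / l i)"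
  define t where "t = q \<bullet> (H x0 *v \<xi>0)"
  let ?x = "x0 - c"
  have s0: "0 < s" unfolding s_def by (rule sf_pos[OF x0])
  have \<mu>0: "0 < \<mu>" using s0 eps by (simp add: \<mu>_def)
  have L0: "0 < L" using L s0 eps unfolding s_def[symmetric] by (smt (verit) divide_pos_pos)
  have C0: "0 \<le> C1" using C1(1) norm_ge_zero order_trans by blast
  have k1: "k + 1 = Z / \<rho>\<^sup>2" by (simp add: k_def \<kappa>)
  have Z\<rho>: "Z = (k + 1) * \<rho>\<^sup>2" using \<rho> by (simp add: k1)
  have k: "1 \<le> k" using Z \<rho> unfolding Z\<rho> by (simp add: mult_le_cancel_right)
  have n1: "1 \<le> n" by (simp add: n_def Suc_leI)
  have \<rho>R: "\<rho> \<le> R\<^sup>2" by (simp add: \<rho>_def)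
  have xR: "norm ?x \<le> R"
    by (rule power2_le_imp_le[OF _ less_imp_le[OF R]]) (use \<rho> in \<open>unfold \<rho>_def power2_norm_eq_inner, linarith\<close>)
  \<comment> \<open>This and \<open>bound2\<close> rewrite all Euclidean sizes as multiples of \<mu>
    with coefficients in \<open>L\<close>; the dependence on \<epsilon> is thereby confined to
    \<mu>.\<close>
  have bound3: "\<epsilon> / s ^ 3 \<le> L\<^sup>2 * \<mu>"
  proof -
    have "\<epsilon> / s ^ 3 = (\<epsilon> / s)\<^sup>2 * \<mu>" using s0 eps by (simp add: \<mu>_def field_simps power2_eq_square power3_eq_cube)
    also have "\<dots> \<le> L\<^sup>2 * \<mu>" using L s0 eps \<mu>0 unfolding s_def[symmetric] by (intro mult_right_mono power_mono) auto
    finally show ?thesis .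
  qed
  have bound2: "1 / s\<^sup>2 \<le> L * \<mu>"
  proof -
    have "1 / s\<^sup>2 = (\<epsilon> / s) * \<mu>" using s0 eps by (simp add: \<mu>_def field_simps power2_eq_square)
    also have "\<dots> \<le> L * \<mu>" using L \<mu>0 unfolding s_def[symmetric] by (intro mult_right_mono) auto
    finally show ?thesis .
  qed
  have nq: "norm q \<le> L * \<mu>" using E.norm_q bound2 unfolding q_def sE s_def by linarith
  have nA: "norm (E.Ainv v) \<le> L\<^sup>2 * \<mu> * norm v" for v
    using E.norm_Ainv[of v] mult_right_mono[OF bound3, of "norm v"] unfolding sE s_def by simp
  have n\<xi>: "(norm \<xi>0)\<^sup>2 \<le> L\<^sup>2 * \<mu>"
    using E.norm_unit[OF unit] bound3 unfolding sE s_def power2_norm_eq_inner by linarith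
  have nf: "f i \<bullet> f i \<le> L\<^sup>2 * \<mu>" for i
    using E.norm_unit[OF E.Psi_frame, of i] bound3 unfolding sE s_def by linarith
  have t2: "t\<^sup>2 \<le> k\<^sup>2 * \<mu>" using E.tangential_bound unfolding t_def q_def k_def \<mu>_def sE s_def E.a_def .
  have t\<xi>: "\<bar>t\<bar> * norm \<xi>0 \<le> k * L * \<mu>"
  proof (rule power2_le_imp_le)
    have "(\<bar>t\<bar> * norm \<xi>0)\<^sup>2 \<le> (k\<^sup>2 * \<mu>) * (L\<^sup>2 * \<mu>)"
      unfolding power_mult_distrib power2_abs using t2 n\<xi> \<mu>0 by (intro mult_mono) auto
    then show "(\<bar>t\<bar> * norm \<xi>0)\<^sup>2 \<le> (k * L * \<mu>)\<^sup>2" by (simp add: power_mult_distrib power2_eq_square mult_ac)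
  qed (use k L0 \<mu>0 in auto)
  \<comment> \<open>\<open>Z\<close> is expressed through the eigenvalue \<open>k + 1\<close>, so
    the derivatives of the cutoff scale with the quantity to be bounded.\<close>
  have \<kappa>1_eq: "\<kappa>1 x0 = (4 * (k + 1) / \<rho>) *\<^sub>R ?x"
    unfolding \<kappa> Z\<rho> using \<rho> by (simp add: power2_eq_square power3_eq_cube)
  have n\<kappa>1: "norm (\<kappa>1 x0) \<le> (k + 1) * (4 * R / \<rho>)"
  proof -
    have "norm (\<kappa>1 x0) = (4 * (k + 1) / \<rho>) * norm ?x" unfolding \<kappa>1_eq using k \<rho> by simp
    also have "\<dots> \<le> (4 * (k + 1) / \<rho>) * R" using k \<rho> xR by (intro mult_left_mono) auto
    finally show ?thesis by (simp add: field_simps)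
  qed
  have \<kappa>2_f: "f i \<bullet> (\<kappa>2 x0 *v f i) \<le> (k + 1) * (28 * R\<^sup>2 / \<rho>\<^sup>2) * L\<^sup>2 * \<mu>" for i
  proof -
    have "\<kappa>2 x0 = (4 * (k + 1) / \<rho>) *\<^sub>R mat 1 + (24 * (k + 1) / \<rho>\<^sup>2) *\<^sub>R outer ?x ?x"
      unfolding \<kappa> Z\<rho> using \<rho> by (simp add: eval_nat_numeral)
    then have "f i \<bullet> (\<kappa>2 x0 *v f i) = (4 * (k + 1) / \<rho>) * (f i \<bullet> f i) + (24 * (k + 1) / \<rho>\<^sup>2) * (?x \<bullet> f i)\<^sup>2"
      by (simp add: matrix_vector_mult_add_rdistrib scaleR_matrix_vector_assoc[symmetric] outer_mult_vec
          inner_add_right inner_commute power2_eq_square)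
    \<comment> \<open>Both summands are brought to the scale
      \<open>R\<^sup>2 / \<rho>\<^sup>2\<close>, where 4 and 24 add up to the 28 of the final
      constant.\<close>
    also have "\<dots> \<le> (4 * (k + 1) * (R\<^sup>2 / \<rho>\<^sup>2)) * (f i \<bullet> f i) + (24 * (k + 1) / \<rho>\<^sup>2) * (R\<^sup>2 * (f i \<bullet> f i))"
    proof (intro add_mono mult_left_mono mult_right_mono)
      have "4 * (k + 1) / \<rho> = 4 * (k + 1) * (\<rho> / \<rho>\<^sup>2)" using \<rho> by (simp add: power2_eq_square)
      also have "\<dots> \<le> 4 * (k + 1) * (R\<^sup>2 / \<rho>\<^sup>2)" using k \<rho>R by (intro mult_left_mono divide_right_mono) auto
      finally show "4 * (k + 1) / \<rho> \<le> 4 * (k + 1) * (R\<^sup>2 / \<rho>\<^sup>2)" .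
      have "(?x \<bullet> f i)\<^sup>2 \<le> (?x \<bullet> ?x) * (f i \<bullet> f i)" by (rule Cauchy_Schwarz_ineq)
      also have "\<dots> \<le> R\<^sup>2 * (f i \<bullet> f i)" using \<rho> by (intro mult_right_mono) (auto simp: \<rho>_def)
      finally show "(?x \<bullet> f i)\<^sup>2 \<le> R\<^sup>2 * (f i \<bullet> f i)" .
    qed (use k in auto)
    also have "\<dots> = (k + 1) * (28 * R\<^sup>2 / \<rho>\<^sup>2) * (f i \<bullet> f i)" by (simp add: divide_inverse algebra_simps)
    also have "\<dots> \<le> (k + 1) * (28 * R\<^sup>2 / \<rho>\<^sup>2) * (L\<^sup>2 * \<mu>)"
      using k nf by (intro mult_left_mono) auto
    finally show ?thesis by (simp add: mult_ac)
  qed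
  define A1 where "A1 = (\<Sum>i\<in>UNIV. (f i \<bullet> (\<kappa>2 x0 *v f i)) / l i)"
  define A2 where "A2 = q \<bullet> \<kappa>1 x0"
  define A3 where "A3 = k * (gF x0 \<bullet> q)"
  define A4 where "A4 = t * (gF x0 \<bullet> \<xi>0 - (k + 1) * (gG (T x0) \<bullet> \<xi>0))"
  define A5 where "A5 = 2 * K * (norm \<xi>0)\<^sup>2 * (1 + (k + 1)\<^sup>2)"
  define A6 where "A6 = gG (T x0) \<bullet> (E.Ainv (\<kappa>1 x0) - (k\<^sup>2 + k) *\<^sub>R q)"
  have main: "0 \<le> - \<mu> * k * ((k + 1) * r - n * (k + 1) - n + (\<Sum>i\<in>UNIV. l i)) + n * t\<^sup>2 + A1 + (r - n) * A2 + A3 - 2 * A4 + A5 + A6"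
    using ineq unfolding Let_def A1_def A2_def A3_def A4_def A5_def A6_def \<mu>_def s_def k_def n_def r_def t_def q_def
    by (simp only: mult.assoc)
  have A1b: "A1 \<le> (k + 1) * (28 * R\<^sup>2 / \<rho>\<^sup>2) * L\<^sup>2 * \<mu> * r"
  proof -
    have "A1 \<le> (\<Sum>i\<in>UNIV. ((k + 1) * (28 * R\<^sup>2 / \<rho>\<^sup>2) * L\<^sup>2 * \<mu>) / l i)"
      unfolding A1_def by (intro sum_mono divide_right_mono \<kappa>2_f less_imp_le[OF E.l_pos])
    then show ?thesis unfolding r_def sum_distrib_left by simp
  qed
  have A2b: "\<bar>A2\<bar> \<le> (k + 1) * (4 * R / \<rho>) * L * \<mu>"
  proof -
    have "\<bar>A2\<bar> \<le> norm q * norm (\<kappa>1 x0)" unfolding A2_def by (rule Cauchy_Schwarz_ineq2)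
    also have "\<dots> \<le> (L * \<mu>) * ((k + 1) * (4 * R / \<rho>))" using nq n\<kappa>1 L0 \<mu>0 by (intro mult_mono) auto
    finally show ?thesis by (simp only: mult_ac)
  qed
  have A3b: "A3 \<le> k * C1 * L * \<mu>"
  proof -
    have "gF x0 \<bullet> q \<le> norm (gF x0) * norm q" by (rule norm_cauchy_schwarz)
    also have "\<dots> \<le> C1 * (L * \<mu>)" using nq C1 C0 by (intro mult_mono) auto
    finally have "k * (gF x0 \<bullet> q) \<le> k * (C1 * (L * \<mu>))" using k by (intro mult_left_mono) auto
    then show ?thesis by (simp add: A3_def mult.assoc)
  qed
  have A4b: "\<bar>A4\<bar> \<le> k * (k + 2) * C1 * L * \<mu>"
  proof -
    have "\<bar>gF x0 \<bullet> \<xi>0 - (k + 1) * (gG (T x0) \<bullet> \<xi>0)\<bar> \<le> norm (gF x0 - (k + 1) *\<^sub>R gG (T x0)) * norm \<xi>0"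
      using Cauchy_Schwarz_ineq2[of "gF x0 - (k + 1) *\<^sub>R gG (T x0)" \<xi>0] by (simp add: inner_diff_left)
    also have "norm (gF x0 - (k + 1) *\<^sub>R gG (T x0)) \<le> C1 + (k + 1) * C1"
      using k C1 by (intro order_trans[OF norm_triangle_ineq4] add_mono) (auto intro!: mult_left_mono)
    finally have "\<bar>gF x0 \<bullet> \<xi>0 - (k + 1) * (gG (T x0) \<bullet> \<xi>0)\<bar> \<le> (C1 + (k + 1) * C1) * norm \<xi>0"
      by (simp add: mult_right_mono)
    then have "\<bar>A4\<bar> \<le> \<bar>t\<bar> * ((C1 + (k + 1) * C1) * norm \<xi>0)"
      unfolding A4_def abs_mult by (intro mult_left_mono) auto
    also have "\<dots> = (\<bar>t\<bar> * norm \<xi>0) * ((k + 2) * C1)" by (simp add: algebra_simps)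
    also have "\<dots> \<le> (k * L * \<mu>) * ((k + 2) * C1)" using t\<xi> k C0 by (intro mult_right_mono) auto
    finally show ?thesis by (simp only: mult_ac)
  qed
  have A5b: "A5 \<le> 2 * K * L\<^sup>2 * \<mu> * (1 + (k + 1)\<^sup>2)"
  proof -
    have "2 * K * (norm \<xi>0)\<^sup>2 * (1 + (k + 1)\<^sup>2) \<le> 2 * K * (L\<^sup>2 * \<mu>) * (1 + (k + 1)\<^sup>2)"
      using n\<xi> K by (intro mult_right_mono mult_left_mono) auto
    then show ?thesis by (simp add: A5_def mult.assoc)
  qed
  have A6b: "A6 \<le> C1 * (L\<^sup>2 * \<mu> * ((k + 1) * (4 * R / \<rho>)) + (k\<^sup>2 + k) * L * \<mu>)"
  proof -
    have "A6 \<le> norm (gG (T x0)) * norm (E.Ainv (\<kappa>1 x0) - (k\<^sup>2 + k) *\<^sub>R q)"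
      unfolding A6_def by (rule norm_cauchy_schwarz)
    also have "\<dots> \<le> C1 * (L\<^sup>2 * \<mu> * ((k + 1) * (4 * R / \<rho>)) + (k\<^sup>2 + k) * (L * \<mu>))"
    proof (intro mult_mono C1 order_trans[OF norm_triangle_ineq4] add_mono)
      show "norm (E.Ainv (\<kappa>1 x0)) \<le> L\<^sup>2 * \<mu> * ((k + 1) * (4 * R / \<rho>))"
        by (rule order_trans[OF nA mult_left_mono[OF n\<kappa>1]]) (use \<mu>0 in simp)
      show "norm ((k\<^sup>2 + k) *\<^sub>R q) \<le> (k\<^sup>2 + k) * (L * \<mu>)" using nq k by (simp add: mult_left_mono)
    qed (use C0 in auto)
    finally show ?thesis by (simp add: mult.assoc)
  qed
  have ll: "0 \<le> (\<Sum>i\<in>UNIV. l i)" using E.l_pos by (intro sum_nonneg) (simp add: less_imp_le)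
  define B where "B = 28 * R\<^sup>2 * L\<^sup>2 + (2 * L + C1 * L\<^sup>2) * (4 * R ^ 3)"
  have B0: "0 \<le> B" using R L0 C0 by (simp add: B_def)
  have r00: "0 < r0" unfolding r0_def using C0 L0 K by (simp add: add_pos_nonneg)
  show ?thesis
  proof (cases "r0 \<le> r")
    case True
    have "(k + 1) * \<rho>\<^sup>2 \<le> 4 * B"
      unfolding B_def
      by (rule scalar_bound[OF \<mu>0 k n1 ll _ C0 K R \<rho> \<rho>R _ main t2 A1b A2b A3b A4b A5b A6b])
         (use True L0 in \<open>auto simp: r0_def n_def\<close>)
    then show ?thesis using Z\<rho> c3 r00 by (simp add: B_def add_increasing2)
  next
    case False
    \<comment> \<open>A nonzero component of \<xi> shows that some \<open>l j\<close> equals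
      \<open>k + 1\<close>, so the bound for single factors applies to it.\<close>
    have "\<exists>i. E.X i \<noteq> 0"
    proof (rule ccontr)
      assume "\<nexists>i. E.X i \<noteq> 0"
      then show False using E.X_norm by simp
    qed
    then obtain j where "E.X j \<noteq> 0" by blast
    then have lj: "l j = k + 1" using E.X_eigen[of j] by (simp add: k_def)
    have det: "det (wm x0) = det (cost_hess \<epsilon> (p x0)) * (\<Prod>i\<in>UNIV. l i)"
      using det_diag_frame(1)[OF E.orth E.wdiag] by (simp add: wm_def)
    have "0 < det (cost_hess \<epsilon> (p x0))" by (intro pos_def_det_pos cost_hess_pos_def eps p_less x0)
    then have "(\<Prod>i\<in>UNIV. l i) \<le> c3" using c3(1) unfolding det by (simp add: mult.commute[of c3])
    from factor_le_of_prod_le[OF E.l_pos this _ r00, of j] False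
    have "k + 1 \<le> c3 * r0 ^ (CARD('n) - 1)" by (simp add: lj r_def)
    then have "Z \<le> c3 * r0 ^ (CARD('n) - 1) * \<rho>\<^sup>2" unfolding Z\<rho> by (intro mult_right_mono) auto
    also have "\<dots> \<le> c3 * r0 ^ (CARD('n) - 1) * (R\<^sup>2)\<^sup>2"
      using \<rho> \<rho>R c3 r00 by (intro mult_left_mono power_mono) auto
    finally show ?thesis using B0 by (simp add: B_def[symmetric])
  qed
qed

section \<open>The interior maximum and the assembly of the estimate\<close>

lemma C3_jet_subset:
  assumes "C3_jet \<Omega> u p H D" "open S" "S \<subseteq> \<Omega>"
  shows "C3_jet S u p H D"
  using assms unfolding C3_jet_def by blast

lemma Psi_scale: "Psi \<epsilon> p (r *\<^sub>R e) = r\<^sup>2 * Psi \<epsilon> p e"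
  by (simp add: Psi_def power2_eq_square algebra_simps)

lemma form_scale: "(r *\<^sub>R e) \<bullet> (M *v (r *\<^sub>R e)) = r\<^sup>2 * (e \<bullet> (M *v e))" for M :: "real^'n^'n"
  by (simp add: matrix_vector_mult_scaleR power2_eq_square)

lemma ln_det_equation:
  fixes \<epsilon> s a b :: real
  assumes "0 < \<epsilon>" "0 < s" "0 < a" "0 < b"
  shows "ln (\<epsilon>\<^sup>2 / (\<epsilon> / s) ^ (n + 2) * (a / b)) = (real n + 2) * ln s + (2 * ln \<epsilon> - (real n + 2) * ln \<epsilon>) + ln a - ln b"
  using assms by (simp add: ln_mult ln_div ln_realpow del: power_Suc) (simp add: algebra_simps)

text \<open>The cutoff quotient is maximised over a closed ball times the unit sphere, and the bound
  for the maximum is read off at the centre. \<open>C\<close> is built from \<open>R\<close>,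
  \<open>L\<close> and bounds for the data only, so neither \<epsilon> nor \<open>u\<close> enters
  it otherwise.\<close>

lemma interior_bound:
  fixes \<Omega> \<Omega>' :: "(real^'n) set" and c :: "real^'n" and R L C1 K c3 :: real
  assumes jet: "C3_jet \<Omega> u p H D" and eps: "0 < \<epsilon>"
    and cc: "cost_concave \<epsilon> \<Omega> \<Omega>' u" and \<Omega>': "bounded \<Omega>'" "\<Omega>' \<noteq> {}" "open \<Omega>'"
    and R: "0 < R" "cball c R \<subseteq> \<Omega>"
    and L: "\<And>x. x \<in> \<Omega> \<Longrightarrow> \<epsilon> / sqrt (1 - p x \<bullet> p x) \<le> L"
    and T_in: "\<And>x. x \<in> \<Omega> \<Longrightarrow> x - \<epsilon> *\<^sub>R ((1 / sqrt (1 - p x \<bullet> p x)) *\<^sub>R p x) \<in> \<Omega>'"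
    and pos: "\<And>x. x \<in> \<Omega> \<Longrightarrow> 0 < F x" "\<And>y. y \<in> \<Omega>' \<Longrightarrow> 0 < G y"
    and ratio: "\<And>x y. x \<in> \<Omega> \<Longrightarrow> y \<in> \<Omega>' \<Longrightarrow> F x / G y \<le> c3"
    and det: "\<And>x. x \<in> \<Omega> \<Longrightarrow> det (cost_hess \<epsilon> (p x) - H x)
        = \<epsilon>\<^sup>2 / (\<epsilon> / sqrt (1 - p x \<bullet> p x)) ^ (CARD('n) + 2) * (F x / G (x - \<epsilon> *\<^sub>R ((1 / sqrt (1 - p x \<bullet> p x)) *\<^sub>R p x)))"
    and dF: "\<And>x. x \<in> \<Omega> \<Longrightarrow> ((\<lambda>x. ln (F x)) has_derivative (\<lambda>v. gF x \<bullet> v)) (at x)"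
      "\<And>x. x \<in> \<Omega> \<Longrightarrow> norm (gF x) \<le> C1"
      "\<And>U x y. convex U \<Longrightarrow> U \<subseteq> \<Omega> \<Longrightarrow> x \<in> U \<Longrightarrow> y \<in> U \<Longrightarrow> norm (gF x - gF y) \<le> K * norm (x - y)"
    and dG: "\<And>x. x \<in> \<Omega>' \<Longrightarrow> ((\<lambda>x. ln (G x)) has_derivative (\<lambda>v. gG x \<bullet> v)) (at x)"
      "\<And>x. x \<in> \<Omega>' \<Longrightarrow> norm (gG x) \<le> C1"
      "\<And>U x y. convex U \<Longrightarrow> U \<subseteq> \<Omega>' \<Longrightarrow> x \<in> U \<Longrightarrow> y \<in> U \<Longrightarrow> norm (gG x - gG y) \<le> K * norm (x - y)"
    and K: "0 \<le> K"
  defines "C \<equiv> 2 * R ^ 4 + (4 * (28 * R\<^sup>2 * L\<^sup>2 + (2 * L + C1 * L\<^sup>2) * (4 * R ^ 3))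
      + c3 * (4 * (2 * CARD('n) + (7 * C1 * L + 4 * K * L\<^sup>2))) ^ (CARD('n) - 1) * R ^ 4)"
  shows "R ^ 4 * (\<xi> \<bullet> ((cost_hess \<epsilon> (p c) - H c) *v \<xi>)) \<le> C * Psi \<epsilon> (p c) \<xi>"
proof -
  interpret J: C3_jet \<Omega> u p H D by (rule jet)
  define w where "w x = cost_hess \<epsilon> (p x) - H x" for x
  have p_less: "p x \<bullet> p x < 1" if "x \<in> \<Omega>" for x by (rule J.cost_concave_jet(1)[OF eps cc \<Omega>'(1,2) that])
  have w_form: "e \<bullet> (w x *v e) = Psi \<epsilon> (p x) e - e \<bullet> (H x *v e)" for x e
    by (simp add: w_def matrix_vector_mult_diff_rdistrib inner_diff_right cost_hess_Psi)
  have w_psd: "0 \<le> e \<bullet> (w x *v e)" if "x \<in> \<Omega>" for x e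
    using J.cost_concave_jet(2)[OF eps cc \<Omega>'(1,2) that, of e] by (simp add: w_form cost_hess_Psi)
  have w_sym: "transpose (w x) = w x" if "x \<in> \<Omega>" for x
    using J.H_sym[OF that] cost_hess_sym[of \<epsilon> "p x"] by (simp add: w_def transpose_def vec_eq_iff)
  have s0: "0 < sqrt (1 - p x \<bullet> p x)" if "x \<in> \<Omega>" for x using p_less[OF that] by simp
  have w_det: "0 < det (w x)" if "x \<in> \<Omega>" for x
    unfolding w_def det[OF that] using s0[OF that] eps pos(1)[OF that] pos(2)[OF T_in[OF that]] by simp
  have w_pos: "pos_def (w x)" if "x \<in> \<Omega>" for x
    unfolding pos_def_def
  proof (intro conjI allI impI w_sym that)
    fix v :: "real^'n" assume v: "v \<noteq> 0"
    \<comment> \<open>Cost-concavity gives semidefiniteness; the equation makes the determinant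
      positive and so excludes null vectors.\<close>
    have "w x *v v \<noteq> 0"
      using w_det[OF that] v by (metis invertible_det_nz invertible_left_inverse matrix_left_invertible_ker less_irrefl)
    then have "v \<bullet> (w x *v v) \<noteq> 0" using psd_zero_vector[OF w_sym[OF that] w_psd[OF that]] by blast
    then show "0 < v \<bullet> (w x *v v)" using w_psd[OF that, of v] by simp
  qed
  have Psi_pos: "0 < Psi \<epsilon> (p x) e" if "x \<in> \<Omega>" "e \<noteq> 0" for x e
    using pos_defD(2)[OF cost_hess_pos_def[OF eps p_less[OF that(1)]] that(2)] by (simp add: cost_hess_Psi)
  define \<rho> where "\<rho> x = R\<^sup>2 - (x - c) \<bullet> (x - c)" for x
  \<comment> \<open>Homogeneous of degree 0 in the vector, so the compact Euclidean unit sphere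
    suffices although the normalisation needed later is that of \<open>A\<close>.\<close>
  define q where "q z = (\<rho> (fst z))\<^sup>2 * ((snd z \<bullet> (w (fst z) *v snd z)) / Psi \<epsilon> (p (fst z)) (snd z))" for z
  let ?K = "cball c R \<times> sphere (0 :: real^'n) 1"
  have cpt: "compact ?K" by (intro compact_Times compact_cball compact_sphere)
  have contp: "continuous_on \<Omega> p" and contH: "continuous_on \<Omega> H"
    using J.isCont_p J.isCont_H by (auto simp: continuous_at_imp_continuous_on)
  have matvec: "continuous_on X (\<lambda>z. M z *v v z)" if "continuous_on X M" "continuous_on X v"
    for X :: "((real^'n) \<times> (real^'n)) set" and M :: "_ \<Rightarrow> real^'n^'n" and v
    using that unfolding continuous_on_def by (auto intro: tendsto_matrix_vector_mult)
  have contpz: "continuous_on ?K (\<lambda>z. p (fst z))" and contHz: "continuous_on ?K (\<lambda>z. H (fst z))"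
    using R(2) by (auto intro!: continuous_on_compose2[OF contp] continuous_on_compose2[OF contH] continuous_intros)
  have contPsi: "continuous_on ?K (\<lambda>z. Psi \<epsilon> (p (fst z)) (snd z))"
    unfolding Psi_def using eps by (intro continuous_intros contpz) auto
  have "Psi \<epsilon> (p (fst z)) (snd z) \<noteq> 0" if "z \<in> ?K" for z
    using that R(2) Psi_pos[of "fst z" "snd z"] by fastforce
  then have cont: "continuous_on ?K q"
    unfolding q_def \<rho>_def w_form by (intro continuous_intros matvec contHz contPsi) auto
  obtain e0 :: "real^'n" where e0: "norm e0 = 1" using vector_choose_size[of 1] by auto
  then have ne: "?K \<noteq> {}" using R by auto
  obtain z where z: "z \<in> ?K" "\<And>z'. z' \<in> ?K \<Longrightarrow> q z' \<le> q z"
    using continuous_attains_sup[OF cpt ne cont] by blast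
  define x where "x = fst z"
  define \<eta> where "\<eta> = snd z"
  define Z where "Z = q z"
  have x\<Omega>: "x \<in> \<Omega>" and xc: "x \<in> cball c R" and \<eta>: "norm \<eta> = 1" using z R by (auto simp: x_def \<eta>_def)
  have max: "(\<rho> y)\<^sup>2 * (e \<bullet> (w y *v e)) \<le> Z * Psi \<epsilon> (p y) e" if y: "y \<in> cball c R" for y e
  proof (cases "e = 0")
    case False
    let ?e = "(1 / norm e) *\<^sub>R e"
    have "q (y, ?e) \<le> Z" unfolding Z_def using y False by (intro z(2)) auto
    moreover have "q (y, ?e) = (\<rho> y)\<^sup>2 * ((e \<bullet> (w y *v e)) / Psi \<epsilon> (p y) e)"
      unfolding q_def fst_conv snd_conv form_scale Psi_scale using False by simp
    moreover have "0 < Psi \<epsilon> (p y) e" using y R False by (intro Psi_pos) auto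
    ultimately show ?thesis by (simp add: pos_divide_le_eq)
  qed (simp add: Psi_def)
  have Zeq: "(\<rho> x)\<^sup>2 * (\<eta> \<bullet> (w x *v \<eta>)) = Z * Psi \<epsilon> (p x) \<eta>"
  proof -
    have "\<eta> \<noteq> 0" using \<eta> by auto
    then have "Psi \<epsilon> (p x) \<eta> \<noteq> 0" using Psi_pos[OF x\<Omega>, of \<eta>] by simp
    then show ?thesis by (simp add: Z_def q_def x_def[symmetric] \<eta>_def[symmetric])
  qed
  have C1: "0 \<le> C1" using dF(2)[OF x\<Omega>] norm_ge_zero order_trans by blast
  have L0: "0 < L" using L[OF x\<Omega>] s0[OF x\<Omega>] eps by (smt (verit) divide_pos_pos)
  have c30: "0 \<le> c3" using ratio[OF x\<Omega> T_in[OF x\<Omega>]] pos(1)[OF x\<Omega>] pos(2)[OF T_in[OF x\<Omega>]]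
    by (smt (verit) divide_pos_pos)
  define C2 where "C2 = 4 * (28 * R\<^sup>2 * L\<^sup>2 + (2 * L + C1 * L\<^sup>2) * (4 * R ^ 3))
      + c3 * (4 * (2 * CARD('n) + (7 * C1 * L + 4 * K * L\<^sup>2))) ^ (CARD('n) - 1) * R ^ 4"
  have C2: "0 \<le> C2" unfolding C2_def using R C1 L0 c30 K by (intro add_nonneg_nonneg mult_nonneg_nonneg) auto
  have CC: "C = 2 * R ^ 4 + C2" by (simp add: C_def C2_def)
  have "Z \<le> C"
  \<comment> \<open>In the first case \<open>Z\<close> is at most \<open>2 * R ^ 4\<close>.
    Otherwise \<open>\<kappa> x \<ge> 1\<close>, as the estimate requires, and \<open>Z > 0\<close>
    keeps the maximum point off the boundary sphere, where \<open>\<rho>\<close> vanishes.\<close>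
  proof (cases "Z < 2 * (\<rho> x)\<^sup>2 \<or> Z \<le> 0")
    case True
    have "0 \<le> \<rho> x" using xc R by (simp add: \<rho>_def power2_norm_eq_inner[symmetric] dist_norm norm_minus_commute power_mono)
    then have "(\<rho> x)\<^sup>2 \<le> (R\<^sup>2)\<^sup>2" by (intro power_mono) (simp_all add: \<rho>_def)
    then have "(\<rho> x)\<^sup>2 \<le> R ^ 4" by simp
    moreover have "0 \<le> R ^ 4" using R by simp
    ultimately show ?thesis using True C2 unfolding CC by linarith
  next
    case False
    then have Z: "2 * (\<rho> x)\<^sup>2 \<le> Z" "0 < Z" by auto
    have "\<eta> \<noteq> 0" using \<eta> by auto
    then have P\<eta>: "0 < Psi \<epsilon> (p x) \<eta>" by (rule Psi_pos[OF x\<Omega>])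
    have "\<rho> x \<noteq> 0" using Zeq Z(2) P\<eta> by auto
    moreover have "0 \<le> \<rho> x" using xc R by (simp add: \<rho>_def power2_norm_eq_inner[symmetric] dist_norm norm_minus_commute power_mono)
    ultimately have \<rho>x: "0 < \<rho> x" by simp
    define S where "S = ball c R"
    have S\<Omega>: "S \<subseteq> \<Omega>" using R(2) ball_subset_cball S_def by blast
    have S\<rho>: "y \<in> S \<longleftrightarrow> 0 < \<rho> y" for y
      unfolding S_def \<rho>_def mem_ball dist_norm power2_norm_eq_inner[symmetric] norm_minus_commute[of c]
      using R(1) by (smt (verit) norm_ge_zero power2_less_imp_less power_strict_mono zero_less_numeral)
    have xS: "x \<in> S" using \<rho>x S\<rho> by blast
    define \<kappa> where "\<kappa> y = Z / (\<rho> y)\<^sup>2 - 1" for y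
    define \<kappa>1 where "\<kappa>1 y = (4 * Z / \<rho> y ^ 3) *\<^sub>R (y - c)" for y
    define \<kappa>2 where "\<kappa>2 y = (4 * Z / \<rho> y ^ 3) *\<^sub>R mat 1 + (24 * Z / \<rho> y ^ 4) *\<^sub>R outer (y - c) (y - c)" for y
    \<comment> \<open>Rescaled from Euclidean length 1 to \<open>A\<close>-length 1.\<close>
    define \<xi>0 where "\<xi>0 = (1 / sqrt (Psi \<epsilon> (p x) \<eta>)) *\<^sub>R \<eta>"
    have unit: "Psi \<epsilon> (p x) \<xi>0 = 1" unfolding \<xi>0_def Psi_scale using P\<eta> by (simp add: power_divide)
    have Q: "e \<bullet> (H y *v e) + \<kappa> y * Psi \<epsilon> (p y) e = (Z * Psi \<epsilon> (p y) e - (\<rho> y)\<^sup>2 * (e \<bullet> (w y *v e))) / (\<rho> y)\<^sup>2"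
      if "y \<in> S" for y e
      using that unfolding S\<rho> w_form \<kappa>_def by (simp add: field_simps)
    interpret N: touching S u p H D \<epsilon> \<kappa> \<kappa>1 \<kappa>2 x \<xi>0
    proof (unfold touching_def touching_axioms_def, intro conjI allI impI)
      show "C3_jet S u p H D" by (rule C3_jet_subset[OF jet _ S\<Omega>]) (simp add: S_def)
      show "0 < \<epsilon>" by (rule eps)
      show "x \<in> S" by (rule xS)
      fix y assume y: "y \<in> S"
      show "p y \<bullet> p y < 1" using y S\<Omega> p_less by blast
      have \<rho>y: "0 < R\<^sup>2 - (y - c) \<bullet> (y - c)" using y S\<rho> by (simp add: \<rho>_def)
      show "(\<kappa> has_derivative (\<lambda>v. \<kappa>1 y \<bullet> v)) (at y)" "(\<kappa>1 has_derivative (\<lambda>v. \<kappa>2 y *v v)) (at y)" "isCont \<kappa>2 y"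
        using cutoff_derivatives[OF \<rho>y, of Z] unfolding \<kappa>_def[abs_def] \<kappa>1_def[abs_def] \<kappa>2_def[abs_def] \<rho>_def by simp_all
      show "0 \<le> \<xi> \<bullet> (H y *v \<xi>) + \<kappa> y * Psi \<epsilon> (p y) \<xi>" for \<xi>
        unfolding Q[OF y] using max[of y \<xi>] y by (intro divide_nonneg_nonneg) (auto simp: S_def)
    next
      have "(\<rho> x)\<^sup>2 * (\<xi>0 \<bullet> (w x *v \<xi>0)) = Z * Psi \<epsilon> (p x) \<xi>0"
        unfolding \<xi>0_def form_scale Psi_scale using Zeq by (simp add: mult.left_commute)
      then show "\<xi>0 \<bullet> (H x *v \<xi>0) + \<kappa> x * Psi \<epsilon> (p x) \<xi>0 = 0" unfolding Q[OF xS] by simp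
    qed
    have wmw: "N.wm y = w y" for y by (simp add: N.wm_def w_def)
    have TT: "N.T y = y - \<epsilon> *\<^sub>R ((1 / sqrt (1 - p y \<bullet> p y)) *\<^sub>R p y)" for y by (simp add: N.T_def N.sf_def)
    \<comment> \<open>\<Omega>' itself may fail to be convex; a ball around the image point carries
      the Lipschitz bound for \<open>gG\<close>.\<close>
    obtain d where d: "0 < d" "ball (N.T x) d \<subseteq> \<Omega>'" using \<Omega>'(3) T_in[OF x\<Omega>] unfolding TT by (meson openE)
    interpret E: pde S u p H D \<epsilon> \<kappa> \<kappa>1 \<kappa>2 x \<xi>0 "ball (N.T x) d" "\<lambda>y. ln (F y)" "\<lambda>y. ln (G y)" gF gG K
        "2 * ln \<epsilon> - (real CARD('n) + 2) * ln \<epsilon>"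
    proof
      show "pos_def (N.wm y)" if "y \<in> S" for y using w_pos that S\<Omega> by (auto simp: wmw)
      show "convex S" by (simp add: S_def)
      show "open (ball (N.T x) d)" by simp
      show "Psi \<epsilon> (p x) \<xi>0 = 1" by (rule unit)
      show "N.T x \<in> ball (N.T x) d" using d by simp
      show "((\<lambda>y. ln (F y)) has_derivative (\<lambda>v. gF y \<bullet> v)) (at y)" if "y \<in> S" for y using dF(1) that S\<Omega> by blast
      show "norm (gF y - gF y') \<le> K * norm (y - y')" if "y \<in> S" "y' \<in> S" for y y'
        using dF(3)[of S, OF _ S\<Omega> that] by (simp add: S_def)
      show "((\<lambda>y. ln (G y)) has_derivative (\<lambda>v. gG y \<bullet> v)) (at y)" if "y \<in> ball (N.T x) d" for y
        using dG(1) that d by blast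
      show "norm (gG y - gG y') \<le> K * norm (y - y')" if "y \<in> ball (N.T x) d" "y' \<in> ball (N.T x) d" for y y'
        using dG(3)[OF convex_ball d(2) that] .
      show "ln (det (N.wm y)) = real (CARD('n) + 2) * ln (N.sf y) + (2 * ln \<epsilon> - (real CARD('n) + 2) * ln \<epsilon>)
          + ln (F y) - ln (G (N.T y))" if "y \<in> S" for y
      proof -
        have y: "y \<in> \<Omega>" using that S\<Omega> by blast
        show ?thesis
          unfolding wmw w_def det[OF y] TT N.sf_def
          by (subst ln_det_equation[OF eps s0[OF y] pos(1)[OF y] pos(2)[OF T_in[OF y]]]) simp
      qed
    qed
    have "Z \<le> C2"
      unfolding C2_def
    proof (rule E.eigenvalue_estimate[of R c Z L C1 c3])
      show "0 < R" by (rule R)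
      show "0 < R\<^sup>2 - (x - c) \<bullet> (x - c)" using \<rho>x by (simp add: \<rho>_def)
      show "\<kappa> x = Z / (R\<^sup>2 - (x - c) \<bullet> (x - c))\<^sup>2 - 1" by (simp add: \<kappa>_def \<rho>_def)
      show "\<kappa>1 x = (4 * Z / (R\<^sup>2 - (x - c) \<bullet> (x - c)) ^ 3) *\<^sub>R (x - c)" by (simp add: \<kappa>1_def \<rho>_def)
      show "\<kappa>2 x = (4 * Z / (R\<^sup>2 - (x - c) \<bullet> (x - c)) ^ 3) *\<^sub>R mat 1
          + (24 * Z / (R\<^sup>2 - (x - c) \<bullet> (x - c)) ^ 4) *\<^sub>R outer (x - c) (x - c)" by (simp add: \<kappa>2_def \<rho>_def)
      show "2 * (R\<^sup>2 - (x - c) \<bullet> (x - c))\<^sup>2 \<le> Z" using Z by (simp add: \<rho>_def)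
      show "\<epsilon> / N.sf x \<le> L" using L[OF x\<Omega>] by (simp add: N.sf_def)
      show "0 \<le> K" by (rule K)
      show "norm (gF x) \<le> C1" by (rule dF(2)[OF x\<Omega>])
      show "norm (gG (N.T x)) \<le> C1" unfolding TT by (rule dG(2)[OF T_in[OF x\<Omega>]])
      show "0 \<le> c3" by (rule c30)
      show "det (N.wm x) \<le> c3 * det (cost_hess \<epsilon> (p x))"
      proof -
        define s where "s = sqrt (1 - p x \<bullet> p x)"
        have s: "0 < s" "s\<^sup>2 = 1 - p x \<bullet> p x" using s0[OF x\<Omega>] p_less[OF x\<Omega>] by (auto simp: s_def)
        \<comment> \<open>The prescribed determinant is that of \<open>A\<close> times the density
          ratio, so \<open>c3\<close>, a bound for this ratio, bounds the product of the
          eigenvalues.\<close>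
        have "\<epsilon>\<^sup>2 / (\<epsilon> / s) ^ (CARD('n) + 2) = (s / \<epsilon>) ^ CARD('n) * s\<^sup>2"
          using s eps by (simp add: power_add power_divide power2_eq_square)
        also have "\<dots> = det (cost_hess \<epsilon> (p x))" by (simp add: det_cost_hess s_def[symmetric] s(2))
        finally have "det (N.wm x) = det (cost_hess \<epsilon> (p x)) * (F x / G (N.T x))"
          unfolding wmw w_def det[OF x\<Omega>] TT s_def[symmetric] by simp
        also have "\<dots> \<le> det (cost_hess \<epsilon> (p x)) * c3"
          using ratio[OF x\<Omega> T_in[OF x\<Omega>]] pos_def_det_pos[OF cost_hess_pos_def[OF eps p_less[OF x\<Omega>]]]
          unfolding TT by (intro mult_left_mono) auto
        finally show ?thesis by (simp add: mult.commute)
      qed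
    qed
    then show ?thesis using R by (simp add: CC add_increasing)
  qed
  \<comment> \<open>At the centre the cutoff takes its largest value \<open>R\<^sup>2\<close>, and
    its square is \<open>R ^ 4\<close>.\<close>
  have "R ^ 4 * (\<xi> \<bullet> (w c *v \<xi>)) \<le> Z * Psi \<epsilon> (p c) \<xi>" using max[of c \<xi>] R by (simp add: \<rho>_def)
  also have "\<dots> \<le> C * Psi \<epsilon> (p c) \<xi>"
  proof (rule mult_right_mono[OF \<open>Z \<le> C\<close>])
    have "c \<in> \<Omega>" using R by auto
    then show "0 \<le> Psi \<epsilon> (p c) \<xi>"
      using Psi_pos[of c \<xi>] by (cases "\<xi> = 0") (simp_all add: less_imp_le, simp add: Psi_def)
  qed
  finally show ?thesis by (simp add: w_def)
qed

text \<open>The double sum is the trace of \<open>w\<close> against the inverse of \<open>A\<close>,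
  which equals the sum of \<open>w(f i, f i)\<close> over an \<open>A\<close>-orthonormal frame;
  each summand is at most \<open>b\<close>.\<close>

lemma Wfun_le:
  fixes A w :: "real^'n^'n" and b :: real
  assumes A: "pos_def A" and w: "transpose w = w" and b: "\<And>v. v \<bullet> (w *v v) \<le> b * (v \<bullet> (A *v v))"
  shows "(\<Sum>\<alpha>\<in>UNIV. \<Sum>\<beta>\<in>UNIV. matrix_inv A $ \<alpha> $ \<beta> * w $ \<alpha> $ \<beta>) \<le> CARD('n) * b"
proof -
  obtain f :: "'n \<Rightarrow> real^'n" and l where f: "\<And>i j. f i \<bullet> (A *v f j) = (if i = j then 1 else 0)"
    "\<And>i j. f i \<bullet> (w *v f j) = (if i = j then l i else 0)"
    using simultaneous_diag[OF A w] by blast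
  let ?F = "of_columns f"
  have "invertible A" using orthonormal_columns(2,3)[OF f(1)] unfolding invertible_def by blast
  then have left: "matrix_inv A ** A = mat 1"
    unfolding invertible_def matrix_inv_def by (rule someI2_ex) blast
  have "matrix_inv A = matrix_inv A ** (A ** (?F ** transpose ?F))"
    by (simp add: orthonormal_columns(3)[OF f(1)])
  also have "\<dots> = ?F ** transpose ?F"
    using left by (simp add: matrix_mul_assoc)
  finally have inv: "matrix_inv A $ \<alpha> $ \<beta> = (\<Sum>i\<in>UNIV. f i $ \<alpha> * f i $ \<beta>)" for \<alpha> \<beta>
    by (simp add: matrix_matrix_mult_def transpose_def of_columns_def)
  have "(\<Sum>\<alpha>\<in>UNIV. \<Sum>\<beta>\<in>UNIV. matrix_inv A $ \<alpha> $ \<beta> * w $ \<alpha> $ \<beta>)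
      = (\<Sum>\<alpha>\<in>UNIV. \<Sum>\<beta>\<in>UNIV. \<Sum>i\<in>UNIV. f i $ \<alpha> * (w $ \<alpha> $ \<beta> * f i $ \<beta>))"
    by (simp add: inv sum_distrib_right) (simp add: mult_ac)
  also have "\<dots> = (\<Sum>\<alpha>\<in>UNIV. \<Sum>i\<in>UNIV. \<Sum>\<beta>\<in>UNIV. f i $ \<alpha> * (w $ \<alpha> $ \<beta> * f i $ \<beta>))"
    by (intro sum.cong refl sum.swap)
  also have "\<dots> = (\<Sum>i\<in>UNIV. \<Sum>\<alpha>\<in>UNIV. \<Sum>\<beta>\<in>UNIV. f i $ \<alpha> * (w $ \<alpha> $ \<beta> * f i $ \<beta>))"
    by (rule sum.swap)
  also have "\<dots> = (\<Sum>i\<in>UNIV. f i \<bullet> (w *v f i))"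
    by (simp add: inner_vec_def matrix_vector_mult_def sum_distrib_left)
  also have "\<dots> \<le> (\<Sum>i\<in>(UNIV :: 'n set). b)"
    using b[of "f i" for i] f(1) by (intro sum_mono) (metis mult.right_neutral)
  finally show ?thesis by simp
qed

theorem theorem1:
  fixes \<Omega> \<Omega>' :: "(real^'n) set" and f g :: "real^'n \<Rightarrow> real" and \<delta> :: real
  assumes "CARD('n) \<ge> 2"
    and "domain_set \<Omega>" and "bounded \<Omega>"
    and "domain_set \<Omega>'" and "bounded \<Omega>'"
    and "C11_on \<Omega> f" and "\<exists>m>0. \<exists>M. \<forall>x\<in>\<Omega>. m \<le> f x \<and> f x \<le> M"
    and "C11_on \<Omega>' g" and "\<exists>m>0. \<exists>M. \<forall>y\<in>\<Omega>'. m \<le> g y \<and> g y \<le> M"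
    and "(LINT x:\<Omega>|lebesgue. f x) = (LINT y:\<Omega>'|lebesgue. g y)"
    and "\<delta> > 0"
  shows "\<exists>C::real. \<forall>(\<epsilon>::real) (u :: real^'n \<Rightarrow> real).
           0 < \<epsilon> \<and> \<epsilon> \<le> 1 \<and>
           C31_on \<Omega> u \<and> cost_concave \<epsilon> \<Omega> \<Omega>' u \<and>
           (\<forall>x\<in>\<Omega>. Tmap \<epsilon> u x \<in> \<Omega>') \<and>
           (\<forall>x\<in>\<Omega>. det (wmat \<epsilon> u x) =
                    \<epsilon>\<^sup>2 / Lfun \<epsilon> u x ^ (CARD('n) + 2) * (f x / g (Tmap \<epsilon> u x)))
           \<longrightarrow> (\<forall>x\<in>\<Omega>. \<delta> \<le> infdist x (frontier \<Omega>) \<longrightarrow> Wfun \<epsilon> u x \<le> C)"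
proof -
  have \<Omega>: "open \<Omega>" and \<Omega>': "open \<Omega>'" "\<Omega>' \<noteq> {}" using assms(2,4) by (auto simp: domain_set_def)
  obtain m M where f: "0 < m" "\<And>x. x \<in> \<Omega> \<Longrightarrow> m \<le> f x" "\<And>x. x \<in> \<Omega> \<Longrightarrow> f x \<le> M" using assms(7) by blast
  obtain m' where g: "0 < m'" "\<And>x. x \<in> \<Omega>' \<Longrightarrow> m' \<le> g x" using assms(9) by blast
  obtain Cf Kf where Cf: "0 \<le> Cf" "0 \<le> Kf"
    "\<And>x. x \<in> \<Omega> \<Longrightarrow> ((\<lambda>x. ln (f x)) has_derivative (\<lambda>v. ((1 / f x) *\<^sub>R grad f x) \<bullet> v)) (at x)"
    "\<And>x. x \<in> \<Omega> \<Longrightarrow> norm ((1 / f x) *\<^sub>R grad f x) \<le> Cf"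
    "\<And>U x y. convex U \<Longrightarrow> U \<subseteq> \<Omega> \<Longrightarrow> x \<in> U \<Longrightarrow> y \<in> U \<Longrightarrow>
       norm ((1 / f x) *\<^sub>R grad f x - (1 / f y) *\<^sub>R grad f y) \<le> Kf * norm (x - y)"
    by (rule C11_log_gradient[OF \<Omega> assms(6) f(1,2)]) (assumption | rule that)+
  obtain Cg Kg where Cg: "0 \<le> Cg" "0 \<le> Kg"
    "\<And>x. x \<in> \<Omega>' \<Longrightarrow> ((\<lambda>x. ln (g x)) has_derivative (\<lambda>v. ((1 / g x) *\<^sub>R grad g x) \<bullet> v)) (at x)"
    "\<And>x. x \<in> \<Omega>' \<Longrightarrow> norm ((1 / g x) *\<^sub>R grad g x) \<le> Cg"
    "\<And>U x y. convex U \<Longrightarrow> U \<subseteq> \<Omega>' \<Longrightarrow> x \<in> U \<Longrightarrow> y \<in> U \<Longrightarrow>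
       norm ((1 / g x) *\<^sub>R grad g x - (1 / g y) *\<^sub>R grad g y) \<le> Kg * norm (x - y)"
    by (rule C11_log_gradient[OF \<Omega>'(1) assms(8) g(1,2)]) (assumption | rule that)+
  define C1 where "C1 = max Cf Cg"
  define K where "K = max Kf Kg"
  obtain d where d: "\<And>x. x \<in> \<Omega> \<union> \<Omega>' \<Longrightarrow> norm x \<le> d"
    using bounded_Un[of \<Omega> \<Omega>'] assms(3,5) unfolding bounded_iff by blast
  \<comment> \<open>Bounds \<open>sqrt (\<epsilon>\<^sup>2 + |x - T x|\<^sup>2)\<close> uniformly:
    \<epsilon> is at most 1, and \<open>x\<close> and \<open>T x\<close> have norm at most
    \<open>d\<close>.\<close>
  define L where "L = sqrt (1 + (2 * d)\<^sup>2)"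
  \<comment> \<open>Half of \<delta>, so that the closed ball around the point lies in the open ball
    of radius \<delta>, which is contained in \<Omega>.\<close>
  define R where "R = \<delta> / 2"
  have R: "0 < R" using assms(11) by (simp add: R_def)
  define C where "C = 2 * R ^ 4 + (4 * (28 * R\<^sup>2 * L\<^sup>2 + (2 * L + C1 * L\<^sup>2) * (4 * R ^ 3))
      + M / m' * (4 * (2 * CARD('n) + (7 * C1 * L + 4 * K * L\<^sup>2))) ^ (CARD('n) - 1) * R ^ 4)"
  show ?thesis
  \<comment> \<open>Each eigenvalue of \<open>w\<close> relative to \<open>A\<close> at the centre
    is at most \<open>C / R ^ 4\<close>, and \<open>W\<close> is the sum of \<open>CARD('n)\<close>
    of them.\<close>
  proof (intro exI[of _ "CARD('n) * (C / R ^ 4)"] allI impI ballI)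
    fix \<epsilon> u c
    assume u: "0 < \<epsilon> \<and> \<epsilon> \<le> 1 \<and> C31_on \<Omega> u \<and> cost_concave \<epsilon> \<Omega> \<Omega>' u \<and> (\<forall>x\<in>\<Omega>. Tmap \<epsilon> u x \<in> \<Omega>') \<and>
           (\<forall>x\<in>\<Omega>. det (wmat \<epsilon> u x) = \<epsilon>\<^sup>2 / Lfun \<epsilon> u x ^ (CARD('n) + 2) * (f x / g (Tmap \<epsilon> u x)))"
      and c: "c \<in> \<Omega>" "\<delta> \<le> infdist c (frontier \<Omega>)"
    have eps: "0 < \<epsilon>" "\<epsilon> \<le> 1" and cc: "cost_concave \<epsilon> \<Omega> \<Omega>' u" using u by auto
    let ?p = "grad u"
    have jet: "C3_jet \<Omega> u ?p (hessian u) (\<lambda>k x. \<chi> i j. partial k (partial j (partial i u)) x)"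
      using u by (intro Ck_on_3_jet \<Omega>) (simp add: C31_on_def)
    interpret J: C3_jet \<Omega> u ?p "hessian u" "\<lambda>k x. \<chi> i j. partial k (partial j (partial i u)) x" by (rule jet)
    have p_less: "?p x \<bullet> ?p x < 1" if "x \<in> \<Omega>" for x
      by (rule J.cost_concave_jet(1)[OF eps(1) cc assms(5) \<Omega>'(2) that])
    have Leq: "Lfun \<epsilon> u x = \<epsilon> / sqrt (1 - ?p x \<bullet> ?p x)" for x by (simp add: Lfun_def power2_norm_eq_inner)
    have Teq: "x - \<epsilon> *\<^sub>R ((1 / sqrt (1 - ?p x \<bullet> ?p x)) *\<^sub>R ?p x) = Tmap \<epsilon> u x" for x by (simp add: Tmap_def Leq)
    have weq: "cost_hess \<epsilon> (?p x) - hessian u x = wmat \<epsilon> u x" for x by (simp add: wmat_def Amat_eq_cost_hess)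
    have Lb: "\<epsilon> / sqrt (1 - ?p x \<bullet> ?p x) \<le> L" if x: "x \<in> \<Omega>" for x
    proof -
      let ?L = "\<epsilon> / sqrt (1 - ?p x \<bullet> ?p x)"
      have "?L\<^sup>2 * (1 - ?p x \<bullet> ?p x) = \<epsilon>\<^sup>2" using p_less[OF x] by (simp add: power_divide)
      then have "?L\<^sup>2 = \<epsilon>\<^sup>2 + ?L\<^sup>2 * (?p x \<bullet> ?p x)" by (simp add: algebra_simps)
      also have "?L\<^sup>2 * (?p x \<bullet> ?p x) = (norm (x - Tmap \<epsilon> u x))\<^sup>2"
        unfolding Tmap_def Leq by (simp add: power_mult_distrib power2_norm_eq_inner[symmetric] power_divide)
      also have "\<dots> \<le> (2 * d)\<^sup>2"
        using d[of x] d[of "Tmap \<epsilon> u x"] x u norm_triangle_ineq4[of x "Tmap \<epsilon> u x"] by (intro power_mono) auto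
      finally have "?L\<^sup>2 \<le> 1 + (2 * d)\<^sup>2" using eps power_mono[of \<epsilon> 1 2] by simp
      then show ?thesis unfolding L_def by (rule real_le_rsqrt)
    qed
    have "cball c R \<subseteq> ball c \<delta>" using assms(11) by (auto simp: R_def)
    then have cR: "cball c R \<subseteq> \<Omega>" using ball_in_domain[OF \<Omega> assms(3) c] by blast
    have bound: "R ^ 4 * (\<xi> \<bullet> (wmat \<epsilon> u c *v \<xi>)) \<le> C * Psi \<epsilon> (?p c) \<xi>" for \<xi>
      unfolding C_def
    proof (rule interior_bound[OF jet eps(1) cc assms(5) \<Omega>'(2,1) R cR Lb, unfolded Teq weq])
      show "Tmap \<epsilon> u x \<in> \<Omega>'" if "x \<in> \<Omega>" for x using u that by blast
      show "0 < f x" if "x \<in> \<Omega>" for x using f that by (meson less_le_trans)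
      show "0 < g y" if "y \<in> \<Omega>'" for y using g that by (meson less_le_trans)
      show "f x / g y \<le> M / m'" if "x \<in> \<Omega>" "y \<in> \<Omega>'" for x y
        using f(1) f(2,3)[OF that(1)] g(1) g(2)[OF that(2)] by (intro frac_le) auto
      show "det (wmat \<epsilon> u x) = \<epsilon>\<^sup>2 / (\<epsilon> / sqrt (1 - ?p x \<bullet> ?p x)) ^ (CARD('n) + 2) * (f x / g (Tmap \<epsilon> u x))"
        if "x \<in> \<Omega>" for x using u that by (simp add: Leq)
      show "((\<lambda>x. ln (f x)) has_derivative (\<lambda>v. ((1 / f x) *\<^sub>R grad f x) \<bullet> v)) (at x)" if "x \<in> \<Omega>" for x
        by (rule Cf(3)[OF that])
      show "norm ((1 / f x) *\<^sub>R grad f x) \<le> C1" if "x \<in> \<Omega>" for x using Cf(4)[OF that] by (simp add: C1_def)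
      show "norm ((1 / f x) *\<^sub>R grad f x - (1 / f y) *\<^sub>R grad f y) \<le> K * norm (x - y)"
        if "convex U" "U \<subseteq> \<Omega>" "x \<in> U" "y \<in> U" for U x y
        using Cf(5)[OF that] by (rule order_trans) (simp add: K_def mult_right_mono)
      show "((\<lambda>x. ln (g x)) has_derivative (\<lambda>v. ((1 / g x) *\<^sub>R grad g x) \<bullet> v)) (at x)" if "x \<in> \<Omega>'" for x
        by (rule Cg(3)[OF that])
      show "norm ((1 / g x) *\<^sub>R grad g x) \<le> C1" if "x \<in> \<Omega>'" for x using Cg(4)[OF that] by (simp add: C1_def)
      show "norm ((1 / g x) *\<^sub>R grad g x - (1 / g y) *\<^sub>R grad g y) \<le> K * norm (x - y)"
        if "convex U" "U \<subseteq> \<Omega>'" "x \<in> U" "y \<in> U" for U x y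
        using Cg(5)[OF that] by (rule order_trans) (simp add: K_def mult_right_mono)
      show "0 \<le> K" using Cf(2) by (simp add: K_def)
    qed
    show "Wfun \<epsilon> u c \<le> CARD('n) * (C / R ^ 4)"
      unfolding Wfun_def
    proof (rule Wfun_le)
      show "pos_def (Amat \<epsilon> u c)" unfolding Amat_eq_cost_hess by (rule cost_hess_pos_def[OF eps(1) p_less[OF c(1)]])
      show "transpose (wmat \<epsilon> u c) = wmat \<epsilon> u c"
        using J.H_sym[OF c(1)] cost_hess_sym[of \<epsilon> "?p c"] by (simp add: weq[symmetric] transpose_def vec_eq_iff)
      show "v \<bullet> (wmat \<epsilon> u c *v v) \<le> C / R ^ 4 * (v \<bullet> (Amat \<epsilon> u c *v v))" for v
        using bound[of v] R unfolding Amat_eq_cost_hess cost_hess_Psi by (simp add: field_simps)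
    qed
  qed
qed

end
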